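(* Consider the covariance regression model and Assumptions (A1), (A2), (A3), (A5) described in the context, and suppose they hold. Let $\hat\beta$ be an estimator of $\beta_0$ satisfying $\sqrt{np}(\hat\beta-\beta_0)\stackrel{d}\longrightarrow Z$, where $Z$ follows a $K$-dimensional multivariate normal distribution. Then for any fixed $i$, as $p\to\infty$, and with $n$ either fixed or going to infinity, $$n\,\|C_{\hat\beta}(X_i)-C_{\beta_0}(X_i)\|_F^2\stackrel{d}\longrightarrow Z^\top Q_{0,i}Z\quad\text{and}\quad n\,\|C_{\hat\beta}^{-1}(X_i)-C_{\beta_0}^{-1}(X_i)\|_F^2\stackrel{d}\longrightarrow Z^\top Q_{-2,i}Z,$$ given that $C_{\hat\beta}(X_i)$ is invertible almost surely.
   Context: **Model.** On a probability space $(\Omega,\mathcal F,\mathrm P)$, for $i=1,\dots,n$, $Y_i$ is a $p$-dimensional random response vector and $X_i$ is a random explanatory variable (a vector, matrix or tensor; the $X_i$ are not assumed independent or identically distributed). Let $\mathcal F_{\mathcal X}=\sigma\langle X_1,\dots,X_n\rangle$. $C_\beta(\cdot)$ is a pre-specified measurable map with values in the positive definite $p\times p$ matrices, indexed by $\beta=(\beta^{(1)},\dots,\beta^{(K)})^\top\in\mathbb R^K$, and $\mathrm{Cov}[Y_i|\mathcal F_{\mathcal X}]=C_{\beta_0}(X_i)$ for $i=1,\dots,n$, with $\beta_0$ the true parameter. $\|\cdot\|_F$ is the Frobenius norm. **Norms.** For $1\le\zeta\le\infty$, $\|\cdot\|_\zeta$ is the vector $\zeta$-norm or its induced matrix (operator)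 $\zeta$-norm. For a random matrix $Z=(z_{k_1k_2})$, $\|z_{k_1k_2}\|_{L^\zeta}=(\mathrm E|z_{k_1k_2}|^\zeta)^{1/\zeta}$, $\|Z\|_{L^\zeta}$ is the matrix with entries $\|z_{k_1k_2}\|_{L^\zeta}$, and $|||Z|||_{L^{\zeta_1},\zeta_2}=\big\|\,\|Z\|_{L^{\zeta_1}}\big\|_{\zeta_2}$. $|Z|$ is the entrywise absolute value and $\sup_{\beta}|Z(\beta)|$ is the entrywise supremum. $\partial g(\beta_0)/\partial\beta^{(k)}$ denotes the derivative evaluated at $\beta_0$. $(a_{k_1k_2})_{K\times K}$ denotes the matrix with these entries. **(A1)** $Y_i=C_{\beta_0}^{1/2}(X_i)\mathcal E_i$, $i=1,\dots,n$, where $C_{\beta_0}^{1/2}(X_i)$ is the symmetric square root of $C_{\beta_0}(X_i)$, $\mathcal E_i=(\varepsilon_{i1},\dots,\varepsilon_{ip})^\top$, the $\varepsilon_{ij}$ are conditionally independent relative to $\mathcal F_{\mathcal X}$ in both $i$ and $j$, $\mathrm E[\varepsilon_{ij}|\mathcal F_{\mathcal X}]=0$ and $\mathrm E[\varepsilon_{ij}^2|\mathcal F_{\mathcal X}]=1$ for all $i,j$. There is a finite constant $\eta_1>0$ with $\sup_{i,j}\mathrm E|\varepsilon_{ij}|^{4+\eta_1}<\infty$. **(A2)** For $i=1,\dots,n$, $C_\beta(X_i)$ is an indexed series of positive definite matrices, uniformly over $\beta$ in a compact parameter space $\mathfrak B\subset\mathbb R^K$, $K<\infty$ (fixed), and $\beta_0$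 is an interior point of $\mathfrak B$. $C_\beta(x_i)$ is three times differentiable with respect to $\beta$ for $P_{X_i}$-almost every $x_i$, where $P_{X_i}=\mathrm P\circ X_i^{-1}$, and $C_\beta(x_i)$ and its first three derivatives in $\beta$ are measurable functions of $x_i$. **(A3)** There exists a finite $\eta_2>8/\eta_1$ such that, for any $k,k_1,k_2,k_3\in\{1,\dots,K\}$, the following are all finite: $\sup_{p\ge1}\sup_i|||C_{\beta_0}^{1/2}(X_i)|||_{L^{\delta_c(2+\eta_2)},1}$, $\sup_{p\ge1}\sup_i|||\sup_{\beta\in\mathfrak B}|C_\beta^{-1}(X_i)|\,|||_{L^{\delta_0(2+\eta_2)},1}$, $\sup_{p\ge1}\sup_i|||\sup_{\beta\in\mathfrak B}|\partial C_\beta(X_i)/\partial\beta^{(k)}|\,|||_{L^{\delta_1(2+\eta_2)},1}$, $\sup_{p\ge1}\sup_i|||\sup_{\beta\in\mathfrak B}|\partial^2C_\beta(X_i)/(\partial\beta^{(k_1)}\partial\beta^{(k_2)})|\,|||_{L^{\delta_2(2+\eta_2)},1}$, and $\sup_{p\ge1}\sup_i|||\sup_{\beta\in\mathfrak B}|\partial^3C_\beta(X_i)/(\partial\beta^{(k_1)}\partial\beta^{(k_2)}\partial\beta^{(k_3)})|\,|||_{L^{\delta_3(2+\eta_2)},1}$, for some $\delta_c,\delta_0,\delta_1,\delta_2,\delta_3\in(0,\infty)$ satisfying $$\max\Big\{\tfrac2{\delta_c}+\tfrac4{\delta_0}+\tfrac3{\delta_1},\ \tfrac2{\delta_c}+\tfrac3{\delta_0}+\tfrac1{\delta_1}+\tfrac1{\delta_2},\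 \tfrac2{\delta_c}+\tfrac2{\delta_0}+\tfrac1{\delta_3}\Big\}\le1 .$$ **(A5)** For any fixed $i$, as $p\to\infty$, $$p^{-1}\Big(\mathrm{tr}\Big\{C_{\beta_0}^l(X_i)\frac{\partial C_{\beta_0}(X_i)}{\partial\beta^{(k_1)}}C_{\beta_0}^l(X_i)\frac{\partial C_{\beta_0}(X_i)}{\partial\beta^{(k_2)}}\Big\}\Big)_{K\times K}\stackrel{\mathrm P}\longrightarrow Q_{l,i}$$ for $l=-2$ and $l=0$, where $C_{\beta_0}^0(X_i)=I_p$. *)

theory Defs
  imports "HOL-Probability.Probability" "Jordan_Normal_Form.Gauss_Jordan_Elimination"
begin

text \<open>
  The matrix dimension varies along the asymptotics, so \<open>p \<times> p\<close> matrices are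
  elements of \<^typ>\<open>real mat\<close> from \<open>Jordan_Normal_Form\<close>, with row and column indices
  \<open>0, \<dots>, p - 1\<close>. The parameter dimension \<open>K\<close> is fixed and is a finite type \<open>'k\<close>; parameters are
  vectors of \<open>HOL-Analysis\<close>, whose components are written with \<open>vec_nth\<close> because \<open>$\<close> now
  belongs to \<open>Jordan_Normal_Form\<close>.

  The asymptotics run over stages \<open>t :: nat\<close> with sample size \<open>n t\<close> and response dimension
  \<open>p t\<close>, and all data and the covariance map may depend on the stage (triangular array).
  Observations are numbered \<open>1, \<dots>, n t\<close>.
\<close>

no_notation vec_nth (infixl \<open>$\<close> 90)
no_notation scalar_prod (infix \<open>\<bullet>\<close> 70)
hide_type (open) Finite_Cartesian_Product.vec
hide_const (open) Finite_Cartesian_Product.vec Finite_Cartesian_Product.mat Finite_Cartesian_Product.row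


section \<open>Matrices\<close>

definition pos_def :: "nat \<Rightarrow> real mat \<Rightarrow> bool" where
  "pos_def p A \<longleftrightarrow> A \<in> carrier_mat p p \<and> transpose_mat A = A \<and>
     (\<forall>v\<in>carrier_vec p. v \<noteq> 0\<^sub>v p \<longrightarrow> scalar_prod v (A *\<^sub>v v) > 0)"

text \<open>A positive definite matrix has several symmetric square roots; as usual the positive
  definite one is meant.\<close>

definition mat_sqrt :: "real mat \<Rightarrow> real mat" where
  "mat_sqrt A = (THE S. pos_def (dim_row A) S \<and> S * S = A)"

definition inv_mat :: "real mat \<Rightarrow> real mat" where
  "inv_mat A = (case mat_inverse A of Some B \<Rightarrow> B | None \<Rightarrow> 0\<^sub>m (dim_row A) (dim_col A))"

definition mat_powi :: "real mat \<Rightarrow> int \<Rightarrow> real mat" where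
  "mat_powi A l = (if l \<ge> 0 then A ^\<^sub>m nat l else inv_mat A ^\<^sub>m nat (- l))"

definition trace_mat :: "real mat \<Rightarrow> real" where
  "trace_mat A = (\<Sum>j<dim_row A. A $$ (j, j))"

definition frobenius_norm :: "real mat \<Rightarrow> real" where
  "frobenius_norm A = sqrt (\<Sum>j<dim_row A. \<Sum>l<dim_col A. (A $$ (j, l))\<^sup>2)"

definition vec_norm :: "real \<Rightarrow> real vec \<Rightarrow> real" where
  "vec_norm \<zeta> v = (\<Sum>j<dim_vec v. \<bar>v $ j\<bar> powr \<zeta>) powr (1 / \<zeta>)"

definition induced_norm :: "real \<Rightarrow> real mat \<Rightarrow> ennreal" where
  "induced_norm \<zeta> A =
     (SUP v\<in>{v \<in> carrier_vec (dim_col A). vec_norm \<zeta> v = 1}. ennreal (vec_norm \<zeta> (A *\<^sub>v v)))"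


section \<open>Norms of random matrices\<close>

text \<open>The \<open>L\<^sup>\<zeta>\<close> norm of a nonnegative extended-valued function; extended values are needed since a
  supremum over the parameter space may be infinite. Here \<open>a > 0\<close> and \<open>0 < \<zeta> < \<infinity>\<close>.\<close>

definition ennpowr :: "ennreal \<Rightarrow> real \<Rightarrow> ennreal" where
  "ennpowr x a = (if x = \<infinity> then \<infinity> else ennreal (enn2real x powr a))"

definition L_norm :: "'a measure \<Rightarrow> real \<Rightarrow> ('a \<Rightarrow> ennreal) \<Rightarrow> ennreal" where
  "L_norm M \<zeta> f = ennpowr (\<integral>\<^sup>+\<omega>. ennpowr (f \<omega>) \<zeta> \<partial>M) (1 / \<zeta>)"

text \<open>The mixed norm of a random \<open>p \<times> p\<close> matrix, given through the absolute values
  \<open>Z j l\<close> of its entries; it is infinite as soon as one entry has infinite \<open>L\<close> norm.\<close>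

definition mixed_norm :: "'a measure \<Rightarrow> nat \<Rightarrow> real \<Rightarrow> real \<Rightarrow> (nat \<Rightarrow> nat \<Rightarrow> 'a \<Rightarrow> ennreal) \<Rightarrow> ennreal" where
  "mixed_norm M p \<zeta>1 \<zeta>2 Z =
     (if \<forall>j<p. \<forall>l<p. L_norm M \<zeta>1 (Z j l) < \<infinity>
      then induced_norm \<zeta>2 (mat p p (\<lambda>(j, l). enn2real (L_norm M \<zeta>1 (Z j l))))
      else \<infinity>)"

text \<open>Entrywise absolute value, and entrywise supremum over \<open>\<beta> \<in> B\<close> of the absolute value.\<close>

definition abs_entry :: "('a \<Rightarrow> real mat) \<Rightarrow> nat \<Rightarrow> nat \<Rightarrow> 'a \<Rightarrow> ennreal" where
  "abs_entry Z j l \<omega> = ennreal \<bar>Z \<omega> $$ (j, l)\<bar>"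

definition sup_abs_entry :: "'b set \<Rightarrow> ('b \<Rightarrow> 'a \<Rightarrow> real mat) \<Rightarrow> nat \<Rightarrow> nat \<Rightarrow> 'a \<Rightarrow> ennreal" where
  "sup_abs_entry B Z j l \<omega> = (SUP \<beta>\<in>B. ennreal \<bar>Z \<beta> \<omega> $$ (j, l)\<bar>)"

definition measurable_mat :: "'a measure \<Rightarrow> nat \<Rightarrow> ('a \<Rightarrow> real mat) \<Rightarrow> bool" where
  "measurable_mat M p Z \<longleftrightarrow> (\<forall>\<omega>\<in>space M. Z \<omega> \<in> carrier_mat p p) \<and>
     (\<forall>j<p. \<forall>l<p. (\<lambda>\<omega>. Z \<omega> $$ (j, l)) \<in> borel_measurable M)"


section \<open>Probabilistic notions\<close>

text \<open>\<open>\<sigma>\<langle>X\<^sub>1, \<dots>, X\<^sub>n\<rangle>\<close>\<close>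

definition sigma_gen :: "'a measure \<Rightarrow> 'x measure \<Rightarrow> nat \<Rightarrow> (nat \<Rightarrow> 'a \<Rightarrow> 'x) \<Rightarrow> 'a measure" where
  "sigma_gen M S n X =
     sigma (space M) (\<Union>i\<in>{1..n}. {X i -` A \<inter> space M | A. A \<in> sets S})"

definition cond_cov :: "'a measure \<Rightarrow> 'a measure \<Rightarrow> ('a \<Rightarrow> real) \<Rightarrow> ('a \<Rightarrow> real) \<Rightarrow> 'a \<Rightarrow> real" where
  "cond_cov M F U V =
     real_cond_exp M F (\<lambda>\<omega>. (U \<omega> - real_cond_exp M F U \<omega>) * (V \<omega> - real_cond_exp M F V \<omega>))"

text \<open>Conditional independence of a finite family; the product formula for subfamilies is the
  case \<open>A i = UNIV\<close> for the omitted indices.\<close>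

definition cond_indep :: "'a measure \<Rightarrow> 'a measure \<Rightarrow> 'i set \<Rightarrow> ('i \<Rightarrow> 'a \<Rightarrow> real) \<Rightarrow> bool" where
  "cond_indep M F I U \<longleftrightarrow>
     (\<forall>A. (\<forall>i\<in>I. A i \<in> sets borel) \<longrightarrow>
       (AE \<omega> in M. real_cond_exp M F (\<lambda>\<omega>'. \<Prod>i\<in>I. indicator (A i) (U i \<omega>')) \<omega> =
                   (\<Prod>i\<in>I. real_cond_exp M F (\<lambda>\<omega>'. indicator (A i) (U i \<omega>')) \<omega>)))"

definition conv_in_prob :: "'a measure \<Rightarrow> (nat \<Rightarrow> 'a \<Rightarrow> 'b::metric_space) \<Rightarrow> 'b \<Rightarrow> bool" where
  "conv_in_prob M U c \<longleftrightarrow>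
     (\<forall>\<epsilon>>0. (\<lambda>t. measure M {\<omega> \<in> space M. dist (U t \<omega>) c > \<epsilon>}) \<longlonglongrightarrow> 0)"

text \<open>Convergence in distribution of random vectors. \<^const>\<open>weak_conv_m\<close> covers the real line
  only. The limit may live on a different probability space \<open>N\<close>.\<close>

definition conv_in_dist ::
  "'a measure \<Rightarrow> (nat \<Rightarrow> 'a \<Rightarrow> 'b::topological_space) \<Rightarrow> 'c measure \<Rightarrow> ('c \<Rightarrow> 'b) \<Rightarrow> bool" where
  "conv_in_dist M U N Z \<longleftrightarrow>
     (\<forall>f :: 'b \<Rightarrow> real. continuous_on UNIV f \<and> bounded (range f) \<longrightarrow>
        (\<lambda>t. \<integral>\<omega>. f (U t \<omega>) \<partial>M) \<longlonglongrightarrow> (\<integral>\<omega>. f (Z \<omega>) \<partial>N))"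

text \<open>All linear functionals are normal, with variance zero allowed; so the covariance matrix may
  be singular and the mean need not vanish.\<close>

definition multivariate_normal :: "'c measure \<Rightarrow> ('c \<Rightarrow> real ^ 'k) \<Rightarrow> bool" where
  "multivariate_normal N Z \<longleftrightarrow> Z \<in> borel_measurable N \<and>
     (\<forall>a. \<exists>\<mu> \<sigma>. \<sigma> \<ge> 0 \<and>
        (if \<sigma> = 0 then AE \<omega> in N. a \<bullet> Z \<omega> = \<mu>
         else distributed N lborel (\<lambda>\<omega>. a \<bullet> Z \<omega>) (normal_density \<mu> \<sigma>)))"


section \<open>The covariance regression model and its assumptions\<close>

text \<open>
  Naming of the variables: \<open>S t\<close> is the measurable space in which the explanatory variables
  \<open>X t i\<close> take values, \<open>C t \<beta> x\<close> is \<open>C\<^sub>\<beta>(x)\<close> and \<open>B\<close> is the parameter space.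
\<close>

definition cov_reg_model ::
  "'a measure \<Rightarrow> (nat \<Rightarrow> 'x measure) \<Rightarrow> (nat \<Rightarrow> nat) \<Rightarrow> (nat \<Rightarrow> nat) \<Rightarrow>
   (nat \<Rightarrow> nat \<Rightarrow> 'a \<Rightarrow> real vec) \<Rightarrow> (nat \<Rightarrow> nat \<Rightarrow> 'a \<Rightarrow> 'x) \<Rightarrow>
   (nat \<Rightarrow> real ^ 'k \<Rightarrow> 'x \<Rightarrow> real mat) \<Rightarrow> real ^ 'k \<Rightarrow> bool" where
  "cov_reg_model M S n p Y X C \<beta>0 \<longleftrightarrow>
     prob_space M \<and>
     (\<forall>t. n t \<ge> 1 \<and> p t \<ge> 1) \<and>
     (\<forall>t \<beta>. measurable_mat (S t) (p t) (C t \<beta>)) \<and>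
     (\<forall>t. \<forall>i\<in>{1..n t}.
        X t i \<in> measurable M (S t) \<and>
        (\<forall>\<omega>\<in>space M. Y t i \<omega> \<in> carrier_vec (p t)) \<and>
        (\<forall>j<p t. (\<lambda>\<omega>. Y t i \<omega> $ j) \<in> borel_measurable M) \<and>
        (\<forall>j<p t. \<forall>l<p t. AE \<omega> in M.
           cond_cov M (sigma_gen M (S t) (n t) (X t)) (\<lambda>\<omega>'. Y t i \<omega>' $ j) (\<lambda>\<omega>'. Y t i \<omega>' $ l) \<omega> =
           C t \<beta>0 (X t i \<omega>) $$ (j, l)))"

text \<open>\<open>\<epsilon> t i j\<close> is the noise variable \<open>\<epsilon>\<^bsub>i,j+1\<^esub>\<close>. The constant \<open>\<eta>1\<close> is a parameter since it also
  occurs in \<open>A3\<close>.\<close>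

definition A1 ::
  "'a measure \<Rightarrow> (nat \<Rightarrow> 'x measure) \<Rightarrow> (nat \<Rightarrow> nat) \<Rightarrow> (nat \<Rightarrow> nat) \<Rightarrow>
   (nat \<Rightarrow> nat \<Rightarrow> 'a \<Rightarrow> real vec) \<Rightarrow> (nat \<Rightarrow> nat \<Rightarrow> 'a \<Rightarrow> 'x) \<Rightarrow>
   (nat \<Rightarrow> real ^ 'k \<Rightarrow> 'x \<Rightarrow> real mat) \<Rightarrow> real ^ 'k \<Rightarrow>
   (nat \<Rightarrow> nat \<Rightarrow> nat \<Rightarrow> 'a \<Rightarrow> real) \<Rightarrow> real \<Rightarrow> bool" where
  "A1 M S n p Y X C \<beta>0 \<epsilon> \<eta>1 \<longleftrightarrow>
     (\<forall>t. \<forall>i\<in>{1..n t}. AE \<omega> in M.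
        Y t i \<omega> = mat_sqrt (C t \<beta>0 (X t i \<omega>)) *\<^sub>v vec (p t) (\<lambda>j. \<epsilon> t i j \<omega>)) \<and>
     (\<forall>t. cond_indep M (sigma_gen M (S t) (n t) (X t)) ({1..n t} \<times> {..<p t})
        (\<lambda>(i, j). \<epsilon> t i j)) \<and>
     (\<forall>t. \<forall>i\<in>{1..n t}. \<forall>j<p t.
        \<epsilon> t i j \<in> borel_measurable M \<and>
        (AE \<omega> in M. real_cond_exp M (sigma_gen M (S t) (n t) (X t)) (\<epsilon> t i j) \<omega> = 0) \<and>
        (AE \<omega> in M. real_cond_exp M (sigma_gen M (S t) (n t) (X t)) (\<lambda>\<omega>'. (\<epsilon> t i j \<omega>')\<^sup>2) \<omega> = 1)) \<and>
     \<eta>1 > 0 \<and>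
     (SUP t. SUP i\<in>{1..n t}. SUP j\<in>{..<p t}.
        \<integral>\<^sup>+\<omega>. ennreal (\<bar>\<epsilon> t i j \<omega>\<bar> powr (4 + \<eta>1)) \<partial>M) < \<infinity>"

text \<open>
  \<open>dC t [k\<^sub>1, \<dots>, k\<^sub>m] \<beta> x\<close> stands for the partial derivative of \<open>C\<^sub>\<beta>(x)\<close> with respect to
  the components \<open>k\<^sub>1, \<dots>, k\<^sub>m\<close> of \<open>\<beta>\<close>, for \<open>m \<le> 3\<close>. Differentiability is total (Frechet) differentiability of every entry,
  within \<open>B\<close>; at interior points of \<open>B\<close>, in particular near \<open>\<beta>0\<close>, this is ordinary
  differentiability and determines \<open>dC\<close>.
\<close>

definition A2 ::
  "'a measure \<Rightarrow> (nat \<Rightarrow> 'x measure) \<Rightarrow> (nat \<Rightarrow> nat) \<Rightarrow> (nat \<Rightarrow> nat) \<Rightarrow> (nat \<Rightarrow> nat \<Rightarrow> 'a \<Rightarrow> 'x) \<Rightarrow>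
   (nat \<Rightarrow> real ^ 'k \<Rightarrow> 'x \<Rightarrow> real mat) \<Rightarrow> (nat \<Rightarrow> 'k list \<Rightarrow> real ^ 'k \<Rightarrow> 'x \<Rightarrow> real mat) \<Rightarrow>
   (real ^ 'k) set \<Rightarrow> real ^ 'k \<Rightarrow> bool" where
  "A2 M S n p X C dC B \<beta>0 \<longleftrightarrow>
     compact B \<and> \<beta>0 \<in> interior B \<and>
     (\<forall>t. \<forall>\<beta>\<in>B. \<forall>x\<in>space (S t). pos_def (p t) (C t \<beta> x)) \<and>
     (\<forall>t. dC t [] = C t) \<and>
     (\<forall>t. \<forall>i\<in>{1..n t}. AE x in distr M (S t) (X t i).
        \<forall>ks. length ks \<le> 2 \<longrightarrow> (\<forall>\<beta>\<in>B. \<forall>j<p t. \<forall>l<p t.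
          ((\<lambda>\<beta>'. dC t ks \<beta>' x $$ (j, l)) has_derivative
             (\<lambda>h. \<Sum>k\<in>UNIV. vec_nth h k * dC t (k # ks) \<beta> x $$ (j, l))) (at \<beta> within B))) \<and>
     (\<forall>t ks. length ks \<le> 3 \<longrightarrow> (\<forall>\<beta>\<in>B. measurable_mat (S t) (p t) (dC t ks \<beta>)))"

definition A3 ::
  "'a measure \<Rightarrow> (nat \<Rightarrow> nat) \<Rightarrow> (nat \<Rightarrow> nat) \<Rightarrow> (nat \<Rightarrow> nat \<Rightarrow> 'a \<Rightarrow> 'x) \<Rightarrow>
   (nat \<Rightarrow> real ^ 'k \<Rightarrow> 'x \<Rightarrow> real mat) \<Rightarrow> (nat \<Rightarrow> 'k list \<Rightarrow> real ^ 'k \<Rightarrow> 'x \<Rightarrow> real mat) \<Rightarrow>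
   (real ^ 'k) set \<Rightarrow> real ^ 'k \<Rightarrow> real \<Rightarrow> bool" where
  "A3 M n p X C dC B \<beta>0 \<eta>1 \<longleftrightarrow>
     (\<exists>\<eta>2 \<delta>c \<delta>0 \<delta>1 \<delta>2 \<delta>3. \<eta>2 > 8 / \<eta>1 \<and>
        \<delta>c > 0 \<and> \<delta>0 > 0 \<and> \<delta>1 > 0 \<and> \<delta>2 > 0 \<and> \<delta>3 > 0 \<and>
        Max {2 / \<delta>c + 4 / \<delta>0 + 3 / \<delta>1, 2 / \<delta>c + 3 / \<delta>0 + 1 / \<delta>1 + 1 / \<delta>2, 2 / \<delta>c + 2 / \<delta>0 + 1 / \<delta>3} \<le> 1 \<and>
        (SUP t. SUP i\<in>{1..n t}. mixed_norm M (p t) (\<delta>c * (2 + \<eta>2)) 1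
           (abs_entry (\<lambda>\<omega>. mat_sqrt (C t \<beta>0 (X t i \<omega>))))) < \<infinity> \<and>
        (SUP t. SUP i\<in>{1..n t}. mixed_norm M (p t) (\<delta>0 * (2 + \<eta>2)) 1
           (sup_abs_entry B (\<lambda>\<beta> \<omega>. inv_mat (C t \<beta> (X t i \<omega>))))) < \<infinity> \<and>
        (\<forall>k. (SUP t. SUP i\<in>{1..n t}. mixed_norm M (p t) (\<delta>1 * (2 + \<eta>2)) 1
           (sup_abs_entry B (\<lambda>\<beta> \<omega>. dC t [k] \<beta> (X t i \<omega>)))) < \<infinity>) \<and>
        (\<forall>k1 k2. (SUP t. SUP i\<in>{1..n t}. mixed_norm M (p t) (\<delta>2 * (2 + \<eta>2)) 1
           (sup_abs_entry B (\<lambda>\<beta> \<omega>. dC t [k1, k2] \<beta> (X t i \<omega>)))) < \<infinity>) \<and>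
        (\<forall>k1 k2 k3. (SUP t. SUP i\<in>{1..n t}. mixed_norm M (p t) (\<delta>3 * (2 + \<eta>2)) 1
           (sup_abs_entry B (\<lambda>\<beta> \<omega>. dC t [k1, k2, k3] \<beta> (X t i \<omega>)))) < \<infinity>))"

text \<open>An index \<open>i\<close> is admissible if observation \<open>i\<close> exists at all late stages. The limits
  \<open>Q l i\<close> are deterministic.\<close>

definition A5 ::
  "'a measure \<Rightarrow> (nat \<Rightarrow> nat) \<Rightarrow> (nat \<Rightarrow> nat) \<Rightarrow> (nat \<Rightarrow> nat \<Rightarrow> 'a \<Rightarrow> 'x) \<Rightarrow>
   (nat \<Rightarrow> real ^ 'k \<Rightarrow> 'x \<Rightarrow> real mat) \<Rightarrow> (nat \<Rightarrow> 'k list \<Rightarrow> real ^ 'k \<Rightarrow> 'x \<Rightarrow> real mat) \<Rightarrow>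
   real ^ 'k \<Rightarrow> (int \<Rightarrow> nat \<Rightarrow> real ^ 'k ^ 'k) \<Rightarrow> bool" where
  "A5 M n p X C dC \<beta>0 Q \<longleftrightarrow>
     (\<forall>i. (\<forall>\<^sub>F t in sequentially. i \<in> {1..n t}) \<longrightarrow>
       (\<forall>l\<in>{-2, 0}. conv_in_prob M
          (\<lambda>t \<omega>. \<chi> k1 k2. 1 / real (p t) *
             trace_mat (mat_powi (C t \<beta>0 (X t i \<omega>)) l * dC t [k1] \<beta>0 (X t i \<omega>) *
                        mat_powi (C t \<beta>0 (X t i \<omega>)) l * dC t [k2] \<beta>0 (X t i \<omega>)))
          (Q l i)))"

end

theory Submission
  imports Defs "Jordan_Normal_Form.Determinant"
begin

no_notation vec_nth (infixl \<open>$\<close> 90)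
no_notation scalar_prod (infix \<open>\<bullet>\<close> 70)
hide_type (open) Finite_Cartesian_Product.vec
hide_const (open) Finite_Cartesian_Product.vec Finite_Cartesian_Product.mat Finite_Cartesian_Product.row
  Determinants.det

text \<open>
  The result is a delta method in growing dimension. Write \<open>h = \<beta>hat - \<beta>0\<close> and
  \<open>\<zeta> = \<surd>(np) h\<close>, so that \<open>\<zeta>\<close> converges to \<open>Z\<close> in distribution. A first order
  expansion gives \<open>C(\<beta>hat) - C(\<beta>0) = L + R\<close> with \<open>L = \<Sum>\<^sub>k h\<^sub>k \<partial>\<^sub>kC\<close>. The linear part contributes
  \<open>n \<parallel>L\<parallel>\<^sup>2 = \<zeta> \<bullet> H \<zeta>\<close>, where \<open>H\<close> has the entries \<open>p\<^sup>-\<^sup>1 tr(\<partial>\<^sub>kC \<partial>\<^sub>lC)\<close>: the derivatives are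
  symmetric because the matrices are, so the trace is the entrywise inner product. By \<open>A5\<close> the
  matrix \<open>H\<close> converges to \<open>Q\<close> in probability. For the inverse,
  \<open>L = - \<Sum>\<^sub>k h\<^sub>k C\<^sup>-\<^sup>1 \<partial>\<^sub>kC C\<^sup>-\<^sup>1\<close>, and cyclicity of the trace produces the powers
  \<open>C\<^sup>-\<^sup>2\<close> in \<open>A5\<close> (\<open>trace_mat_powi_minus_2\<close>).

  The point is that the remainder is negligible although the matrices grow. Each entry of \<open>R\<close> is
  at most \<open>\<bar>h\<bar>\<^sup>2 F\<^sub>j\<^sub>l\<close>, where \<open>F\<close> is a supremum of second derivatives over the parameter space or,
  for the inverse, a polynomial in the suprema of the entries of \<open>C\<^sup>-\<^sup>1\<close>, \<open>\<partial>C\<close> and \<open>\<partial>\<^sup>2C\<close>,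
  obtained from the identity \<open>A\<^sub>1 - A\<^sub>0 = A\<^sub>0 D A\<^sub>0 D A\<^sub>1 - A\<^sub>0 D A\<^sub>0\<close> for the inverses \<open>A\<^sub>0\<close>,
  \<open>A\<^sub>1\<close> of two matrices with difference \<open>D\<close> (\<open>inv_mat_expansion\<close>). Assumption \<open>A3\<close> bounds the
  column sums of the \<open>L\<^sup>q\<close> norms of these suprema. Maximal column sums are submultiplicative, and
  the inequalities of Minkowski and Hoelder carry them from the factors to \<open>F\<close>; the condition on
  the exponents in \<open>A3\<close> leaves an \<open>L\<^sup>2\<close> bound. Hence \<open>E \<Sum>\<^sub>j\<^sub>l F\<^sub>j\<^sub>l\<^sup>2\<close> is at most the sum of the
  squared column sums, which is \<open>O(p)\<close>, while
  \<open>n \<parallel>R\<parallel>\<^sup>2 \<le> n \<bar>h\<bar>\<^sup>4 \<Sum> F\<^sup>2 = \<bar>\<zeta>\<bar>\<^sup>4 (np\<^sup>2)\<^sup>-\<^sup>1 \<Sum> F\<^sup>2\<close>. Since \<open>\<zeta>\<close> is tight, this tends to \<open>0\<close> in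
  probability as \<open>p \<rightarrow> \<infinity>\<close>, whatever \<open>n\<close> does.

  The remainder bounds at a fixed stage are \<open>matrix_remainder\<close> and \<open>inverse_remainder\<close>; the
  probabilistic limit is \<open>frobenius_delta_method\<close>.
\<close>

section \<open>Determinants and inverses\<close>

lemma mat_mult_entry:
  fixes A B :: "real mat"
  assumes "A \<in> carrier_mat p p" "B \<in> carrier_mat p p" "j < p" "l < p"
  shows "(A * B) $$ (j, l) = (\<Sum>m<p. A $$ (j, m) * B $$ (m, l))"
  using assms by (simp add: scalar_prod_def atLeast0LessThan)

lemma pos_def_det_nonzero: "pos_def p A \<Longrightarrow> det A \<noteq> 0"
proof
  assume pd: "pos_def p A" and "det A = 0"
  then obtain v where v: "v \<in> carrier_vec p" "v \<noteq> 0\<^sub>v p" "A *\<^sub>v v = 0\<^sub>v p"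
    using det_0_iff_vec_prod_zero[of A p] unfolding pos_def_def by blast
  then have "scalar_prod v (A *\<^sub>v v) = 0" by simp
  with pd v show False unfolding pos_def_def by fastforce
qed

text \<open>The adjugate is the link to analysis: it makes the entries of the inverse rational functions of
  the entries of the matrix, hence measurable and, on invertible matrices, continuous.\<close>

lemma inv_mat_eq_adj_mat:
  assumes A: "A \<in> carrier_mat p p"
  shows "inv_mat A = (if det A = 0 then 0\<^sub>m p p else (1 / det A) \<cdot>\<^sub>m adj_mat A)"
proof (cases "mat_inverse A")
  case None
  have "det A = 0"
  proof (rule ccontr)
    assume d: "det A \<noteq> 0"
    then have "A \<in> Units (ring_mat TYPE(real) p ())"
      using det_non_zero_imp_unit[OF A] by simp
    with mat_inverse(1)[OF A None, of "()"] show False by simp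
  qed
  with None A show ?thesis by (simp add: inv_mat_def)
next
  case (Some B)
  from mat_inverse(2)[OF A Some] have B: "A * B = 1\<^sub>m p" "B * A = 1\<^sub>m p" "B \<in> carrier_mat p p" by auto
  have "det A * det B = 1" using det_mult[OF A B(3)] B(1) by simp
  then have d: "det A \<noteq> 0" by auto
  have "adj_mat A = (B * A) * adj_mat A" using B(2) adj_mat(1)[OF A] by simp
  also have "\<dots> = B * (A * adj_mat A)" using A B(3) adj_mat(1)[OF A] by (simp add: assoc_mult_mat[of _ p p _ p _ p])
  also have "\<dots> = det A \<cdot>\<^sub>m B" using B(3) adj_mat(2)[OF A] by (simp add: mult_smult_distrib[of _ p p _ p])
  finally have "(1 / det A) \<cdot>\<^sub>m adj_mat A = B" using d by (auto intro!: eq_matI)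
  with Some d show ?thesis by (simp add: inv_mat_def)
qed

lemma inv_mat_carrier: "A \<in> carrier_mat p p \<Longrightarrow> inv_mat A \<in> carrier_mat p p"
  using adj_mat(1)[of A p] by (auto simp: inv_mat_eq_adj_mat)

lemma inv_mat_inverse:
  assumes A: "A \<in> carrier_mat p p" and d: "det A \<noteq> 0"
  shows "A * inv_mat A = 1\<^sub>m p" "inv_mat A * A = 1\<^sub>m p"
  using adj_mat[OF A] d A
  by (auto simp: inv_mat_eq_adj_mat[OF A] mult_smult_distrib[of _ p p _ p] mult_smult_assoc_mat[of _ p p _ p]
      intro!: eq_matI)

text \<open>Valid for singular matrices as well, where both sides are \<open>0\<close> because division by \<open>0\<close>
  gives \<open>0\<close>.\<close>

lemma inv_mat_entry:
  assumes A: "A \<in> carrier_mat p p" and jl: "j < p" "l < p"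
  shows "inv_mat A $$ (j, l) = cofactor A l j / det A"
  using A jl adj_mat(1)[OF A] by (auto simp: inv_mat_eq_adj_mat adj_mat_def)

lemma transpose_inv_mat:
  assumes A: "A \<in> carrier_mat p p" and sym: "transpose_mat A = A"
  shows "transpose_mat (inv_mat A) = inv_mat A"
proof (rule eq_matI)
  have c: "inv_mat A \<in> carrier_mat p p" by (rule inv_mat_carrier[OF A])
  fix j l assume "j < dim_row (inv_mat A)" "l < dim_col (inv_mat A)"
  with c have jl: "j < p" "l < p" by auto
  have "mat_delete A j l = transpose_mat (mat_delete (transpose_mat A) l j)"
    using A jl by (intro eq_matI) (auto simp: mat_delete_def)
  then have "det (mat_delete A j l) = det (mat_delete A l j)"
    using sym A by (simp add: det_transpose[OF mat_delete_carrier[OF A]])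
  then have "cofactor A j l = cofactor A l j" by (simp add: cofactor_def add.commute)
  then show "transpose_mat (inv_mat A) $$ (j, l) = inv_mat A $$ (j, l)"
    using c jl A by (simp add: inv_mat_entry[OF A])
qed (use inv_mat_carrier[OF A] in auto)

lemma continuous_on_det:
  assumes A: "\<And>b. b \<in> S \<Longrightarrow> A b \<in> carrier_mat p p"
    and c: "\<And>j l. j < p \<Longrightarrow> l < p \<Longrightarrow> continuous_on S (\<lambda>b. A b $$ (j, l) :: real)"
  shows "continuous_on S (\<lambda>b. det (A b))"
proof -
  have "continuous_on S (\<lambda>b. \<Sum>\<pi> | \<pi> permutes {0..<p}. signof \<pi> * (\<Prod>i = 0..<p. A b $$ (i, \<pi> i)))"
    by (intro continuous_intros c) (auto dest: permutes_in_image)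
  then show ?thesis
    by (rule continuous_on_eq) (simp add: det_def'[OF A])
qed

lemma borel_measurable_det:
  assumes A: "\<And>\<omega>. \<omega> \<in> space M \<Longrightarrow> A \<omega> \<in> carrier_mat p p"
    and c: "\<And>j l. j < p \<Longrightarrow> l < p \<Longrightarrow> (\<lambda>\<omega>. A \<omega> $$ (j, l) :: real) \<in> borel_measurable M"
  shows "(\<lambda>\<omega>. det (A \<omega>)) \<in> borel_measurable M"
proof -
  have "(\<lambda>\<omega>. \<Sum>\<pi> | \<pi> permutes {0..<p}. signof \<pi> * (\<Prod>i = 0..<p. A \<omega> $$ (i, \<pi> i))) \<in> borel_measurable M"
    by (intro borel_measurable_sum borel_measurable_times borel_measurable_const borel_measurable_prod c)
       (auto dest: permutes_in_image)
  then show ?thesis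
    by (rule measurable_cong[THEN iffD1, rotated]) (simp add: det_def'[OF A])
qed

lemma mat_delete_entry:
  assumes "A \<in> carrier_mat p p" "j' < p - 1" "l' < p - 1"
  shows "mat_delete A j l $$ (j', l') = A $$ (if j' < j then j' else Suc j', if l' < l then l' else Suc l')"
  using assms by (auto simp: mat_delete_def)

lemma continuous_on_inv_mat:
  assumes A: "\<And>b. b \<in> S \<Longrightarrow> A b \<in> carrier_mat p p" and d: "\<And>b. b \<in> S \<Longrightarrow> det (A b) \<noteq> 0"
    and c: "\<And>j l. j < p \<Longrightarrow> l < p \<Longrightarrow> continuous_on S (\<lambda>b. A b $$ (j, l) :: real)"
    and jl: "j < p" "l < p"
  shows "continuous_on S (\<lambda>b. inv_mat (A b) $$ (j, l))"
proof -
  have "continuous_on S (\<lambda>b. det (mat_delete (A b) l j))"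
  proof (rule continuous_on_det)
    show "mat_delete (A b) l j \<in> carrier_mat (p - 1) (p - 1)" if "b \<in> S" for b
      using mat_delete_carrier[OF A[OF that]] by simp
    fix j' l' assume jl': "j' < p - 1" "l' < p - 1"
    have "continuous_on S (\<lambda>b. A b $$ (if j' < l then j' else Suc j', if l' < j then l' else Suc l'))"
      using jl' by (intro c) auto
    then show "continuous_on S (\<lambda>b. mat_delete (A b) l j $$ (j', l'))"
      by (rule continuous_on_eq) (simp add: mat_delete_entry[OF A jl'])
  qed
  moreover have "continuous_on S (\<lambda>b. det (A b))" by (rule continuous_on_det[OF A c])
  ultimately have "continuous_on S (\<lambda>b. cofactor (A b) l j / det (A b))"
    unfolding cofactor_def using d by (intro continuous_on_divide continuous_on_mult_left) auto
  then show ?thesis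
    by (rule continuous_on_eq) (simp add: inv_mat_entry[OF A jl])
qed

section \<open>Measurable random matrices\<close>

lemma measurable_mat_cong:
  assumes "\<And>\<omega>. \<omega> \<in> space M \<Longrightarrow> A \<omega> = B \<omega>" "measurable_mat M p A"
  shows "measurable_mat M p B"
proof -
  have "(\<lambda>\<omega>. B \<omega> $$ (j, l)) \<in> borel_measurable M \<longleftrightarrow> (\<lambda>\<omega>. A \<omega> $$ (j, l)) \<in> borel_measurable M" for j l
    by (rule measurable_cong) (simp add: assms(1))
  with assms show ?thesis unfolding measurable_mat_def by simp
qed

lemma measurable_mat_compose:
  assumes "f \<in> measurable M S" "measurable_mat S p A"
  shows "measurable_mat M p (\<lambda>\<omega>. A (f \<omega>))"
  using assms(2) measurable_space[OF assms(1)] unfolding measurable_mat_def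
  by (auto intro: measurable_compose[OF assms(1)])

lemma measurable_mat_mult:
  assumes "measurable_mat M p A" "measurable_mat M p B"
  shows "measurable_mat M p (\<lambda>\<omega>. A \<omega> * B \<omega>)"
  unfolding measurable_mat_def
proof (intro conjI ballI allI impI)
  have c: "A \<omega> \<in> carrier_mat p p" "B \<omega> \<in> carrier_mat p p" if "\<omega> \<in> space M" for \<omega>
    using assms that unfolding measurable_mat_def by auto
  then show "A \<omega> * B \<omega> \<in> carrier_mat p p" if "\<omega> \<in> space M" for \<omega>
    using that by (intro mult_carrier_mat[of _ p p _ p])
  fix j l assume jl: "j < p" "l < p"
  have "(\<lambda>\<omega>. \<Sum>m<p. A \<omega> $$ (j, m) * B \<omega> $$ (m, l)) \<in> borel_measurable M"
    using assms jl unfolding measurable_mat_def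
    by (intro borel_measurable_sum borel_measurable_times) auto
  then show "(\<lambda>\<omega>. (A \<omega> * B \<omega>) $$ (j, l)) \<in> borel_measurable M"
    by (rule measurable_cong[THEN iffD1, rotated]) (use c jl in \<open>simp add: mat_mult_entry[of _ p] del: index_mult_mat\<close>)
qed

lemma measurable_mat_inv_mat:
  assumes Am: "measurable_mat M p A"
  shows "measurable_mat M p (\<lambda>\<omega>. inv_mat (A \<omega>))"
proof -
  have A: "\<And>\<omega>. \<omega> \<in> space M \<Longrightarrow> A \<omega> \<in> carrier_mat p p"
    and c: "\<And>j l. j < p \<Longrightarrow> l < p \<Longrightarrow> (\<lambda>\<omega>. A \<omega> $$ (j, l) :: real) \<in> borel_measurable M"
    using Am unfolding measurable_mat_def by auto
  have "(\<lambda>\<omega>. inv_mat (A \<omega>) $$ (j, l)) \<in> borel_measurable M" if jl: "j < p" "l < p" for j l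
  proof -
    have "(\<lambda>\<omega>. det (mat_delete (A \<omega>) l j)) \<in> borel_measurable M"
    proof (rule borel_measurable_det)
      show "mat_delete (A \<omega>) l j \<in> carrier_mat (p - 1) (p - 1)" if "\<omega> \<in> space M" for \<omega>
        using mat_delete_carrier[OF A[OF that]] by simp
      fix j' l' assume jl': "j' < p - 1" "l' < p - 1"
      have "(\<lambda>\<omega>. A \<omega> $$ (if j' < l then j' else Suc j', if l' < j then l' else Suc l')) \<in> borel_measurable M"
        using jl' by (intro c) auto
      then show "(\<lambda>\<omega>. mat_delete (A \<omega>) l j $$ (j', l')) \<in> borel_measurable M"
        by (rule measurable_cong[THEN iffD1, rotated]) (simp add: mat_delete_entry[OF A jl'])
    qed
    moreover have "(\<lambda>\<omega>. det (A \<omega>)) \<in> borel_measurable M" by (rule borel_measurable_det[OF A c])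
    ultimately have "(\<lambda>\<omega>. cofactor (A \<omega>) l j / det (A \<omega>)) \<in> borel_measurable M"
      unfolding cofactor_def by (intro borel_measurable_divide borel_measurable_times borel_measurable_const)
    then show ?thesis
      by (rule measurable_cong[THEN iffD1, rotated]) (simp add: inv_mat_entry[OF A jl])
  qed
  then show ?thesis using A inv_mat_carrier unfolding measurable_mat_def by blast
qed

lemma measurable_mat_powi:
  assumes A: "measurable_mat M p A" and l: "l = 0 \<or> l = -2"
  shows "measurable_mat M p (\<lambda>\<omega>. mat_powi (A \<omega>) l)"
proof (cases "l = 0")
  case True
  have "measurable_mat M p (\<lambda>\<omega>. 1\<^sub>m p)" unfolding measurable_mat_def by simp
  then show ?thesis
    by (rule measurable_mat_cong[rotated]) (use A True in \<open>auto simp: mat_powi_def measurable_mat_def\<close>)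
next
  case False
  have "measurable_mat M p (\<lambda>\<omega>. inv_mat (A \<omega>) * inv_mat (A \<omega>))"
    by (intro measurable_mat_mult measurable_mat_inv_mat A)
  then show ?thesis
  proof (rule measurable_mat_cong[rotated])
    fix \<omega> assume "\<omega> \<in> space M"
    then have "inv_mat (A \<omega>) \<in> carrier_mat p p" using A inv_mat_carrier unfolding measurable_mat_def by blast
    then show "inv_mat (A \<omega>) * inv_mat (A \<omega>) = mat_powi (A \<omega>) l"
      using False l by (simp add: mat_powi_def numeral_2_eq_2)
  qed
qed

lemma borel_measurable_trace_mat:
  assumes "measurable_mat M p A"
  shows "(\<lambda>\<omega>. trace_mat (A \<omega>)) \<in> borel_measurable M"
proof -
  have "(\<lambda>\<omega>. \<Sum>j<p. A \<omega> $$ (j, j)) \<in> borel_measurable M"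
    using assms unfolding measurable_mat_def by (intro borel_measurable_sum) auto
  then show ?thesis
    by (rule measurable_cong[THEN iffD1, rotated]) (use assms in \<open>auto simp: trace_mat_def measurable_mat_def\<close>)
qed

section \<open>Entrywise domination of matrix products\<close>

text \<open>Matrix multiplication for entry functions. Bounds on matrix entries are kept as functions of
  the indices, so that they can be compared pointwise and made random without carrier sets.\<close>

definition kernel_prod :: "nat \<Rightarrow> (nat \<Rightarrow> nat \<Rightarrow> real) \<Rightarrow> (nat \<Rightarrow> nat \<Rightarrow> real) \<Rightarrow> nat \<Rightarrow> nat \<Rightarrow> real" where
  "kernel_prod p f g j l = (\<Sum>m<p. f j m * g m l)"

definition entries_le :: "nat \<Rightarrow> real mat \<Rightarrow> (nat \<Rightarrow> nat \<Rightarrow> real) \<Rightarrow> bool" where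
  "entries_le p A f \<longleftrightarrow> A \<in> carrier_mat p p \<and> (\<forall>j<p. \<forall>l<p. \<bar>A $$ (j, l)\<bar> \<le> f j l)"

lemma entries_le_mult:
  assumes "entries_le p A f" "entries_le p B g"
  shows "entries_le p (A * B) (kernel_prod p f g)"
proof -
  have "\<bar>(A * B) $$ (j, l)\<bar> \<le> kernel_prod p f g j l" if jl: "j < p" "l < p" for j l
  proof -
    have "\<bar>(A * B) $$ (j, l)\<bar> = \<bar>\<Sum>m<p. A $$ (j, m) * B $$ (m, l)\<bar>"
      using assms jl unfolding entries_le_def by (simp add: mat_mult_entry[of A p] del: index_mult_mat)
    also have "\<dots> \<le> (\<Sum>m<p. \<bar>A $$ (j, m)\<bar> * \<bar>B $$ (m, l)\<bar>)"
      unfolding abs_mult[symmetric] by (rule sum_abs)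
    also have "\<dots> \<le> kernel_prod p f g j l"
      unfolding kernel_prod_def using assms jl unfolding entries_le_def
      by (intro sum_mono mult_mono) (auto intro: order_trans[OF abs_ge_zero])
    finally show ?thesis .
  qed
  then show ?thesis using assms unfolding entries_le_def by auto
qed

lemma kernel_prod_scale [simp]:
  "kernel_prod p (\<lambda>j l. s * f j l) g = (\<lambda>j l. s * kernel_prod p f g j l)"
  "kernel_prod p f (\<lambda>j l. s * g j l) = (\<lambda>j l. s * kernel_prod p f g j l)"
  by (auto simp: kernel_prod_def fun_eq_iff sum_distrib_left mult_ac)

text \<open>The resolvent identity \<open>A\<^sub>0 D A\<^sub>1 = A\<^sub>0 - A\<^sub>1\<close>, applied twice. Keeping \<open>A\<^sub>1\<close> only in the
  quadratic term gives a second order expansion of the inverse without differentiating it, so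
  the derivatives of \<open>C\<close> are all that has to be controlled. Here \<open>L\<close> is any approximation
  of \<open>D\<close>.\<close>

lemma inv_mat_expansion:
  fixes C0 C1 :: "real mat"
  assumes C: "C0 \<in> carrier_mat p p" "C1 \<in> carrier_mat p p" and L: "L \<in> carrier_mat p p"
    and d: "det C0 \<noteq> 0" "det C1 \<noteq> 0"
  defines "J0 \<equiv> inv_mat C0" and "J1 \<equiv> inv_mat C1" and "D \<equiv> C1 - C0"
  shows "J1 - J0 + J0 * (L * J0) = J0 * (D * (J0 * (D * J1))) - J0 * ((D - L) * J0)"
proof -
  have A[simp]: "J0 \<in> carrier_mat p p" "J1 \<in> carrier_mat p p" "D \<in> carrier_mat p p"
    using C unfolding J0_def J1_def D_def by (auto intro: inv_mat_carrier)
  note [simp] = C L mult_carrier_mat[of _ p p _ p] minus_carrier_mat[of _ p p]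
  have 1: "J0 * (D * J1) = J0 - J1"
  proof -
    have "D * J1 = 1\<^sub>m p - C0 * J1"
      unfolding D_def using inv_mat_inverse(1)[OF C(2) d(2)]
      by (simp add: minus_mult_distrib_mat[of _ p p _ _ p] flip: J1_def)
    then have "J0 * (D * J1) = J0 * 1\<^sub>m p - J0 * (C0 * J1)"
      by (simp add: mult_minus_distrib_mat[of _ p p _ p])
    also have "J0 * (C0 * J1) = (J0 * C0) * J1" by (simp add: assoc_mult_mat[of _ p p _ p _ p])
    also have "\<dots> = J1" using inv_mat_inverse(2)[OF C(1) d(1)] left_mult_one_mat[OF A(2)] by (simp flip: J0_def)
    finally show ?thesis using right_mult_one_mat[OF A(1)] by simp
  qed
  have 2: "J0 * (D * (J0 * (D * J1))) = J0 * (D * J0) - J0 * (D * J1)"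
    by (simp add: 1 mult_minus_distrib_mat[of _ p p _ p])
  have 3: "J0 * ((D - L) * J0) = J0 * (D * J0) - J0 * (L * J0)"
    by (simp add: mult_minus_distrib_mat[of _ p p _ p] minus_mult_distrib_mat[of _ p p _ _ p])
  have 4: "J1 - J0 + Y = X - (J0 - J1) - (X - Y)"
    if "X \<in> carrier_mat p p" "Y \<in> carrier_mat p p" for X Y
    using that carrier_matD[OF A(1)] carrier_matD[OF A(2)] by (intro eq_matI) auto
  show ?thesis unfolding 2 3 unfolding 1 by (rule 4) simp_all
qed

text \<open>With \<open>s\<close> the size of the parameter increment, \<open>L\<close> the linear part of \<open>C1 - C0\<close> and first and
  second order bounds \<open>g\<close> and \<open>h\<close>, the two error terms of the expansion are of order \<open>s\<^sup>2\<close>.\<close>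

lemma inv_mat_remainder_bound:
  fixes C0 C1 L :: "real mat"
  assumes C: "C0 \<in> carrier_mat p p" "C1 \<in> carrier_mat p p" and L: "L \<in> carrier_mat p p"
    and d: "det C0 \<noteq> 0" "det C1 \<noteq> 0"
    and A0: "entries_le p (inv_mat C0) f" and A1: "entries_le p (inv_mat C1) f"
    and D: "entries_le p (C1 - C0) (\<lambda>j l. s * g j l)"
    and R: "entries_le p (C1 - C0 - L) (\<lambda>j l. s\<^sup>2 * h j l)"
    and jl: "j < p" "l < p"
  shows "\<bar>(inv_mat C1 - inv_mat C0 + inv_mat C0 * (L * inv_mat C0)) $$ (j, l)\<bar>
     \<le> s\<^sup>2 * (kernel_prod p f (kernel_prod p g (kernel_prod p f (kernel_prod p g f))) j l
            + kernel_prod p f (kernel_prod p h f) j l)"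
proof -
  let ?T1 = "inv_mat C0 * ((C1 - C0) * (inv_mat C0 * ((C1 - C0) * inv_mat C1)))"
  let ?T2 = "inv_mat C0 * ((C1 - C0 - L) * inv_mat C0)"
  have T1: "entries_le p ?T1 (kernel_prod p f (kernel_prod p (\<lambda>j l. s * g j l) (kernel_prod p f (kernel_prod p (\<lambda>j l. s * g j l) f))))"
    by (intro entries_le_mult A0 A1 D)
  have T2: "entries_le p ?T2 (kernel_prod p f (kernel_prod p (\<lambda>j l. s\<^sup>2 * h j l) f))"
    by (intro entries_le_mult A0 R)
  have "(?T1 - ?T2) $$ (j, l) = ?T1 $$ (j, l) - ?T2 $$ (j, l)"
    using T2 jl unfolding entries_le_def by (intro index_minus_mat(1)) (metis carrier_matD)+
  then have "\<bar>(?T1 - ?T2) $$ (j, l)\<bar> \<le> \<bar>?T1 $$ (j, l)\<bar> + \<bar>?T2 $$ (j, l)\<bar>"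
    by simp
  also have "\<dots> \<le> s\<^sup>2 * (kernel_prod p f (kernel_prod p g (kernel_prod p f (kernel_prod p g f))) j l
            + kernel_prod p f (kernel_prod p h f) j l)"
  proof -
    have "\<bar>?T1 $$ (j, l)\<bar> \<le> s\<^sup>2 * kernel_prod p f (kernel_prod p g (kernel_prod p f (kernel_prod p g f))) j l"
      using T1 jl unfolding entries_le_def by (simp add: power2_eq_square mult.assoc)
    moreover have "\<bar>?T2 $$ (j, l)\<bar> \<le> s\<^sup>2 * kernel_prod p f (kernel_prod p h f) j l"
      using T2 jl unfolding entries_le_def by simp
    ultimately show ?thesis by (simp add: distrib_left)
  qed
  finally show ?thesis unfolding inv_mat_expansion[OF C L d] .
qed

section \<open>Traces and the Frobenius norm\<close>

lemma trace_mat_mult: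
  assumes "A \<in> carrier_mat p p" "B \<in> carrier_mat p p"
  shows "trace_mat (A * B) = (\<Sum>j<p. \<Sum>l<p. A $$ (j, l) * B $$ (l, j))"
  unfolding trace_mat_def using assms by (auto simp: mat_mult_entry[of _ p] simp del: index_mult_mat(1) intro!: sum.cong)

lemma trace_mat_commute:
  assumes "A \<in> carrier_mat p p" "B \<in> carrier_mat p p"
  shows "trace_mat (A * B) = trace_mat (B * A)"
  unfolding trace_mat_mult[OF assms] trace_mat_mult[OF assms(2,1)]
  by (subst sum.swap) (simp add: mult.commute)

lemma trace_mat_mult_symmetric:
  assumes "A \<in> carrier_mat p p" "B \<in> carrier_mat p p" "transpose_mat B = B"
  shows "trace_mat (A * B) = (\<Sum>j<p. \<Sum>l<p. A $$ (j, l) * B $$ (j, l))"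
proof -
  have "B $$ (l, j) = B $$ (j, l)" if "j < p" "l < p" for j l
    using assms(2,3) that by (metis carrier_matD index_transpose_mat(1))
  then show ?thesis unfolding trace_mat_mult[OF assms(1,2)] by (auto intro!: sum.cong)
qed

lemma trace_mat_powi_0:
  assumes "C \<in> carrier_mat p p" "P \<in> carrier_mat p p" "Q \<in> carrier_mat p p" "transpose_mat Q = Q"
  shows "trace_mat (mat_powi C 0 * P * mat_powi C 0 * Q) = (\<Sum>j<p. \<Sum>l<p. P $$ (j, l) * Q $$ (j, l))"
proof -
  have "mat_powi C 0 = 1\<^sub>m p" using assms by (simp add: mat_powi_def)
  then have "mat_powi C 0 * P * mat_powi C 0 * Q = P * Q" using assms by simp
  then show ?thesis using trace_mat_mult_symmetric[OF assms(2-4)] by simp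
qed

text \<open>One factor \<open>A\<close> is moved from the front to the back of the trace; the two sandwiched
  matrices that remain are symmetric.\<close>

lemma trace_mat_powi_minus_2:
  assumes C: "C \<in> carrier_mat p p" "transpose_mat C = C"
    and P: "P \<in> carrier_mat p p" and Q: "Q \<in> carrier_mat p p" "transpose_mat Q = Q"
  defines "A \<equiv> inv_mat C"
  shows "trace_mat (mat_powi C (-2) * P * mat_powi C (-2) * Q) =
     (\<Sum>j<p. \<Sum>l<p. (A * (P * A)) $$ (j, l) * (A * (Q * A)) $$ (j, l))"
proof -
  have A[simp]: "A \<in> carrier_mat p p" unfolding A_def by (rule inv_mat_carrier[OF C(1)])
  note [simp] = P Q(1)
  have tA: "transpose_mat A = A" unfolding A_def by (rule transpose_inv_mat[OF C])
  have pw: "mat_powi C (-2) = A * A"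
    using A by (simp add: mat_powi_def A_def[symmetric] numeral_2_eq_2)
  note as = assoc_mult_mat[of _ p p _ p _ p] mult_carrier_mat[of _ p p _ p]
  have "A * A * P * (A * A) * Q = A * ((A * (P * A)) * (A * Q))" by (simp add: as)
  then have "trace_mat (mat_powi C (-2) * P * mat_powi C (-2) * Q) = trace_mat (A * ((A * (P * A)) * (A * Q)))"
    unfolding pw by simp
  also have "\<dots> = trace_mat (((A * (P * A)) * (A * Q)) * A)" 
    by (rule trace_mat_commute[of _ p]) (intro mult_carrier_mat[of _ p p _ p] A P Q(1))+
  also have "((A * (P * A)) * (A * Q)) * A = (A * (P * A)) * (A * (Q * A))" by (simp add: as)
  also have "trace_mat \<dots> = (\<Sum>j<p. \<Sum>l<p. (A * (P * A)) $$ (j, l) * (A * (Q * A)) $$ (j, l))"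
  proof (rule trace_mat_mult_symmetric)
    show "transpose_mat (A * (Q * A)) = A * (Q * A)"
      by (simp add: transpose_mult[of _ p p _ p] tA Q as)
  qed (intro mult_carrier_mat[of _ p p _ p] A P Q(1))+
  finally show ?thesis .
qed

lemma frobenius_norm_diff_squared:
  assumes "A \<in> carrier_mat p p" "B \<in> carrier_mat p p"
  shows "(frobenius_norm (A - B))\<^sup>2 = (\<Sum>j<p. \<Sum>l<p. (A $$ (j, l) - B $$ (j, l))\<^sup>2)"
  using assms by (simp add: frobenius_norm_def sum_nonneg)

section \<open>First and second order increments\<close>

lemma gradient_bound:
  fixes f :: "real^'k \<Rightarrow> real"
  assumes S: "convex S"
    and der: "\<And>y. y \<in> S \<Longrightarrow> (f has_derivative (\<lambda>v. \<Sum>k\<in>UNIV. vec_nth v k * g k y)) (at y within S)"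
    and b: "\<And>k y. y \<in> S \<Longrightarrow> \<bar>g k y\<bar> \<le> b k"
    and xy: "x \<in> S" "y \<in> S"
  shows "\<bar>f x - f y\<bar> \<le> norm (x - y) * (\<Sum>k\<in>UNIV. b k)"
proof -
  have "norm (f x - f y) \<le> (\<Sum>k\<in>UNIV. b k) * norm (x - y)"
  proof (rule differentiable_bound[OF S der _ xy])
    fix z assume z: "z \<in> S"
    show "onorm (\<lambda>v. \<Sum>k\<in>UNIV. vec_nth v k * g k z) \<le> (\<Sum>k\<in>UNIV. b k)"
    proof (rule onorm_le)
      fix v :: "real^'k"
      have "norm (\<Sum>k\<in>UNIV. vec_nth v k * g k z) \<le> (\<Sum>k\<in>UNIV. norm v * b k)"
        unfolding real_norm_def using z
        by (intro sum_abs[THEN order_trans] sum_mono)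
           (auto simp: abs_mult intro!: mult_mono b component_le_norm_cart)
      then show "norm (\<Sum>k\<in>UNIV. vec_nth v k * g k z) \<le> (\<Sum>k\<in>UNIV. b k) * norm v"
        by (simp add: sum_distrib_left mult.commute)
    qed
  qed
  then show ?thesis by (simp add: mult.commute)
qed

text \<open>The mean value bound is used twice: for the gradient, and then for \<open>f\<close> minus its linear part
  on the ball around \<open>x0\<close> that has \<open>x\<close> on its boundary, where the gradient differs from its
  value at \<open>x0\<close> by at most the distance times the bound on the second derivatives.\<close>

lemma second_order_taylor_bound:
  fixes f :: "real^'k \<Rightarrow> real"
  assumes S: "convex S"
    and der1: "\<And>y. y \<in> S \<Longrightarrow> (f has_derivative (\<lambda>v. \<Sum>k\<in>UNIV. vec_nth v k * g k y)) (at y within S)"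
    and der2: "\<And>k y. y \<in> S \<Longrightarrow> (g k has_derivative (\<lambda>v. \<Sum>k'\<in>UNIV. vec_nth v k' * h k' k y)) (at y within S)"
    and b: "\<And>k' k y. y \<in> S \<Longrightarrow> \<bar>h k' k y\<bar> \<le> b k' k"
    and x: "x \<in> S" "x0 \<in> S"
  shows "\<bar>f x - f x0 - (\<Sum>k\<in>UNIV. vec_nth (x - x0) k * g k x0)\<bar>
    \<le> (norm (x - x0))\<^sup>2 * (\<Sum>k\<in>UNIV. \<Sum>k'\<in>UNIV. b k' k)"
proof -
  define T where "T = S \<inter> cball x0 (norm (x - x0))"
  have T: "convex T" "x \<in> T" "x0 \<in> T" "T \<subseteq> S"
    using S x by (auto simp: T_def convex_Int dist_norm norm_minus_commute)
  define \<phi> where "\<phi> y = f y - (\<Sum>k\<in>UNIV. vec_nth y k * g k x0)" for y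
  have "\<bar>\<phi> x - \<phi> x0\<bar> \<le> norm (x - x0) * (\<Sum>k\<in>UNIV. norm (x - x0) * (\<Sum>k'\<in>UNIV. b k' k))"
  proof (rule gradient_bound[OF T(1) _ _ T(2,3), where g = "\<lambda>k y. g k y - g k x0"])
    fix y assume y: "y \<in> T"
    have "(f has_derivative (\<lambda>v. \<Sum>k\<in>UNIV. vec_nth v k * g k y)) (at y within T)"
      using der1 T(4) y by (blast intro: has_derivative_subset)
    moreover have "((\<lambda>y. \<Sum>k\<in>UNIV. vec_nth y k * g k x0) has_derivative
        (\<lambda>v. \<Sum>k\<in>UNIV. vec_nth v k * g k x0)) (at y within T)"
      by (intro bounded_linear_imp_has_derivative bounded_linear_sum
          bounded_linear_mult_const bounded_linear_vec_nth)
    ultimately have "(\<phi> has_derivative (\<lambda>v. (\<Sum>k\<in>UNIV. vec_nth v k * g k y) -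
        (\<Sum>k\<in>UNIV. vec_nth v k * g k x0))) (at y within T)"
      unfolding \<phi>_def by (rule has_derivative_diff)
    then show "(\<phi> has_derivative (\<lambda>v. \<Sum>k\<in>UNIV. vec_nth v k * (g k y - g k x0))) (at y within T)"
      by (simp add: right_diff_distrib sum_subtractf)
    fix k
    have b0: "0 \<le> (\<Sum>k'\<in>UNIV. b k' k)" using b[OF x(1)]
      by (intro sum_nonneg) (meson abs_ge_zero order_trans)
    have "\<bar>g k y - g k x0\<bar> \<le> norm (y - x0) * (\<Sum>k'\<in>UNIV. b k' k)"
      using y T(4) x by (intro gradient_bound[OF S der2 b]) auto
    also have "\<dots> \<le> norm (x - x0) * (\<Sum>k'\<in>UNIV. b k' k)"
      using y b0 by (intro mult_right_mono) (auto simp: T_def dist_norm norm_minus_commute)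
    finally show "\<bar>g k y - g k x0\<bar> \<le> norm (x - x0) * (\<Sum>k'\<in>UNIV. b k' k)" .
  qed
  also have "\<dots> = (norm (x - x0))\<^sup>2 * (\<Sum>k\<in>UNIV. \<Sum>k'\<in>UNIV. b k' k)"
    by (simp add: power2_eq_square sum_distrib_left mult.assoc)
  also have "\<phi> x - \<phi> x0 = f x - f x0 - (\<Sum>k\<in>UNIV. vec_nth (x - x0) k * g k x0)"
    by (simp add: \<phi>_def left_diff_distrib sum_subtractf)
  finally show ?thesis .
qed

section \<open>Moment bounds for sums and products\<close>

text \<open>Up to a constant factor, this says that the \<open>L\<^sup>q\<close> norm of \<open>F\<close> with \<open>q = 1/w\<close> is at most \<open>a\<close>:
  take \<open>g = 1 + \<bar>F/a\<bar>\<^sup>q\<close>. In this form the inequalities of Minkowski and Hoelder become pointwise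
  convexity inequalities for the functions \<open>g\<close>, and constants stay multiplicative without loss.
  The lower bound \<open>1 \<le> g\<close> makes the notion monotone in \<open>w\<close> and removes degenerate cases. Only
  \<open>g\<close> has to be measurable, so that \<open>F\<close> may be an error term about which nothing is known but
  a pointwise bound.\<close>

definition moment_dominated :: "'a measure \<Rightarrow> real \<Rightarrow> real \<Rightarrow> ('a \<Rightarrow> real) \<Rightarrow> bool" where
  "moment_dominated M w a F \<longleftrightarrow> a \<ge> 0 \<and>
     (\<exists>g. integrable M g \<and> (\<forall>\<omega>. 1 \<le> g \<omega>) \<and> integral\<^sup>L M g \<le> 2 \<and>
          (AE \<omega> in M. \<bar>F \<omega>\<bar> \<le> a * g \<omega> powr w))"

lemma moment_dominated_weaken:
  assumes "moment_dominated M w a F" "w \<le> v"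
  shows "moment_dominated M v a F"
proof -
  obtain g where g: "a \<ge> 0" "integrable M g" "\<forall>\<omega>. 1 \<le> g \<omega>" "integral\<^sup>L M g \<le> 2"
    "AE \<omega> in M. \<bar>F \<omega>\<bar> \<le> a * g \<omega> powr w"
    using assms(1) unfolding moment_dominated_def by blast
  have "a * g \<omega> powr w \<le> a * g \<omega> powr v" for \<omega>
    using g(1,3) assms(2) by (intro mult_left_mono powr_mono) auto
  then have "AE \<omega> in M. \<bar>F \<omega>\<bar> \<le> a * g \<omega> powr v"
    using g(5) by (auto intro: order_trans)
  with g show ?thesis unfolding moment_dominated_def by blast
qed

lemma (in prob_space) moment_dominated_zero:
  "moment_dominated M w 0 (\<lambda>_. 0)"
  unfolding moment_dominated_def by (auto intro!: exI[of _ "\<lambda>_. 1"] simp: prob_space)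

text \<open>Minkowski's inequality. With the weights \<open>a/(a+b)\<close> and \<open>b/(a+b)\<close> it is the concavity of
  \<open>u \<mapsto> u powr w\<close> for \<open>w \<le> 1\<close>.\<close>

lemma moment_dominated_add:
  assumes "moment_dominated M w a F" "moment_dominated M w b G" "0 \<le> w" "w \<le> 1"
  shows "moment_dominated M w (a + b) (\<lambda>\<omega>. F \<omega> + G \<omega>)"
proof -
  obtain f where f: "a \<ge> 0" "integrable M f" "\<forall>\<omega>. 1 \<le> f \<omega>" "integral\<^sup>L M f \<le> 2"
    "AE \<omega> in M. \<bar>F \<omega>\<bar> \<le> a * f \<omega> powr w"
    using assms(1) unfolding moment_dominated_def by blast
  obtain g where g: "b \<ge> 0" "integrable M g" "\<forall>\<omega>. 1 \<le> g \<omega>" "integral\<^sup>L M g \<le> 2"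
    "AE \<omega> in M. \<bar>G \<omega>\<bar> \<le> b * g \<omega> powr w"
    using assms(2) unfolding moment_dominated_def by blast
  show ?thesis
  proof (cases "a + b = 0")
    case True
    with f(1) g(1) have "a = 0" "b = 0" by auto
    with f g show ?thesis unfolding moment_dominated_def
      by (auto intro!: exI[of _ f] elim!: AE_mp)
  next
    case False
    with f(1) g(1) have ab: "a + b > 0" by linarith
    define s where "s = a / (a + b)"
    define r where "r = b / (a + b)"
    have sr: "s \<ge> 0" "r \<ge> 0" "s + r = 1" "a = (a + b) * s" "b = (a + b) * r"
      using f(1) g(1) ab by (auto simp: s_def r_def simp flip: add_divide_distrib)
    define h where "h \<omega> = s * f \<omega> + r * g \<omega>" for \<omega>
    have h1: "1 \<le> h \<omega>" for \<omega>
    proof -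
      have "s * 1 + r * 1 \<le> h \<omega>" unfolding h_def
        using sr f(3) g(3) by (intro add_mono mult_left_mono) auto
      with sr show ?thesis by simp
    qed
    have int: "integrable M h" unfolding h_def using f g by auto
    have "integral\<^sup>L M h = s * integral\<^sup>L M f + r * integral\<^sup>L M g"
      unfolding h_def using f g by auto
    also have "\<dots> \<le> s * 2 + r * 2"
      using sr f(4) g(4) by (intro add_mono mult_left_mono) auto
    also have "\<dots> = 2" using sr by linarith
    finally have h2: "integral\<^sup>L M h \<le> 2" .
    \<comment> \<open>A concave function lies below its tangents; the slope inequality is weighted AM-GM for
      \<open>u / c\<close> and \<open>1\<close>.\<close>
    have key: "u powr w \<le> c powr w + w * c powr (w - 1) * (u - c)" if "u > 0" "c > 0" for u c :: real
    proof -
      have "(u / c) powr w * 1 powr (1 - w) \<le> w * (u / c) + (1 - w) * 1"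
        using that assms by (intro Youngs_inequality_0) auto
      then have "c powr w * (u / c) powr w \<le> c powr w * (w * (u / c) + (1 - w))"
        by (intro mult_left_mono) auto
      moreover have "c powr w * (u / c) powr w = u powr w"
        using that by (simp add: powr_divide)
      moreover have "c powr w = c powr (w - 1) * c"
        using that by (simp add: powr_diff)
      moreover have "c * (w * (u / c) + (1 - w)) = w * u + (1 - w) * c"
        using that by (simp add: field_simps)
      ultimately have "u powr w \<le> c powr (w - 1) * (w * u + (1 - w) * c)" by (metis mult.assoc)
      then show ?thesis using \<open>c powr w = c powr (w - 1) * c\<close> by (simp add: algebra_simps)
    qed
    have *: "a * f \<omega> powr w + b * g \<omega> powr w \<le> (a + b) * h \<omega> powr w" for \<omega>
    proof -
      have pos: "f \<omega> > 0" "g \<omega> > 0" "h \<omega> > 0" using f(3) g(3) h1 by (auto intro: less_le_trans[of 0 1])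
      have "s * f \<omega> powr w + r * g \<omega> powr w
        \<le> s * (h \<omega> powr w + w * h \<omega> powr (w - 1) * (f \<omega> - h \<omega>))
          + r * (h \<omega> powr w + w * h \<omega> powr (w - 1) * (g \<omega> - h \<omega>))"
        using pos sr by (intro add_mono mult_left_mono key) auto
      also have "\<dots> = (s + r) * h \<omega> powr w + w * h \<omega> powr (w - 1) * (s * f \<omega> + r * g \<omega> - (s + r) * h \<omega>)"
        by (simp add: algebra_simps)
      also have "\<dots> = h \<omega> powr w" using sr(3) by (simp add: h_def)
      finally have "(a + b) * (s * f \<omega> powr w + r * g \<omega> powr w) \<le> (a + b) * h \<omega> powr w"
        using ab by (intro mult_left_mono) auto
      then show ?thesis using sr(4,5) by (simp only: distrib_left mult.assoc[symmetric])
    qed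
    have "AE \<omega> in M. \<bar>F \<omega> + G \<omega>\<bar> \<le> (a + b) * h \<omega> powr w"
      using f(5) g(5)
    proof eventually_elim
      case (elim \<omega>)
      with *[of \<omega>] show ?case by linarith
    qed
    with ab int h1 h2 show ?thesis unfolding moment_dominated_def by (auto intro!: exI[of _ h])
  qed
qed

lemma (in prob_space) moment_dominated_sum:
  assumes "\<And>i. i \<in> I \<Longrightarrow> moment_dominated M w (a i) (F i)" "0 \<le> w" "w \<le> 1" "finite I"
  shows "moment_dominated M w (\<Sum>i\<in>I. a i) (\<lambda>\<omega>. \<Sum>i\<in>I. F i \<omega>)"
  using assms(4,1)
proof (induction rule: finite_induct)
  case empty
  then show ?case by (simp add: moment_dominated_zero)
next
  case (insert x I)
  then show ?case using assms(2,3) by (auto intro!: moment_dominated_add)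
qed

text \<open>Hoelder's inequality. The exponents \<open>w = 1/q\<close> add up, and the new dominating function is the
  convex combination of \<open>f\<close> and \<open>g\<close> with weights proportional to the exponents, by the weighted
  inequality between the geometric and the arithmetic mean.\<close>

lemma moment_dominated_mult:
  assumes "moment_dominated M v a F" "moment_dominated M w b G" "0 < v" "0 < w"
  shows "moment_dominated M (v + w) (a * b) (\<lambda>\<omega>. F \<omega> * G \<omega>)"
proof -
  obtain f where f: "a \<ge> 0" "integrable M f" "\<forall>\<omega>. 1 \<le> f \<omega>" "integral\<^sup>L M f \<le> 2"
    "AE \<omega> in M. \<bar>F \<omega>\<bar> \<le> a * f \<omega> powr v"
    using assms(1) unfolding moment_dominated_def by blast
  obtain g where g: "b \<ge> 0" "integrable M g" "\<forall>\<omega>. 1 \<le> g \<omega>" "integral\<^sup>L M g \<le> 2"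
    "AE \<omega> in M. \<bar>G \<omega>\<bar> \<le> b * g \<omega> powr w"
    using assms(2) unfolding moment_dominated_def by blast
  define s where "s = v / (v + w)"
  define r where "r = w / (v + w)"
  have sr: "s \<ge> 0" "r \<ge> 0" "s + r = 1" "v = s * (v + w)" "w = r * (v + w)"
    using assms(3,4) by (auto simp: s_def r_def simp flip: add_divide_distrib)
  define h where "h \<omega> = s * f \<omega> + r * g \<omega>" for \<omega>
  have h1: "1 \<le> h \<omega>" for \<omega>
  proof -
    have "s * 1 + r * 1 \<le> h \<omega>" unfolding h_def
      using sr f(3) g(3) by (intro add_mono mult_left_mono) auto
    with sr show ?thesis by simp
  qed
  have int: "integrable M h" unfolding h_def using f g by auto
  have "integral\<^sup>L M h = s * integral\<^sup>L M f + r * integral\<^sup>L M g"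
    unfolding h_def using f g by auto
  also have "\<dots> \<le> s * 2 + r * 2"
    using sr f(4) g(4) by (intro add_mono mult_left_mono) auto
  also have "\<dots> = 2" using sr by linarith
  finally have h2: "integral\<^sup>L M h \<le> 2" .
  have *: "f \<omega> powr v * g \<omega> powr w \<le> h \<omega> powr (v + w)" for \<omega>
  proof -
    have pos: "f \<omega> > 0" "g \<omega> > 0" using f(3) g(3) by (auto intro: less_le_trans[of 0 1])
    have "f \<omega> powr v * g \<omega> powr w = (f \<omega> powr s * g \<omega> powr r) powr (v + w)"
      using pos sr(4,5) by (simp add: powr_mult powr_powr)
    also have "\<dots> \<le> h \<omega> powr (v + w)"
      unfolding h_def using pos sr assms(3,4)
      by (intro powr_mono2 Youngs_inequality_0) auto
    finally show ?thesis .
  qed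
  have "AE \<omega> in M. \<bar>F \<omega> * G \<omega>\<bar> \<le> (a * b) * h \<omega> powr (v + w)"
    using f(5) g(5)
  proof eventually_elim
    case (elim \<omega>)
    have "\<bar>F \<omega> * G \<omega>\<bar> \<le> (a * f \<omega> powr v) * (b * g \<omega> powr w)"
      unfolding abs_mult using elim f(1) by (intro mult_mono) auto
    also have "\<dots> = (a * b) * (f \<omega> powr v * g \<omega> powr w)" by simp
    also have "\<dots> \<le> (a * b) * h \<omega> powr (v + w)"
      using f(1) g(1) * by (intro mult_left_mono) auto
    finally show ?case .
  qed
  with f(1) g(1) int h1 h2 show ?thesis unfolding moment_dominated_def by (auto intro!: exI[of _ h])
qed

text \<open>The function \<open>u\<close> with the finite norm may fail to be measurable, for its norm is a lower
  integral; a measurable minorant \<open>f\<close> inherits the bound.\<close>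

lemma (in prob_space) L_norm_finite_imp_dominated:
  assumes f[measurable]: "f \<in> borel_measurable M" and le: "\<And>\<omega>. f \<omega> \<le> u \<omega>"
    and fin: "L_norm M q u < \<infinity>" and q: "q > 0"
  shows "(AE \<omega> in M. f \<omega> < \<infinity>) \<and>
    moment_dominated M (1 / q) (enn2real (L_norm M q u)) (\<lambda>\<omega>. enn2real (f \<omega>))"
proof -
  define J where "J = (\<integral>\<^sup>+\<omega>. ennpowr (u \<omega>) q \<partial>M)"
  define L where "L = enn2real (L_norm M q u)"
  have Jfin: "J < \<infinity>" using fin unfolding L_norm_def J_def[symmetric]
    by (auto simp: ennpowr_def less_top split: if_splits)
  have Leq: "L = enn2real J powr (1 / q)"
    using Jfin unfolding L_def L_norm_def J_def[symmetric] by (simp add: ennpowr_def)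
  have meas[measurable]: "(\<lambda>\<omega>. ennpowr (f \<omega>) q) \<in> borel_measurable M"
    unfolding ennpowr_def by measurable
  have "ennpowr (f \<omega>) q \<le> ennpowr (u \<omega>) q" for \<omega>
    using le[of \<omega>] q unfolding ennpowr_def
    by (auto simp: top_unique intro!: ennreal_leI powr_mono2 enn2real_mono simp: less_top)
  then have IJ: "(\<integral>\<^sup>+\<omega>. ennpowr (f \<omega>) q \<partial>M) \<le> J" unfolding J_def by (intro nn_integral_mono)
  then have "(\<integral>\<^sup>+\<omega>. ennpowr (f \<omega>) q \<partial>M) \<noteq> \<infinity>" using Jfin by (auto simp: top_unique)
  then have "AE \<omega> in M. ennpowr (f \<omega>) q \<noteq> \<infinity>" by (intro nn_integral_PInf_AE) auto
  then have AEfin: "AE \<omega> in M. f \<omega> < \<infinity>"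
    by eventually_elim (auto simp: ennpowr_def less_top[symmetric] split: if_splits)
  define k where "k \<omega> = enn2real (f \<omega>) powr q" for \<omega>
  have k0: "k \<omega> \<ge> 0" for \<omega> by (simp add: k_def)
  have km[measurable]: "k \<in> borel_measurable M" unfolding k_def by measurable
  have "(\<integral>\<^sup>+\<omega>. ennreal (k \<omega>) \<partial>M) \<le> (\<integral>\<^sup>+\<omega>. ennpowr (f \<omega>) q \<partial>M)"
    by (intro nn_integral_mono) (auto simp: ennpowr_def k_def)
  with IJ have kJ: "(\<integral>\<^sup>+\<omega>. ennreal (k \<omega>) \<partial>M) \<le> J" by (rule order_trans[rotated])
  then have kint: "integrable M k" using Jfin k0 by (intro integrableI_nonneg) (auto simp: top_unique less_top)
  have kle: "integral\<^sup>L M k \<le> enn2real J"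
  proof -
    have "ennreal (integral\<^sup>L M k) \<le> J" using kJ kint k0 by (simp add: nn_integral_eq_integral)
    then have "enn2real (ennreal (integral\<^sup>L M k)) \<le> enn2real J"
      using Jfin by (intro enn2real_mono) auto
    then show ?thesis using k0 by simp
  qed
  have dom: "moment_dominated M (1 / q) L (\<lambda>\<omega>. enn2real (f \<omega>))"
  proof (cases "enn2real J = 0")
    case True
    then have "integral\<^sup>L M k = 0" using kle Bochner_Integration.integral_nonneg[of M k, OF k0] by linarith
    then have "AE \<omega> in M. k \<omega> = 0" using kint k0 by (subst (asm) integral_nonneg_eq_0_iff_AE) auto
    then have "AE \<omega> in M. \<bar>enn2real (f \<omega>)\<bar> \<le> L * 1 powr (1 / q)"
      by eventually_elim (auto simp: k_def Leq)
    then show ?thesis unfolding moment_dominated_def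
      by (intro conjI exI[of _ "\<lambda>_. 1"]) (auto simp: prob_space Leq)
  next
    case False
    then have J0: "enn2real J > 0" by (simp add: order_less_le)
    define g where "g \<omega> = 1 + k \<omega> / enn2real J" for \<omega>
    have "enn2real (f \<omega>) \<le> L * g \<omega> powr (1 / q)" for \<omega>
    proof -
      have "enn2real (f \<omega>) = k \<omega> powr (1 / q)" using q by (simp add: k_def powr_powr)
      also have "\<dots> \<le> (enn2real J * g \<omega>) powr (1 / q)"
        using q J0 k0[of \<omega>] unfolding g_def by (intro powr_mono2) (auto simp: field_simps)
      also have "\<dots> = L * g \<omega> powr (1 / q)"
        using J0 k0[of \<omega>] unfolding Leq g_def by (subst powr_mult) auto
      finally show ?thesis .
    qed
    moreover have "integrable M g" unfolding g_def using kint by auto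
    moreover have "integral\<^sup>L M g \<le> 2"
      unfolding g_def using kint kle J0 by (simp add: prob_space)
    ultimately show ?thesis unfolding moment_dominated_def
      using k0 J0 by (intro conjI exI[of _ g]) (auto simp: Leq g_def)
  qed
  with AEfin show ?thesis unfolding L_def by blast
qed

section \<open>Random matrices of bounded mixed norm\<close>

text \<open>The analogue of the mixed norm with outer norm \<open>\<zeta>\<^sub>2 = 1\<close>: the constants of the entries form
  a matrix with column sums at most \<open>c\<close>.\<close>

definition mixed_dominated :: "'a measure \<Rightarrow> nat \<Rightarrow> real \<Rightarrow> real \<Rightarrow> (nat \<Rightarrow> nat \<Rightarrow> 'a \<Rightarrow> real) \<Rightarrow> bool" where
  "mixed_dominated M p w c F \<longleftrightarrow>
     (\<exists>a. (\<forall>j<p. \<forall>l<p. moment_dominated M w (a j l) (F j l)) \<and> (\<forall>l<p. (\<Sum>j<p. a j l) \<le> c))"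

lemma mixed_dominated_weaken:
  "mixed_dominated M p w c F \<Longrightarrow> w \<le> v \<Longrightarrow> c \<le> d \<Longrightarrow> mixed_dominated M p v d F"
  unfolding mixed_dominated_def
proof (elim exE conjE)
  fix a assume "w \<le> v" "c \<le> d" "\<forall>j<p. \<forall>l<p. moment_dominated M w (a j l) (F j l)"
    "\<forall>l<p. (\<Sum>j<p. a j l) \<le> c"
  then show "\<exists>a. (\<forall>j<p. \<forall>l<p. moment_dominated M v (a j l) (F j l)) \<and> (\<forall>l<p. (\<Sum>j<p. a j l) \<le> d)"
    by (intro exI[of _ a]) (auto intro: moment_dominated_weaken order_trans)
qed

lemma (in prob_space) mixed_dominated_sum:
  assumes "\<And>i. i \<in> I \<Longrightarrow> mixed_dominated M p w (c i) (F i)" "0 \<le> w" "w \<le> 1" "finite I"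
  shows "mixed_dominated M p w (\<Sum>i\<in>I. c i) (\<lambda>j l \<omega>. \<Sum>i\<in>I. F i j l \<omega>)"
proof -
  obtain a where a: "\<And>i j l. i \<in> I \<Longrightarrow> j < p \<Longrightarrow> l < p \<Longrightarrow> moment_dominated M w (a i j l) (F i j l)"
    "\<And>i l. i \<in> I \<Longrightarrow> l < p \<Longrightarrow> (\<Sum>j<p. a i j l) \<le> c i"
    using assms(1) unfolding mixed_dominated_def by metis
  show ?thesis unfolding mixed_dominated_def
  proof (intro exI[of _ "\<lambda>j l. \<Sum>i\<in>I. a i j l"] conjI allI impI)
    fix j l assume "j < p" "l < p"
    then show "moment_dominated M w (\<Sum>i\<in>I. a i j l) (\<lambda>\<omega>. \<Sum>i\<in>I. F i j l \<omega>)"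
      using assms a by (intro moment_dominated_sum) auto
  next
    fix l assume "l < p"
    have "(\<Sum>j<p. \<Sum>i\<in>I. a i j l) = (\<Sum>i\<in>I. \<Sum>j<p. a i j l)" by (rule sum.swap)
    also have "\<dots> \<le> (\<Sum>i\<in>I. c i)" using a(2) \<open>l < p\<close> by (intro sum_mono) auto
    finally show "(\<Sum>j<p. \<Sum>i\<in>I. a i j l) \<le> (\<Sum>i\<in>I. c i)" .
  qed
qed

lemma mixed_dominated_add:
  assumes "mixed_dominated M p w c F" "mixed_dominated M p w d G" "0 \<le> w" "w \<le> 1"
  shows "mixed_dominated M p w (c + d) (\<lambda>j l \<omega>. F j l \<omega> + G j l \<omega>)"
proof -
  obtain a where a: "\<forall>j<p. \<forall>l<p. moment_dominated M w (a j l) (F j l)" "\<forall>l<p. (\<Sum>j<p. a j l) \<le> c"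
    using assms(1) unfolding mixed_dominated_def by blast
  obtain b where b: "\<forall>j<p. \<forall>l<p. moment_dominated M w (b j l) (G j l)" "\<forall>l<p. (\<Sum>j<p. b j l) \<le> d"
    using assms(2) unfolding mixed_dominated_def by blast
  show ?thesis unfolding mixed_dominated_def
    using a b assms(3,4)
    by (intro exI[of _ "\<lambda>j l. a j l + b j l"])
       (auto simp: sum.distrib intro!: moment_dominated_add add_mono)
qed

text \<open>Submultiplicativity of the maximal column sum, combined with the inequalities of Minkowski and
  Hoelder for the entries.\<close>

lemma (in prob_space) mixed_dominated_kernel_prod:
  assumes "mixed_dominated M p v c F" "mixed_dominated M p w d G" "0 < v" "0 < w" "v + w \<le> 1" "0 \<le> c"
  shows "mixed_dominated M p (v + w) (c * d) (\<lambda>j l \<omega>. kernel_prod p (\<lambda>j l. F j l \<omega>) (\<lambda>j l. G j l \<omega>) j l)"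
proof -
  obtain a where a: "\<forall>j<p. \<forall>l<p. moment_dominated M v (a j l) (F j l)" "\<forall>l<p. (\<Sum>j<p. a j l) \<le> c"
    using assms(1) unfolding mixed_dominated_def by blast
  obtain b where b: "\<forall>j<p. \<forall>l<p. moment_dominated M w (b j l) (G j l)" "\<forall>l<p. (\<Sum>j<p. b j l) \<le> d"
    using assms(2) unfolding mixed_dominated_def by blast
  have b0: "b j l \<ge> 0" if "j < p" "l < p" for j l
    using b(1) that unfolding moment_dominated_def by blast
  show ?thesis unfolding mixed_dominated_def kernel_prod_def
  proof (intro exI[of _ "\<lambda>j l. \<Sum>m<p. a j m * b m l"] conjI allI impI)
    fix j l assume "j < p" "l < p"
    then show "moment_dominated M (v + w) (\<Sum>m<p. a j m * b m l) (\<lambda>\<omega>. \<Sum>m<p. F j m \<omega> * G m l \<omega>)"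
      using assms a b by (intro moment_dominated_sum moment_dominated_mult) auto
  next
    fix l assume l: "l < p"
    have "(\<Sum>j<p. \<Sum>m<p. a j m * b m l) = (\<Sum>m<p. (\<Sum>j<p. a j m) * b m l)"
      by (subst sum.swap) (simp add: sum_distrib_right)
    also have "\<dots> \<le> (\<Sum>m<p. c * b m l)" using a(2) b0 l by (intro sum_mono mult_right_mono) auto
    also have "\<dots> = c * (\<Sum>m<p. b m l)" by (simp add: sum_distrib_left)
    also have "\<dots> \<le> c * d" using b(2) l assms(6) by (intro mult_left_mono) auto
    finally show "(\<Sum>j<p. \<Sum>m<p. a j m * b m l) \<le> c * d" .
  qed
qed

text \<open>Square integrability is enough to make the squared Frobenius norm of order \<open>p\<close> rather than
  \<open>p\<^sup>2\<close>: in each of the \<open>p\<close> columns the sum of the squares of nonnegative constants is at most the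
  square of their sum. This is where the growth of the dimension is paid for.\<close>

lemma mixed_dominated_square_sum:
  assumes "mixed_dominated M p w c F" "w \<le> 1 / 2"
  obtains V where "integrable M V" "\<And>\<omega>. 0 \<le> V \<omega>" "integral\<^sup>L M V \<le> 2 * c\<^sup>2 * real p"
    "AE \<omega> in M. (\<Sum>j<p. \<Sum>l<p. (F j l \<omega>)\<^sup>2) \<le> V \<omega>"
proof -
  have "mixed_dominated M p (1/2) c F" using assms by (rule mixed_dominated_weaken) auto
  then obtain a where a: "\<forall>j<p. \<forall>l<p. moment_dominated M (1/2) (a j l) (F j l)" "\<forall>l<p. (\<Sum>j<p. a j l) \<le> c"
    unfolding mixed_dominated_def by blast
  have a0: "a j l \<ge> 0" if "j < p" "l < p" for j l
    using a(1) that unfolding moment_dominated_def by blast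
  define Q where "Q j l g \<longleftrightarrow> integrable M g \<and> (\<forall>\<omega>. 1 \<le> g \<omega>) \<and> integral\<^sup>L M g \<le> 2 \<and>
     (AE \<omega> in M. \<bar>F j l \<omega>\<bar> \<le> a j l * g \<omega> powr (1/2))" for j l and g :: "'a \<Rightarrow> real"
  define g where "g j l = (SOME g. Q j l g)" for j l
  have "\<exists>g. Q j l g" if "j < p" "l < p" for j l
    using a(1) that unfolding moment_dominated_def Q_def by blast
  then have "Q j l (g j l)" if "j < p" "l < p" for j l
    unfolding g_def using that by (metis someI_ex)
  then have g: "integrable M (g j l) \<and> (\<forall>\<omega>. 1 \<le> g j l \<omega>) \<and>
     integral\<^sup>L M (g j l) \<le> 2 \<and> (AE \<omega> in M. \<bar>F j l \<omega>\<bar> \<le> a j l * g j l \<omega> powr (1/2))"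
    if "j < p" "l < p" for j l
    using that unfolding Q_def by blast
  \<comment> \<open>With exponent \<open>1/2\<close> the bound \<open>a * sqrt g\<close> squares to \<open>a\<^sup>2 * g\<close>.\<close>
  define V where "V \<omega> = (\<Sum>j<p. \<Sum>l<p. (a j l)\<^sup>2 * g j l \<omega>)" for \<omega>
  have V1: "integrable M V" unfolding V_def using g by (intro Bochner_Integration.integrable_sum) auto
  have g0: "0 \<le> g j l \<omega>" if "j < p" "l < p" for j l \<omega> using g[OF that] by (meson order_trans zero_le_one)
  have V2: "0 \<le> V \<omega>" for \<omega> unfolding V_def using g0 by (intro sum_nonneg mult_nonneg_nonneg) auto
  have "integral\<^sup>L M V = (\<Sum>j<p. \<Sum>l<p. (a j l)\<^sup>2 * integral\<^sup>L M (g j l))"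
    unfolding V_def using g
    by (subst Bochner_Integration.integral_sum)
       (auto intro!: sum.cong Bochner_Integration.integrable_sum simp: Bochner_Integration.integral_sum)
  also have "\<dots> \<le> (\<Sum>j<p. \<Sum>l<p. (a j l)\<^sup>2 * 2)"
    using g by (intro sum_mono mult_left_mono) auto
  also have "\<dots> = 2 * (\<Sum>l<p. \<Sum>j<p. (a j l)\<^sup>2)"
    by (subst sum.swap) (simp add: sum_distrib_left mult.commute)
  also have "\<dots> \<le> 2 * (\<Sum>l<p. c\<^sup>2)"
  proof (intro mult_left_mono sum_mono)
    fix l assume l: "l \<in> {..<p}"
    have s0: "(\<Sum>j<p. a j l) \<ge> 0" using a0 l by (intro sum_nonneg) auto
    have "(\<Sum>j<p. (a j l)\<^sup>2) \<le> (\<Sum>j<p. a j l * (\<Sum>j<p. a j l))"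
      unfolding power2_eq_square using a0 l
      by (intro sum_mono mult_left_mono member_le_sum) auto
    also have "\<dots> = (\<Sum>j<p. a j l)\<^sup>2" by (simp add: power2_eq_square sum_distrib_right)
    also have "\<dots> \<le> c\<^sup>2" using a(2) l s0 by (intro power_mono) auto
    finally show "(\<Sum>j<p. (a j l)\<^sup>2) \<le> c\<^sup>2" .
  qed auto
  also have "\<dots> = 2 * c\<^sup>2 * real p" by simp
  finally have V3: "integral\<^sup>L M V \<le> 2 * c\<^sup>2 * real p" .
  have "AE \<omega> in M. \<forall>j\<in>{..<p}. \<forall>l\<in>{..<p}. \<bar>F j l \<omega>\<bar> \<le> a j l * g j l \<omega> powr (1/2)"
    using g by (intro AE_finite_allI) auto
  then have "AE \<omega> in M. (\<Sum>j<p. \<Sum>l<p. (F j l \<omega>)\<^sup>2) \<le> V \<omega>"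
  proof eventually_elim
    case (elim \<omega>)
    show ?case unfolding V_def
    proof (intro sum_mono)
      fix j l assume jl: "j \<in> {..<p}" "l \<in> {..<p}"
      have "(F j l \<omega>)\<^sup>2 = \<bar>F j l \<omega>\<bar>\<^sup>2" by simp
      also have "\<dots> \<le> (a j l * g j l \<omega> powr (1/2))\<^sup>2" using elim jl by (intro power_mono) auto
      also have "\<dots> = (a j l)\<^sup>2 * g j l \<omega>"
        using g0 jl by (simp add: power_mult_distrib powr_half_sqrt)
      finally show "(F j l \<omega>)\<^sup>2 \<le> (a j l)\<^sup>2 * g j l \<omega>" .
    qed
  qed
  with V1 V2 V3 that show thesis by blast
qed

text \<open>A column sum is the 1-norm of the image of a unit vector.\<close>

lemma column_sum_le_induced_norm_1:
  assumes "l < p" and nn: "\<And>j. j < p \<Longrightarrow> f j l \<ge> 0"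
  shows "ennreal (\<Sum>j<p. f j l) \<le> induced_norm 1 (mat p p (\<lambda>(j, l). f j l))"
proof -
  let ?A = "mat p p (\<lambda>(j, l). f j l)"
  let ?e = "unit_vec p l"
  have "vec_norm 1 ?e = (\<Sum>j<p. if j = l then 1 else 0)"
    using assms(1) by (auto simp: vec_norm_def unit_vec_def intro!: sum.cong)
  also have "\<dots> = 1" using assms(1) by simp
  finally have e: "vec_norm 1 ?e = 1" .
  have col: "?A *\<^sub>v ?e = vec p (\<lambda>j. f j l)"
    using assms(1) by (intro eq_vecI) (auto simp: row_def)
  have "vec_norm 1 (?A *\<^sub>v ?e) = (\<Sum>j<p. f j l)"
    unfolding col vec_norm_def using nn sum_nonneg[of "{..<p}" "\<lambda>j. f j l"] by simp
  then show ?thesis unfolding induced_norm_def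
    using e by (intro SUP_upper2[of ?e]) auto
qed

text \<open>A supremum over the uncountable set \<open>B\<close> need not be measurable. The supremum over a countable
  dense subset is, has no larger norm, and by continuity in the parameter it still dominates
  every member of the family.\<close>

lemma (in prob_space) mixed_norm_finite_imp_mixed_dominated:
  fixes Zb :: "'b::euclidean_space \<Rightarrow> 'a \<Rightarrow> real mat"
  assumes meas: "\<And>\<beta> j l. \<beta> \<in> B \<Longrightarrow> j < p \<Longrightarrow> l < p \<Longrightarrow> (\<lambda>\<omega>. Zb \<beta> \<omega> $$ (j, l)) \<in> borel_measurable M"
    and cont: "AE \<omega> in M. \<forall>j<p. \<forall>l<p. continuous_on B (\<lambda>\<beta>. Zb \<beta> \<omega> $$ (j, l))"
    and cl: "closed B" and q: "q > 0"
    and fin: "mixed_norm M p q 1 (sup_abs_entry B Zb) \<le> ennreal c" and c: "0 \<le> c"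
  obtains F where "mixed_dominated M p (1 / q) c F"
    "AE \<omega> in M. \<forall>\<beta>\<in>B. \<forall>j<p. \<forall>l<p. \<bar>Zb \<beta> \<omega> $$ (j, l)\<bar> \<le> F j l \<omega>"
proof -
  obtain D where D: "countable D" "D \<subseteq> B" "B \<subseteq> closure D" using separable[of B] by blast
  have clD: "closure D = B" using D cl by (simp add: closure_minimal subset_antisym)
  define f where "f j l \<omega> = (SUP \<beta>\<in>D. ennreal \<bar>Zb \<beta> \<omega> $$ (j, l)\<bar>)" for j l \<omega>
  have fm: "f j l \<in> borel_measurable M" if "j < p" "l < p" for j l
    unfolding f_def using D meas[OF _ that]
    by (intro borel_measurable_SUP) auto
  have fle: "f j l \<omega> \<le> sup_abs_entry B Zb j l \<omega>" for j l \<omega>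
    unfolding f_def sup_abs_entry_def using D(2) by (intro SUP_subset_mono) auto
  have Lfin: "L_norm M q (sup_abs_entry B Zb j l) < \<infinity>" if "j < p" "l < p" for j l
    using fin that unfolding mixed_norm_def by (auto simp: top_unique split: if_splits)
  define F where "F j l \<omega> = enn2real (f j l \<omega>)" for j l \<omega>
  define a where "a j l = enn2real (L_norm M q (sup_abs_entry B Zb j l))" for j l
  have *: "(AE \<omega> in M. f j l \<omega> < \<infinity>) \<and> moment_dominated M (1 / q) (a j l) (F j l)"
    if "j < p" "l < p" for j l
    unfolding F_def a_def by (rule L_norm_finite_imp_dominated[OF fm[OF that] fle Lfin[OF that] q])
  have "mixed_dominated M p (1 / q) c F"
    unfolding mixed_dominated_def
  proof (intro exI[of _ a] conjI allI impI)
    fix l assume l: "l < p"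
    have "ennreal (\<Sum>j<p. a j l) \<le> induced_norm 1 (mat p p (\<lambda>(j, l). a j l))"
      using l by (intro column_sum_le_induced_norm_1) (auto simp: a_def)
    also have "\<dots> = mixed_norm M p q 1 (sup_abs_entry B Zb)"
      using Lfin by (auto simp: mixed_norm_def a_def)
    also have "\<dots> \<le> ennreal c" by (rule fin)
    finally show "(\<Sum>j<p. a j l) \<le> c" using c by simp
  qed (use * in auto)
  moreover have "AE \<omega> in M. \<forall>\<beta>\<in>B. \<forall>j<p. \<forall>l<p. \<bar>Zb \<beta> \<omega> $$ (j, l)\<bar> \<le> F j l \<omega>"
  proof -
    have "AE \<omega> in M. \<forall>j\<in>{..<p}. \<forall>l\<in>{..<p}. f j l \<omega> < \<infinity>"
      using * by (intro AE_finite_allI) auto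
    with cont show ?thesis
    proof eventually_elim
      case (elim \<omega>)
      show ?case
      proof (intro ballI allI impI)
        fix \<beta> j l assume b: "\<beta> \<in> B" and jl: "j < p" "l < p"
        have fi: "f j l \<omega> < \<infinity>" using elim jl by auto
        have c': "continuous_on (closure D) (\<lambda>\<beta>. \<bar>Zb \<beta> \<omega> $$ (j, l)\<bar>)"
          unfolding clD using elim(1) jl by (intro continuous_on_rabs) auto
        show "\<bar>Zb \<beta> \<omega> $$ (j, l)\<bar> \<le> F j l \<omega>"
        proof (rule continuous_le_on_closure[OF c'])
          show "\<beta> \<in> closure D" using b clD by simp
          fix x assume "x \<in> D"
          then have "ennreal \<bar>Zb x \<omega> $$ (j, l)\<bar> \<le> f j l \<omega>" unfolding f_def by (rule SUP_upper)
          then have "enn2real (ennreal \<bar>Zb x \<omega> $$ (j, l)\<bar>) \<le> enn2real (f j l \<omega>)"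
            using fi by (intro enn2real_mono) auto
          then show "\<bar>Zb x \<omega> $$ (j, l)\<bar> \<le> F j l \<omega>" unfolding F_def by simp
        qed
      qed
    qed
  qed
  ultimately show thesis using that by blast
qed

section \<open>Convergence in probability and in distribution\<close>

lemma borel_measurable_matrix_lambda:
  fixes f :: "'k::finite \<Rightarrow> 'k \<Rightarrow> 'a \<Rightarrow> real"
  assumes "\<And>k1 k2. f k1 k2 \<in> borel_measurable M"
  shows "(\<lambda>\<omega>. (\<chi> k1 k2. f k1 k2 \<omega>) :: real^'k^'k) \<in> borel_measurable M"
  using assms
  by (subst borel_measurable_euclidean_space)
     (auto simp: Basis_vec_def inner_axis axis_eq_axis)

lemma conv_in_prob_cong_AE:
  fixes U V :: "nat \<Rightarrow> 'a \<Rightarrow> 'b::{metric_space, second_countable_topology}"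
  assumes U: "\<forall>\<^sub>F t in sequentially. U t \<in> borel_measurable M"
    and V: "\<forall>\<^sub>F t in sequentially. V t \<in> borel_measurable M"
    and eq: "\<forall>\<^sub>F t in sequentially. AE \<omega> in M. U t \<omega> = V t \<omega>"
    and conv: "conv_in_prob M U c"
  shows "conv_in_prob M V c"
  unfolding conv_in_prob_def
proof (intro allI impI)
  fix e :: real assume "0 < e"
  then have "(\<lambda>t. measure M {\<omega>\<in>space M. dist (U t \<omega>) c > e}) \<longlonglongrightarrow> 0"
    using conv unfolding conv_in_prob_def by blast
  moreover have "\<forall>\<^sub>F t in sequentially. measure M {\<omega>\<in>space M. dist (U t \<omega>) c > e} = measure M {\<omega>\<in>space M. dist (V t \<omega>) c > e}"
    using U V eq
  proof eventually_elim
    case (elim t)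
    note [measurable] = elim(1,2)
    show ?case
      by (rule measure_eq_AE) (use elim(3) in \<open>eventually_elim, auto\<close>, measurable)
  qed
  ultimately show "(\<lambda>t. measure M {\<omega>\<in>space M. dist (V t \<omega>) c > e}) \<longlonglongrightarrow> 0"
    by (rule Lim_transform_eventually)
qed

lemma weak_conv_m_cong:
  assumes "weak_conv_m \<mu> \<nu>" "\<forall>\<^sub>F t in sequentially. \<mu> t = \<mu>' t"
  shows "weak_conv_m \<mu>' \<nu>"
  using assms unfolding weak_conv_m_def weak_conv_def
  by (auto intro: Lim_transform_eventually elim!: eventually_mono)

text \<open>The test function is a continuous cutoff, equal to \<open>1\<close> outside the ball of radius \<open>R + 1\<close> and
  to \<open>0\<close> inside the ball of radius \<open>R\<close>; its expectation under the limit vanishes as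
  \<open>R \<rightarrow> \<infinity>\<close>.\<close>

lemma conv_in_dist_tight:
  fixes U :: "nat \<Rightarrow> 'a \<Rightarrow> 'b::euclidean_space" and Z :: "'c \<Rightarrow> 'b"
  assumes "prob_space M" "prob_space N" and Z[measurable]: "Z \<in> borel_measurable N"
    and U: "\<And>t. U t \<in> borel_measurable M" and conv: "conv_in_dist M U N Z" and e: "0 < e"
  obtains m where "0 < m" "\<forall>\<^sub>F t in sequentially. measure M {\<omega>\<in>space M. norm (U t \<omega>) > m} < e"
proof -
  interpret M: prob_space M by fact
  interpret N: prob_space N by fact
  define f where "f R z = min 1 (max 0 (norm z - R))" for R :: real and z :: 'b
  have fcont: "continuous_on UNIV (f R)" for R unfolding f_def by (intro continuous_intros)
  have fb: "0 \<le> f R z" "f R z \<le> 1" for R z by (auto simp: f_def)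
  have fm[measurable]: "f R \<in> borel_measurable borel" for R
    using fcont by (rule borel_measurable_continuous_onI)
  have "(\<lambda>n. \<integral>\<omega>. f (real n) (Z \<omega>) \<partial>N) \<longlonglongrightarrow> (\<integral>\<omega>. 0 \<partial>N)"
  proof (rule integral_dominated_convergence[where w = "\<lambda>_. 1"])
    show "AE \<omega> in N. (\<lambda>n. f (real n) (Z \<omega>)) \<longlonglongrightarrow> 0"
    proof (intro AE_I2 tendsto_eventually)
      fix \<omega>
      have "\<forall>\<^sub>F n in sequentially. norm (Z \<omega>) \<le> real n"
        by (meson eventually_sequentiallyI nat_ceiling_le_eq)
      then show "\<forall>\<^sub>F n in sequentially. f (real n) (Z \<omega>) = 0"
        by eventually_elim (auto simp: f_def)
    qed
  qed (use fb in auto)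
  then have "\<forall>\<^sub>F n in sequentially. (\<integral>\<omega>. f (real n) (Z \<omega>) \<partial>N) < e"
    using e by (intro order_tendstoD(2)) auto
  then obtain n where n: "(\<integral>\<omega>. f (real n) (Z \<omega>) \<partial>N) < e"
    by (meson eventually_sequentially order_refl)
  have "bounded (range (f (real n)))"
    using fb by (auto intro!: boundedI[of _ 1])
  then have "(\<lambda>t. \<integral>\<omega>. f (real n) (U t \<omega>) \<partial>M) \<longlonglongrightarrow> (\<integral>\<omega>. f (real n) (Z \<omega>) \<partial>N)"
    using conv fcont unfolding conv_in_dist_def by blast
  then have "\<forall>\<^sub>F t in sequentially. (\<integral>\<omega>. f (real n) (U t \<omega>) \<partial>M) < e"
    using n by (rule order_tendstoD(2))
  then have "\<forall>\<^sub>F t in sequentially. measure M {\<omega>\<in>space M. norm (U t \<omega>) > real n + 1} < e"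
  proof eventually_elim
    case (elim t)
    note U[of t, measurable]
    have "measure M {\<omega>\<in>space M. norm (U t \<omega>) > real n + 1}
        = (\<integral>\<omega>. indicator {\<omega>\<in>space M. norm (U t \<omega>) > real n + 1} \<omega> \<partial>M)"
      by simp
    also have "\<dots> \<le> (\<integral>\<omega>. f (real n) (U t \<omega>) \<partial>M)"
    proof (rule integral_mono)
      show "integrable M (\<lambda>\<omega>. f (real n) (U t \<omega>))"
        using fb by (intro M.integrable_const_bound[of _ 1]) auto
    qed (auto simp: f_def M.emeasure_eq_measure split: split_indicator)
    finally show ?case using elim by simp
  qed
  then show thesis by (intro that[of "real n + 1"]) auto
qed

text \<open>Slutsky's lemma together with the continuous mapping theorem. Weak convergence on the line may
  be tested with the functions \<open>cts_step\<close>; these are uniformly continuous, so closeness in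
  probability passes to the expectations without any tightness.\<close>

lemma weak_conv_m_if_close_in_prob:
  fixes U :: "nat \<Rightarrow> 'a \<Rightarrow> real" and \<zeta> :: "nat \<Rightarrow> 'a \<Rightarrow> 'b::euclidean_space" and Z :: "'c \<Rightarrow> 'b"
  assumes "prob_space M" "prob_space N" and Z[measurable]: "Z \<in> borel_measurable N"
    and \<zeta>: "\<And>t. \<zeta> t \<in> borel_measurable M" and conv: "conv_in_dist M \<zeta> N Z"
    and \<phi>: "continuous_on UNIV \<phi>"
    and U: "\<forall>\<^sub>F t in sequentially. U t \<in> borel_measurable M"
    and close: "\<And>e. 0 < e \<Longrightarrow> (\<lambda>t. measure M {\<omega>\<in>space M. \<bar>U t \<omega> - \<phi> (\<zeta> t \<omega>)\<bar> > e}) \<longlonglongrightarrow> 0"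
  shows "weak_conv_m (\<lambda>t. distr M borel (U t)) (distr N borel (\<lambda>\<omega>. \<phi> (Z \<omega>)))"
proof -
  interpret M: prob_space M by fact
  interpret N: prob_space N by fact
  have [measurable]: "\<phi> \<in> borel_measurable borel" using \<phi> by (rule borel_measurable_continuous_onI)
  \<comment> \<open>The criterion needs genuine distributions at all indices, not only at late ones.\<close>
  define U' where "U' t = (if U t \<in> borel_measurable M then U t else (\<lambda>_. 0))" for t
  have U'[measurable]: "U' t \<in> borel_measurable M" for t unfolding U'_def by auto
  have U'eq: "\<forall>\<^sub>F t in sequentially. U' t = U t" using U by eventually_elim (auto simp: U'_def)
  have "weak_conv_m (\<lambda>t. distr M borel (U' t)) (distr N borel (\<lambda>\<omega>. \<phi> (Z \<omega>)))"
  proof (rule integral_cts_step_conv_imp_weak_conv)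
    show "real_distribution (distr M borel (U' t))" for t
      by (intro M.real_distribution_distr) auto
    show "real_distribution (distr N borel (\<lambda>\<omega>. \<phi> (Z \<omega>)))"
      by (intro N.real_distribution_distr) auto
    fix x y :: real assume xy: "x < y"
    define s where "s = cts_step x y"
    have suc: "uniformly_continuous_on UNIV s" unfolding s_def by (rule cts_step_uniformly_continuous[OF xy])
    then have scont: "continuous_on UNIV s" by (rule uniformly_continuous_imp_continuous)
    have [measurable]: "s \<in> borel_measurable borel" using scont by (rule borel_measurable_continuous_onI)
    have sb: "0 \<le> s v" "s v \<le> 1" for v using xy by (auto simp: s_def cts_step_def divide_simps)
    have bd: "\<bar>s v - s w\<bar> \<le> 1" for v w using sb[of v] sb[of w] by linarith
    have "continuous_on UNIV (\<lambda>z. s (\<phi> z))"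
      using continuous_on_compose2[OF scont \<phi>] by simp
    moreover have "bounded (range (\<lambda>z. s (\<phi> z)))"
      using sb by (auto intro!: boundedI[of _ 1])
    ultimately have c1: "(\<lambda>t. \<integral>\<omega>. s (\<phi> (\<zeta> t \<omega>)) \<partial>M) \<longlonglongrightarrow> (\<integral>\<omega>. s (\<phi> (Z \<omega>)) \<partial>N)"
      using conv unfolding conv_in_dist_def by (auto dest!: spec[of _ "\<lambda>z. s (\<phi> z)"])
    have c2: "(\<lambda>t. (\<integral>\<omega>. s (U' t \<omega>) \<partial>M) - (\<integral>\<omega>. s (\<phi> (\<zeta> t \<omega>)) \<partial>M)) \<longlonglongrightarrow> 0"
    proof (rule LIMSEQ_I)
      fix r :: real assume r: "0 < r"
      obtain d where d: "d > 0" "\<And>v w. \<bar>v - w\<bar> < d \<Longrightarrow> \<bar>s v - s w\<bar> < r / 2"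
        using suc r unfolding uniformly_continuous_on_def dist_real_def
        by (metis UNIV_I half_gt_zero)
      have "\<forall>\<^sub>F t in sequentially. measure M {\<omega>\<in>space M. \<bar>U t \<omega> - \<phi> (\<zeta> t \<omega>)\<bar> > d / 2} < r / 2"
        using close[of "d / 2"] d r by (intro order_tendstoD(2)) auto
      with U'eq have "\<forall>\<^sub>F t in sequentially. norm ((\<integral>\<omega>. s (U' t \<omega>) \<partial>M) - (\<integral>\<omega>. s (\<phi> (\<zeta> t \<omega>)) \<partial>M) - 0) < r"
      proof eventually_elim
        case (elim t)
        note \<zeta>[of t, measurable]
        let ?A = "{\<omega>\<in>space M. \<bar>U' t \<omega> - \<phi> (\<zeta> t \<omega>)\<bar> > d / 2}"
        have i1: "integrable M (\<lambda>\<omega>. s (U' t \<omega>))" "integrable M (\<lambda>\<omega>. s (\<phi> (\<zeta> t \<omega>)))"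
          using sb by (auto intro!: M.integrable_const_bound[of _ 1])
        have "\<bar>(\<integral>\<omega>. s (U' t \<omega>) \<partial>M) - (\<integral>\<omega>. s (\<phi> (\<zeta> t \<omega>)) \<partial>M)\<bar>
            = \<bar>\<integral>\<omega>. s (U' t \<omega>) - s (\<phi> (\<zeta> t \<omega>)) \<partial>M\<bar>"
          using i1 by simp
        also have "\<dots> \<le> (\<integral>\<omega>. \<bar>s (U' t \<omega>) - s (\<phi> (\<zeta> t \<omega>))\<bar> \<partial>M)"
          by (rule integral_abs_bound)
        also have "\<dots> \<le> (\<integral>\<omega>. r / 2 + indicator ?A \<omega> \<partial>M)"
        proof (rule integral_mono)
          show "integrable M (\<lambda>\<omega>. r / 2 + indicator ?A \<omega>)"
            by (intro Bochner_Integration.integrable_add)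
               (auto simp: M.emeasure_eq_measure)
          show "integrable M (\<lambda>\<omega>. \<bar>s (U' t \<omega>) - s (\<phi> (\<zeta> t \<omega>))\<bar>)" using i1 by auto
          fix \<omega> assume "\<omega> \<in> space M"
          then show "\<bar>s (U' t \<omega>) - s (\<phi> (\<zeta> t \<omega>))\<bar> \<le> r / 2 + indicator ?A \<omega>"
            using d(2)[of "U' t \<omega>" "\<phi> (\<zeta> t \<omega>)"] bd[of "U' t \<omega>" "\<phi> (\<zeta> t \<omega>)"] d(1) r
            by (auto split: split_indicator)
        qed
        also have "\<dots> = r / 2 + measure M ?A"
          by (subst Bochner_Integration.integral_add) (auto simp: M.prob_space M.emeasure_eq_measure)
        also have "\<dots> < r" using elim by auto
        finally show ?case by simp
      qed
      then show "\<exists>no. \<forall>t\<ge>no. norm ((\<integral>\<omega>. s (U' t \<omega>) \<partial>M) - (\<integral>\<omega>. s (\<phi> (\<zeta> t \<omega>)) \<partial>M) - 0) < r"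
        unfolding eventually_sequentially .
    qed
    from tendsto_add[OF c1 c2]
    have "(\<lambda>t. \<integral>\<omega>. s (U' t \<omega>) \<partial>M) \<longlonglongrightarrow> (\<integral>\<omega>. s (\<phi> (Z \<omega>)) \<partial>N)" by simp
    then show "(\<lambda>t. integral\<^sup>L (distr M borel (U' t)) (cts_step x y)) \<longlonglongrightarrow>
        integral\<^sup>L (distr N borel (\<lambda>\<omega>. \<phi> (Z \<omega>))) (cts_step x y)"
      unfolding s_def[symmetric] by (simp add: integral_distr)
  qed
  then show ?thesis
    unfolding weak_conv_m_def weak_conv_def
    using U'eq
    by (auto intro: Lim_transform_eventually elim!: eventually_mono)
qed

section \<open>Quadratic forms and squared Frobenius norms\<close>

lemma quadratic_form_bound:
  fixes A :: "real^'k^'k" and z :: "real^'k"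
  shows "\<bar>z \<bullet> (A *v z)\<bar> \<le> (real CARD('k))\<^sup>2 * norm A * (norm z)\<^sup>2"
proof -
  have c: "\<bar>vec_nth (vec_nth A i) j\<bar> \<le> norm A" for i j
    using component_le_norm_cart[of "vec_nth A i" j] Finite_Cartesian_Product.norm_nth_le[of A i] by linarith
  have "norm (A *v z) \<le> onorm ((*v) A) * norm z"
    by (intro onorm) (simp add: matrix_vector_mul_bounded_linear)
  also have "\<dots> \<le> (real CARD('k) * real CARD('k) * norm A) * norm z"
    by (intro mult_right_mono onorm_le_matrix_component c) auto
  finally have "norm z * norm (A *v z) \<le> norm z * ((real CARD('k) * real CARD('k) * norm A) * norm z)"
    by (intro mult_left_mono) auto
  with Cauchy_Schwarz_ineq2[of z "A *v z"] show ?thesis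
    by (simp add: power2_eq_square mult_ac)
qed

text \<open>Deterministic comparison on the event that \<open>\<zeta>\<close> is bounded, \<open>H\<close> is close to \<open>Q\<close> and \<open>V\<close> is
  small. The hypothesis compares square roots because for squared norms this is what the
  triangle inequality delivers.\<close>

lemma quadratic_form_close_in_prob:
  fixes \<zeta> :: "nat \<Rightarrow> 'a \<Rightarrow> real^'k" and H :: "nat \<Rightarrow> 'a \<Rightarrow> real^'k^'k"
  assumes "prob_space M"
    and \<zeta>: "\<And>t. \<zeta> t \<in> borel_measurable M"
    and tight: "\<And>e. 0 < e \<Longrightarrow> \<exists>m. \<forall>\<^sub>F t in sequentially. measure M {\<omega>\<in>space M. norm (\<zeta> t \<omega>) > m} < e"
    and H: "\<forall>\<^sub>F t in sequentially. H t \<in> borel_measurable M" and HQ: "conv_in_prob M H Q"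
    and V: "\<forall>\<^sub>F t in sequentially. V t \<in> borel_measurable M" and V0: "conv_in_prob M V (0::real)"
    and U: "\<forall>\<^sub>F t in sequentially. U t \<in> borel_measurable M"
    and close: "\<And>m. \<forall>\<^sub>F t in sequentially. AE \<omega> in M. norm (\<zeta> t \<omega>) \<le> m \<longrightarrow>
        0 \<le> U t \<omega> \<and> 0 \<le> \<zeta> t \<omega> \<bullet> (H t \<omega> *v \<zeta> t \<omega>) \<and>
        \<bar>sqrt (U t \<omega>) - sqrt (\<zeta> t \<omega> \<bullet> (H t \<omega> *v \<zeta> t \<omega>))\<bar> \<le> (norm (\<zeta> t \<omega>))\<^sup>2 * sqrt (V t \<omega>)"
    and e: "0 < e"
  shows "(\<lambda>t. measure M {\<omega>\<in>space M. \<bar>U t \<omega> - \<zeta> t \<omega> \<bullet> (Q *v \<zeta> t \<omega>)\<bar> > e}) \<longlonglongrightarrow> 0"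
proof (rule LIMSEQ_I)
  interpret prob_space M by fact
  fix r :: real assume r: "0 < r"
  obtain m0 where m0: "\<forall>\<^sub>F t in sequentially. measure M {\<omega>\<in>space M. norm (\<zeta> t \<omega>) > m0} < r / 3"
    using tight[of "r / 3"] r by auto
  define m where "m = max m0 1"
  have m1: "m \<ge> 1" "m0 \<le> m" by (auto simp: m_def)
  define c where "c = (real CARD('k))\<^sup>2"
  have c0: "c \<ge> 0" by (simp add: c_def)
  \<comment> \<open>The distance of \<open>U\<close> and the limiting form on the good event; it vanishes with \<open>d\<close>.\<close>
  define b where "b d = m\<^sup>2 * sqrt d * (2 * sqrt (c * (norm Q + d) * m\<^sup>2) + m\<^sup>2 * sqrt d) + c * d * m\<^sup>2" for d
  have "(b \<longlongrightarrow> m\<^sup>2 * sqrt 0 * (2 * sqrt (c * (norm Q + 0) * m\<^sup>2) + m\<^sup>2 * sqrt 0) + c * 0 * m\<^sup>2) (at_right 0)"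
    unfolding b_def by (intro tendsto_intros)
  then have "\<forall>\<^sub>F d in at_right 0. b d < e" using e by (intro order_tendstoD(2)) auto
  moreover have "\<forall>\<^sub>F d::real in at_right 0. d > 0" by (simp add: eventually_at_right_less)
  ultimately have "\<forall>\<^sub>F d in at_right 0. b d < e \<and> d > 0" by eventually_elim auto
  then obtain d where d: "b d < e" "d > 0"
    using eventually_happens'[of "at_right (0::real)"] by auto
  have bound: "\<bar>u - z \<bullet> (Q *v z)\<bar> \<le> b d"
    if z: "norm z \<le> m" and A: "dist A Q \<le> d" and v: "v \<le> d"
      and u: "0 \<le> u" "0 \<le> z \<bullet> (A *v z)" "\<bar>sqrt u - sqrt (z \<bullet> (A *v z))\<bar> \<le> (norm z)\<^sup>2 * sqrt v"
    for u v and z :: "real^'k" and A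
  proof -
    define x where "x = sqrt u"
    define y where "y = sqrt (z \<bullet> (A *v z))"
    have xy: "x \<ge> 0" "y \<ge> 0" "x\<^sup>2 = u" "y\<^sup>2 = z \<bullet> (A *v z)" using u by (auto simp: x_def y_def)
    have nz: "(norm z)\<^sup>2 \<le> m\<^sup>2" using z by (intro power_mono) auto
    have "\<bar>x - y\<bar> \<le> (norm z)\<^sup>2 * sqrt v" using u by (simp add: x_def y_def)
    also have "\<dots> \<le> (norm z)\<^sup>2 * sqrt d" using v by (intro mult_left_mono) auto
    also have "\<dots> \<le> m\<^sup>2 * sqrt d" using nz d by (intro mult_right_mono) auto
    finally have 1: "\<bar>x - y\<bar> \<le> m\<^sup>2 * sqrt d" .
    have "norm A \<le> norm Q + d" using A norm_triangle_sub[of A Q] by (simp add: dist_norm)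
    then have "c * norm A * (norm z)\<^sup>2 \<le> c * (norm Q + d) * m\<^sup>2"
      using c0 nz d by (intro mult_mono mult_nonneg_nonneg) auto
    then have "y\<^sup>2 \<le> c * (norm Q + d) * m\<^sup>2"
      using quadratic_form_bound[of z A] unfolding xy c_def by linarith
    then have 2: "y \<le> sqrt (c * (norm Q + d) * m\<^sup>2)" by (simp add: real_le_rsqrt)
    have "u - y\<^sup>2 = (x - y) * (x + y)"
      unfolding xy(3)[symmetric] by (simp add: power2_eq_square algebra_simps)
    then have "\<bar>u - y\<^sup>2\<bar> = \<bar>x - y\<bar> * (x + y)"
      using xy by (simp add: abs_mult)
    also have "\<dots> \<le> (m\<^sup>2 * sqrt d) * (2 * sqrt (c * (norm Q + d) * m\<^sup>2) + m\<^sup>2 * sqrt d)"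
      using 1 2 xy by (intro mult_mono) auto
    finally have 3: "\<bar>u - y\<^sup>2\<bar> \<le> (m\<^sup>2 * sqrt d) * (2 * sqrt (c * (norm Q + d) * m\<^sup>2) + m\<^sup>2 * sqrt d)" .
    have "y\<^sup>2 - z \<bullet> (Q *v z) = z \<bullet> ((A - Q) *v z)"
      unfolding xy by (simp add: matrix_vector_mult_diff_rdistrib inner_diff_right)
    then have "\<bar>y\<^sup>2 - z \<bullet> (Q *v z)\<bar> \<le> c * norm (A - Q) * (norm z)\<^sup>2"
      using quadratic_form_bound[of z "A - Q"] by (simp add: c_def)
    also have "\<dots> \<le> c * d * m\<^sup>2"
      using A c0 nz d by (intro mult_mono) (auto simp: dist_norm)
    finally have "\<bar>y\<^sup>2 - z \<bullet> (Q *v z)\<bar> \<le> c * d * m\<^sup>2" .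
    with 3 show ?thesis unfolding b_def by linarith
  qed
  have pH: "\<forall>\<^sub>F t in sequentially. measure M {\<omega>\<in>space M. dist (H t \<omega>) Q > d} < r / 3"
    using HQ d r unfolding conv_in_prob_def by (intro order_tendstoD(2)[where y = 0]) auto
  have pV: "\<forall>\<^sub>F t in sequentially. measure M {\<omega>\<in>space M. dist (V t \<omega>) 0 > d} < r / 3"
    using V0 d r unfolding conv_in_prob_def by (intro order_tendstoD(2)[where y = 0]) auto
  have "\<forall>\<^sub>F t in sequentially. norm (measure M {\<omega>\<in>space M. \<bar>U t \<omega> - \<zeta> t \<omega> \<bullet> (Q *v \<zeta> t \<omega>)\<bar> > e} - 0) < r"
    using m0 pH pV close[of m] H V U
  proof eventually_elim
    case (elim t)
    note [measurable] = \<zeta>[of t] elim(5-7)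
    let ?A = "{\<omega>\<in>space M. norm (\<zeta> t \<omega>) > m0}"
    let ?B = "{\<omega>\<in>space M. dist (H t \<omega>) Q > d}"
    let ?C = "{\<omega>\<in>space M. dist (V t \<omega>) 0 > d}"
    have "measure M {\<omega>\<in>space M. \<bar>U t \<omega> - \<zeta> t \<omega> \<bullet> (Q *v \<zeta> t \<omega>)\<bar> > e} \<le> measure M (?A \<union> ?B \<union> ?C)"
    proof (rule finite_measure_mono_AE)
      show "AE \<omega> in M. \<omega> \<in> {\<omega>\<in>space M. \<bar>U t \<omega> - \<zeta> t \<omega> \<bullet> (Q *v \<zeta> t \<omega>)\<bar> > e} \<longrightarrow> \<omega> \<in> ?A \<union> ?B \<union> ?C"
        using elim(4)
      proof eventually_elim
        case (elim \<omega>)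
        show ?case
        proof (rule impI, rule ccontr)
          assume a: "\<omega> \<in> {\<omega>\<in>space M. \<bar>U t \<omega> - \<zeta> t \<omega> \<bullet> (Q *v \<zeta> t \<omega>)\<bar> > e}" and n: "\<omega> \<notin> ?A \<union> ?B \<union> ?C"
          then have "norm (\<zeta> t \<omega>) \<le> m" "dist (H t \<omega>) Q \<le> d" "V t \<omega> \<le> d" using m1 by auto
          then have "\<bar>U t \<omega> - \<zeta> t \<omega> \<bullet> (Q *v \<zeta> t \<omega>)\<bar> \<le> b d" using elim
            by (intro bound[of "\<zeta> t \<omega>" "H t \<omega>" "V t \<omega>" "U t \<omega>"]) auto
          with a d show False by auto
        qed
      qed
    qed measurable
    also have "\<dots> \<le> measure M (?A \<union> ?B) + measure M ?C"
      by (rule measure_Un_le) measurable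
    also have "measure M (?A \<union> ?B) \<le> measure M ?A + measure M ?B"
      by (rule measure_Un_le) measurable
    also have "measure M ?A + measure M ?B + measure M ?C < r" using elim by linarith
    finally show ?case by simp
  qed
  then show "\<exists>no. \<forall>t\<ge>no. norm (measure M {\<omega>\<in>space M. \<bar>U t \<omega> - \<zeta> t \<omega> \<bullet> (Q *v \<zeta> t \<omega>)\<bar> > e} - 0) < r"
    unfolding eventually_sequentially .
qed

text \<open>Here \<open>D\<close> is the matrix error and \<open>G k\<close> its derivative in the direction \<open>k\<close>, both given by
  their entries. The squared Frobenius norm of the linear part is exactly a quadratic form in the
  rescaled parameter error, with the matrix of inner products of the \<open>G k\<close>. An error
  \<open>\<bar>h\<bar>\<^sup>4 V\<close> with \<open>E V = O(p)\<close> is negligible by Markov's inequality, since after rescaling it carries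
  the factor \<open>1/(n p\<^sup>2)\<close>.\<close>

lemma frobenius_delta_method:
  fixes n p :: "nat \<Rightarrow> nat" and \<theta> :: "nat \<Rightarrow> 'a \<Rightarrow> real^'k" and Z :: "'c \<Rightarrow> real^'k"
    and D :: "nat \<Rightarrow> 'a \<Rightarrow> nat \<Rightarrow> nat \<Rightarrow> real" and G :: "nat \<Rightarrow> 'a \<Rightarrow> 'k \<Rightarrow> nat \<Rightarrow> nat \<Rightarrow> real"
  assumes "prob_space M" "prob_space N" and Z: "Z \<in> borel_measurable N"
    and np: "\<And>t. 1 \<le> n t" "\<And>t. 1 \<le> p t" and p_lim: "filterlim p at_top sequentially"
    and \<theta>: "\<And>t. \<theta> t \<in> borel_measurable M"
    and lim: "conv_in_dist M (\<lambda>t \<omega>. sqrt (real (n t) * real (p t)) *\<^sub>R (\<theta> t \<omega> - \<theta>0)) N Z"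
    and D: "\<forall>\<^sub>F t in sequentially. \<forall>j<p t. \<forall>l<p t. (\<lambda>\<omega>. D t \<omega> j l) \<in> borel_measurable M"
    and G: "\<forall>\<^sub>F t in sequentially. \<forall>k. \<forall>j<p t. \<forall>l<p t. (\<lambda>\<omega>. G t \<omega> k j l) \<in> borel_measurable M"
    and Q: "conv_in_prob M (\<lambda>t \<omega>. \<chi> k1 k2. 1 / real (p t) * (\<Sum>j<p t. \<Sum>l<p t. G t \<omega> k1 j l * G t \<omega> k2 j l)) Q"
    and r: "0 < r"
    and rem: "\<forall>\<^sub>F t in sequentially. \<exists>V. integrable M V \<and> (\<forall>\<omega>. 0 \<le> V \<omega>) \<and> integral\<^sup>L M V \<le> \<kappa> * real (p t) \<and>
       (AE \<omega> in M. norm (\<theta> t \<omega> - \<theta>0) < r \<longrightarrow>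
          (\<Sum>j<p t. \<Sum>l<p t. (D t \<omega> j l - (\<Sum>k\<in>UNIV. vec_nth (\<theta> t \<omega> - \<theta>0) k * G t \<omega> k j l))\<^sup>2)
            \<le> norm (\<theta> t \<omega> - \<theta>0) ^ 4 * V \<omega>)"
  shows "weak_conv_m (\<lambda>t. distr M borel (\<lambda>\<omega>. real (n t) * (\<Sum>j<p t. \<Sum>l<p t. (D t \<omega> j l)\<^sup>2)))
           (distr N borel (\<lambda>\<omega>. Z \<omega> \<bullet> (Q *v Z \<omega>)))"
proof -
  interpret prob_space M by fact
  define \<zeta> where "\<zeta> t \<omega> = sqrt (real (n t) * real (p t)) *\<^sub>R (\<theta> t \<omega> - \<theta>0)" for t \<omega>
  define H :: "nat \<Rightarrow> 'a \<Rightarrow> real^'k^'k" where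
    "H t \<omega> = (\<chi> k1 k2. 1 / real (p t) * (\<Sum>j<p t. \<Sum>l<p t. G t \<omega> k1 j l * G t \<omega> k2 j l))" for t \<omega>
  define U where "U t \<omega> = real (n t) * (\<Sum>j<p t. \<Sum>l<p t. (D t \<omega> j l)\<^sup>2)" for t \<omega>
  define P where "P t V \<longleftrightarrow> integrable M V \<and> (\<forall>\<omega>. 0 \<le> V \<omega>) \<and> integral\<^sup>L M V \<le> \<kappa> * real (p t) \<and>
       (AE \<omega> in M. norm (\<theta> t \<omega> - \<theta>0) < r \<longrightarrow>
          (\<Sum>j<p t. \<Sum>l<p t. (D t \<omega> j l - (\<Sum>k\<in>UNIV. vec_nth (\<theta> t \<omega> - \<theta>0) k * G t \<omega> k j l))\<^sup>2)
            \<le> norm (\<theta> t \<omega> - \<theta>0) ^ 4 * V \<omega>)" for t V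
  define V where "V t = (SOME V. P t V)" for t
  have PV: "\<forall>\<^sub>F t in sequentially. P t (V t)"
    using rem unfolding P_def[symmetric]
  proof eventually_elim
    case (elim t)
    then show "P t (V t)" unfolding V_def by (rule someI_ex[of "P t"])
  qed
  define W where "W t \<omega> = V t \<omega> / (real (n t) * (real (p t))\<^sup>2)" for t \<omega>
  have pos: "0 < real (n t)" "0 < real (p t)" for t using np[of t] by auto
  have \<zeta>m: "\<zeta> t \<in> borel_measurable M" for t unfolding \<zeta>_def using \<theta>[of t] by measurable
  have conv: "conv_in_dist M \<zeta> N Z" using lim unfolding \<zeta>_def .
  have Hm: "\<forall>\<^sub>F t in sequentially. H t \<in> borel_measurable M"
    using G
  proof eventually_elim
    case (elim t)
    then show ?case unfolding H_def
      by (intro borel_measurable_matrix_lambda borel_measurable_times borel_measurable_sum borel_measurable_const) auto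
  qed
  have Um: "\<forall>\<^sub>F t in sequentially. U t \<in> borel_measurable M"
    using D unfolding U_def
    by eventually_elim (intro borel_measurable_times borel_measurable_sum borel_measurable_const borel_measurable_power, auto)
  have Wm: "\<forall>\<^sub>F t in sequentially. W t \<in> borel_measurable M"
    using PV unfolding P_def W_def
    by eventually_elim (auto intro: borel_measurable_divide borel_measurable_integrable)
  have W0: "conv_in_prob M W 0" unfolding conv_in_prob_def
  proof (intro allI impI)
    fix e :: real assume e: "0 < e"
    have "(\<lambda>t. \<bar>\<kappa>\<bar> / e * (1 / real (p t))) \<longlonglongrightarrow> \<bar>\<kappa>\<bar> / e * 0"
      using p_lim by (intro tendsto_mult tendsto_const filterlim_compose[OF lim_1_over_n])
    then have lim0: "(\<lambda>t. \<bar>\<kappa>\<bar> / e * (1 / real (p t))) \<longlonglongrightarrow> 0" by simp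
    show "(\<lambda>t. measure M {\<omega>\<in>space M. dist (W t \<omega>) 0 > e}) \<longlonglongrightarrow> 0"
    proof (rule tendsto_sandwich[OF _ _ tendsto_const lim0])
      show "\<forall>\<^sub>F t in sequentially. measure M {\<omega>\<in>space M. dist (W t \<omega>) 0 > e} \<le> \<bar>\<kappa>\<bar> / e * (1 / real (p t))"
        using PV Wm
      proof eventually_elim
        case (elim t)
        have V: "integrable M (V t)" "\<And>\<omega>. 0 \<le> V t \<omega>" "integral\<^sup>L M (V t) \<le> \<kappa> * real (p t)"
          using elim(1) unfolding P_def by auto
        note elim(2)[measurable]
        have Wn: "0 \<le> W t \<omega>" for \<omega> unfolding W_def using V(2) by simp
        have Wi: "integrable M (W t)" unfolding W_def using V(1) by auto
        have "measure M {\<omega>\<in>space M. dist (W t \<omega>) 0 > e} \<le> measure M {\<omega>\<in>space M. W t \<omega> \<ge> e}"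
          using Wn by (intro finite_measure_mono) auto
        also have "\<dots> \<le> integral\<^sup>L M (W t) / e"
          using Wi Wn e by (intro integral_Markov_inequality_measure[where A = "{}"]) auto
        also have "integral\<^sup>L M (W t) = integral\<^sup>L M (V t) / (real (n t) * (real (p t))\<^sup>2)"
          unfolding W_def by simp
        also have "\<dots> \<le> (\<bar>\<kappa>\<bar> * real (p t)) / (real (n t) * (real (p t))\<^sup>2)"
          using V(3) pos[of t] by (intro divide_right_mono) (auto intro: order_trans mult_right_mono)
        also have "\<dots> \<le> (\<bar>\<kappa>\<bar> * real (p t)) / (1 * (real (p t))\<^sup>2)"
          using pos[of t] np[of t] by (intro divide_left_mono mult_right_mono mult_pos_pos) auto
        also have "\<dots> = \<bar>\<kappa>\<bar> / real (p t)"
          using pos[of t] by (simp add: power2_eq_square)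
        finally show ?case using e by (simp add: divide_right_mono field_simps)
      qed
    qed simp
  qed
  \<comment> \<open>A bounded \<open>\<zeta>\<close> forces \<open>\<theta> - \<theta>0\<close> below \<open>r\<close> once \<open>n p\<close> is large, so the expansion applies.\<close>
  have close: "\<forall>\<^sub>F t in sequentially. AE \<omega> in M. norm (\<zeta> t \<omega>) \<le> m \<longrightarrow>
        0 \<le> U t \<omega> \<and> 0 \<le> \<zeta> t \<omega> \<bullet> (H t \<omega> *v \<zeta> t \<omega>) \<and>
        \<bar>sqrt (U t \<omega>) - sqrt (\<zeta> t \<omega> \<bullet> (H t \<omega> *v \<zeta> t \<omega>))\<bar> \<le> (norm (\<zeta> t \<omega>))\<^sup>2 * sqrt (W t \<omega>)" for m
  proof -
    have "filterlim (\<lambda>t. real (p t)) at_top sequentially"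
      using p_lim by (rule filterlim_compose[OF filterlim_real_sequentially])
    then have "\<forall>\<^sub>F t in sequentially. (m / r)\<^sup>2 < real (p t)"
      by (simp add: filterlim_at_top_dense)
    with PV show ?thesis
    proof eventually_elim
      case (elim t)
      define s where "s = sqrt (real (n t) * real (p t))"
      have s0: "s > 0" "s\<^sup>2 = real (n t) * real (p t)" using pos[of t] by (auto simp: s_def)
      have "(m / r)\<^sup>2 < 1 * real (p t)" using elim(2) by simp
      also have "\<dots> \<le> s\<^sup>2" unfolding s0(2) using np[of t] by (intro mult_right_mono) auto
      finally have "m / r < s" using s0(1) by (simp add: power2_less_imp_less)
      then have mr: "m < s * r" using r by (simp add: field_simps)
      have "AE \<omega> in M. norm (\<theta> t \<omega> - \<theta>0) < r \<longrightarrow>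
          (\<Sum>j<p t. \<Sum>l<p t. (D t \<omega> j l - (\<Sum>k\<in>UNIV. vec_nth (\<theta> t \<omega> - \<theta>0) k * G t \<omega> k j l))\<^sup>2)
            \<le> norm (\<theta> t \<omega> - \<theta>0) ^ 4 * V t \<omega>"
        using elim(1) unfolding P_def by blast
      then show ?case
      proof eventually_elim
        case (elim \<omega>)
        define h where "h = \<theta> t \<omega> - \<theta>0"
        define I where "I = {..<p t} \<times> {..<p t}"
        define d where "d = (\<lambda>(j, l). D t \<omega> j l)"
        define g where "g = (\<lambda>k (j, l). G t \<omega> k j l)"
        define a where "a x = (\<Sum>k\<in>UNIV. vec_nth h k * g k x)" for x
        have zh: "\<zeta> t \<omega> = s *\<^sub>R h" by (simp add: \<zeta>_def h_def s_def)
        have U2: "U t \<omega> = real (n t) * (L2_set d I)\<^sup>2"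
          unfolding U_def d_def I_def L2_set_def
          by (simp add: sum.cartesian_product split_def sum_nonneg)
        have Hk: "vec_nth (vec_nth (H t \<omega>) k1) k2 = 1 / real (p t) * (\<Sum>x\<in>I. g k1 x * g k2 x)" for k1 k2
          unfolding H_def g_def I_def by (simp add: sum.cartesian_product split_def)
        have "\<zeta> t \<omega> \<bullet> (H t \<omega> *v \<zeta> t \<omega>)
            = (\<Sum>k1\<in>UNIV. \<Sum>k2\<in>UNIV. s * vec_nth h k1 * vec_nth (vec_nth (H t \<omega>) k1) k2 * (s * vec_nth h k2))"
          unfolding zh inner_vec_def matrix_vector_mult_def
          by (simp add: sum_distrib_left mult.assoc)
        also have "\<dots> = (\<Sum>k1\<in>UNIV. \<Sum>k2\<in>UNIV. \<Sum>x\<in>I. s\<^sup>2 / real (p t) * ((vec_nth h k1 * g k1 x) * (vec_nth h k2 * g k2 x)))"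
          unfolding Hk by (simp add: sum_distrib_left sum_distrib_right power2_eq_square mult_ac)
        also have "\<dots> = (\<Sum>x\<in>I. \<Sum>k1\<in>UNIV. \<Sum>k2\<in>UNIV. s\<^sup>2 / real (p t) * ((vec_nth h k1 * g k1 x) * (vec_nth h k2 * g k2 x)))"
          by (simp only: sum.swap[of _ I])
        also have "\<dots> = (\<Sum>x\<in>I. s\<^sup>2 / real (p t) * (a x)\<^sup>2)"
          unfolding a_def power2_eq_square[of "sum _ _"] sum_product by (simp add: sum_distrib_left)
        also have "\<dots> = real (n t) * (\<Sum>x\<in>I. (a x)\<^sup>2)"
          using pos[of t] by (simp add: s0(2) sum_distrib_left)
        finally have H2: "\<zeta> t \<omega> \<bullet> (H t \<omega> *v \<zeta> t \<omega>) = real (n t) * (L2_set a I)\<^sup>2"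
          by (simp add: L2_set_def sum_nonneg)
        show ?case
        proof (intro impI conjI)
          assume nz: "norm (\<zeta> t \<omega>) \<le> m"
          show "0 \<le> U t \<omega>" unfolding U2 by simp
          show "0 \<le> \<zeta> t \<omega> \<bullet> (H t \<omega> *v \<zeta> t \<omega>)" unfolding H2 by simp
          have "s * norm h \<le> m" using nz s0(1) by (simp add: zh)
          with mr have "s * norm h < s * r" by linarith
          with s0(1) have "norm h < r" by simp
          with elim have "(\<Sum>j<p t. \<Sum>l<p t. (D t \<omega> j l - (\<Sum>k\<in>UNIV. vec_nth h k * G t \<omega> k j l))\<^sup>2) \<le> norm h ^ 4 * V t \<omega>"
            unfolding h_def by blast
          then have "(\<Sum>x\<in>I. (d x - a x)\<^sup>2) \<le> norm h ^ 4 * V t \<omega>"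
            unfolding I_def d_def a_def g_def by (simp add: sum.cartesian_product split_def)
          then have "L2_set (\<lambda>x. d x - a x) I \<le> sqrt (norm h ^ 4 * V t \<omega>)"
            unfolding L2_set_def by simp
          moreover have "\<bar>L2_set d I - L2_set a I\<bar> \<le> L2_set (\<lambda>x. d x - a x) I"
          proof -
            have "L2_set d I \<le> L2_set a I + L2_set (\<lambda>x. d x - a x) I"
              using L2_set_triangle_ineq[of a "\<lambda>x. d x - a x" I] by simp
            moreover have "L2_set a I \<le> L2_set d I + L2_set (\<lambda>x. a x - d x) I"
              using L2_set_triangle_ineq[of d "\<lambda>x. a x - d x" I] by simp
            moreover have "L2_set (\<lambda>x. a x - d x) I = L2_set (\<lambda>x. d x - a x) I"
              unfolding L2_set_def by (simp add: power2_commute)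
            ultimately show ?thesis by linarith
          qed
          ultimately have "sqrt (real (n t)) * \<bar>L2_set d I - L2_set a I\<bar> \<le> sqrt (real (n t)) * sqrt (norm h ^ 4 * V t \<omega>)"
            by (intro mult_left_mono) auto
          also have "\<dots> = (norm (\<zeta> t \<omega>))\<^sup>2 * sqrt (W t \<omega>)"
          proof -
            have "real (n t) * (norm h ^ 4 * V t \<omega>) = ((norm (\<zeta> t \<omega>))\<^sup>2)\<^sup>2 * W t \<omega>"
              using pos[of t] s0 unfolding zh W_def
              by (simp add: power_mult_distrib power2_eq_square power4_eq_xxxx field_simps)
            then have "sqrt (real (n t) * (norm h ^ 4 * V t \<omega>)) = sqrt (((norm (\<zeta> t \<omega>))\<^sup>2)\<^sup>2 * W t \<omega>)"
              by (rule arg_cong)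
            also have "\<dots> = (norm (\<zeta> t \<omega>))\<^sup>2 * sqrt (W t \<omega>)"
              by (simp only: real_sqrt_mult real_sqrt_abs abs_power2)
            finally have "sqrt (real (n t) * (norm h ^ 4 * V t \<omega>)) = (norm (\<zeta> t \<omega>))\<^sup>2 * sqrt (W t \<omega>)" .
            then show ?thesis by (simp add: real_sqrt_mult)
          qed
          finally show "\<bar>sqrt (U t \<omega>) - sqrt (\<zeta> t \<omega> \<bullet> (H t \<omega> *v \<zeta> t \<omega>))\<bar> \<le> (norm (\<zeta> t \<omega>))\<^sup>2 * sqrt (W t \<omega>)"
            unfolding U2 H2 by (simp add: real_sqrt_mult abs_mult flip: right_diff_distrib)
        qed
      qed
    qed
  qed
  have tight: "\<exists>m. \<forall>\<^sub>F t in sequentially. measure M {\<omega>\<in>space M. norm (\<zeta> t \<omega>) > m} < e" if "0 < e" for e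
    using conv_in_dist_tight[OF assms(1,2) Z \<zeta>m conv that] by blast
  have cont: "continuous_on UNIV (\<lambda>z::real^'k. z \<bullet> (Q *v z))"
    by (intro continuous_intros linear_continuous_on matrix_vector_mul_bounded_linear)
  have "(\<lambda>t. measure M {\<omega>\<in>space M. \<bar>U t \<omega> - \<zeta> t \<omega> \<bullet> (Q *v \<zeta> t \<omega>)\<bar> > e}) \<longlonglongrightarrow> 0" if "0 < e" for e
    using Q[folded H_def] that
    by (intro quadratic_form_close_in_prob[OF assms(1) \<zeta>m tight Hm _ Wm W0 Um close])
  from weak_conv_m_if_close_in_prob[OF assms(1,2) Z \<zeta>m conv cont Um this]
  show ?thesis unfolding U_def .
qed

section \<open>Expansion of a smooth random matrix\<close>

text \<open>A single stage of the triangular array and a single observation, with the explanatory variable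
  composed into the random matrix \<open>dC []\<close>. The constants \<open>c0\<close>, \<open>c1\<close>, \<open>c2\<close> will be the same at
  all stages, which makes the remainder bounds uniform. The conditions on the \<open>q\<close>s ensure that \<open>A \<partial>C A \<partial>C A\<close> and
  \<open>A \<partial>\<^sup>2C A\<close>, with \<open>A\<close> the inverse matrix, are square integrable.\<close>

locale smooth_random_matrix = prob_space M for M :: "'a measure" +
  fixes p :: nat and dC :: "'k::finite list \<Rightarrow> real^'k \<Rightarrow> 'a \<Rightarrow> real mat"
    and B :: "(real^'k) set" and \<beta>0 :: "real^'k" and r :: real
    and q0 q1 q2 c0 c1 c2 :: real
  assumes B: "closed B" "ball \<beta>0 r \<subseteq> B" "0 < r"
    and pd: "\<And>\<beta> \<omega>. \<beta> \<in> B \<Longrightarrow> \<omega> \<in> space M \<Longrightarrow> pos_def p (dC [] \<beta> \<omega>)"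
    and der: "AE \<omega> in M. \<forall>ks. length ks \<le> 2 \<longrightarrow> (\<forall>\<beta>\<in>B. \<forall>j<p. \<forall>l<p.
          ((\<lambda>\<beta>'. dC ks \<beta>' \<omega> $$ (j, l)) has_derivative
             (\<lambda>h. \<Sum>k\<in>UNIV. vec_nth h k * dC (k # ks) \<beta> \<omega> $$ (j, l))) (at \<beta> within B))"
    and meas: "\<And>ks \<beta>. length ks \<le> 2 \<Longrightarrow> \<beta> \<in> B \<Longrightarrow> measurable_mat M p (dC ks \<beta>)"
    and q: "0 < q0" "0 < q1" "0 < q2" "3 / q0 + 2 / q1 \<le> 1 / 2" "2 / q0 + 1 / q2 \<le> 1 / 2"
    and c: "0 \<le> c0" "0 \<le> c1" "0 \<le> c2"
    and n0: "mixed_norm M p q0 1 (sup_abs_entry B (\<lambda>\<beta> \<omega>. inv_mat (dC [] \<beta> \<omega>))) \<le> ennreal c0"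
    and n1: "\<And>k. mixed_norm M p q1 1 (sup_abs_entry B (dC [k])) \<le> ennreal c1"
    and n2: "\<And>k k'. mixed_norm M p q2 1 (sup_abs_entry B (dC [k, k'])) \<le> ennreal c2"

begin

lemma carrier: "\<beta> \<in> B \<Longrightarrow> \<omega> \<in> space M \<Longrightarrow> length ks \<le> 2 \<Longrightarrow> dC ks \<beta> \<omega> \<in> carrier_mat p p"
  using meas unfolding measurable_mat_def by blast

lemma base_in: "\<beta>0 \<in> B" using B by auto

lemma AE_continuous:
  "AE \<omega> in M. \<forall>ks. length ks \<le> 2 \<longrightarrow> (\<forall>j<p. \<forall>l<p. continuous_on B (\<lambda>\<beta>. dC ks \<beta> \<omega> $$ (j, l)))"
  using der
proof eventually_elim
  case (elim \<omega>)
  show ?case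
  proof (intro allI impI)
    fix ks :: "'k list" and j l assume "length ks \<le> 2" "j < p" "l < p"
    with elim show "continuous_on B (\<lambda>\<beta>. dC ks \<beta> \<omega> $$ (j, l))"
      by (intro has_derivative_continuous_on) blast
  qed
qed

lemma dominating_inverse:
  obtains F where "mixed_dominated M p (1 / q0) c0 F"
    "AE \<omega> in M. \<forall>\<beta>\<in>B. \<forall>j<p. \<forall>l<p. \<bar>inv_mat (dC [] \<beta> \<omega>) $$ (j, l)\<bar> \<le> F j l \<omega>"
proof (rule mixed_norm_finite_imp_mixed_dominated[OF _ _ B(1) q(1) n0 c(1)])
  show "(\<lambda>\<omega>. inv_mat (dC [] \<beta> \<omega>) $$ (j, l)) \<in> borel_measurable M" if "\<beta> \<in> B" "j < p" "l < p" for \<beta> j l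
    using measurable_mat_inv_mat[OF meas[of "[]" \<beta>]] that unfolding measurable_mat_def by simp
  show "AE \<omega> in M. \<forall>j<p. \<forall>l<p. continuous_on B (\<lambda>\<beta>. inv_mat (dC [] \<beta> \<omega>) $$ (j, l))"
    using AE_continuous AE_space
  proof eventually_elim
    case (elim \<omega>)
    show ?case
    proof (intro allI impI)
      fix j l assume jl: "j < p" "l < p"
      show "continuous_on B (\<lambda>\<beta>. inv_mat (dC [] \<beta> \<omega>) $$ (j, l))"
        using elim(2) by (intro continuous_on_inv_mat[OF carrier _ _ jl] elim(1)[rule_format] pos_def_det_nonzero[OF pd]) auto
    qed
  qed
qed (use that in auto)

lemma dominating_derivative:
  assumes "length ks \<le> 2" "0 < q" "0 \<le> c" "mixed_norm M p q 1 (sup_abs_entry B (dC ks)) \<le> ennreal c"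
  obtains F where "mixed_dominated M p (1 / q) c F"
    "AE \<omega> in M. \<forall>\<beta>\<in>B. \<forall>j<p. \<forall>l<p. \<bar>dC ks \<beta> \<omega> $$ (j, l)\<bar> \<le> F j l \<omega>"
proof (rule mixed_norm_finite_imp_mixed_dominated[OF _ _ B(1) assms(2,4,3)])
  show "(\<lambda>\<omega>. dC ks \<beta> \<omega> $$ (j, l)) \<in> borel_measurable M" if "\<beta> \<in> B" "j < p" "l < p" for \<beta> j l
    using meas[OF assms(1)] that unfolding measurable_mat_def by simp
  show "AE \<omega> in M. \<forall>j<p. \<forall>l<p. continuous_on B (\<lambda>\<beta>. dC ks \<beta> \<omega> $$ (j, l))"
    using AE_continuous by eventually_elim (use assms(1) in auto)
qed (use that in auto)

text \<open>The entries of \<open>G\<close> and \<open>H\<close> dominate the sums over the parameter directions of the first and second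
  derivatives, uniformly in the parameter. The exceptional null set does not depend on \<open>\<beta>\<close>, so that a random
  parameter may be inserted later.\<close>

lemma increment_bounds:
  obtains G H where "mixed_dominated M p (1 / q1) (real CARD('k) * c1) G"
    "mixed_dominated M p (1 / q2) ((real CARD('k))\<^sup>2 * c2) H"
    "AE \<omega> in M. \<forall>\<beta>\<in>ball \<beta>0 r. \<forall>j<p. \<forall>l<p.
       \<bar>dC [] \<beta> \<omega> $$ (j, l) - dC [] \<beta>0 \<omega> $$ (j, l)\<bar> \<le> norm (\<beta> - \<beta>0) * G j l \<omega> \<and>
       \<bar>dC [] \<beta> \<omega> $$ (j, l) - dC [] \<beta>0 \<omega> $$ (j, l) - (\<Sum>k\<in>UNIV. vec_nth (\<beta> - \<beta>0) k * dC [k] \<beta>0 \<omega> $$ (j, l))\<bar>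
         \<le> (norm (\<beta> - \<beta>0))\<^sup>2 * H j l \<omega>"
proof -
  have "\<exists>F. mixed_dominated M p (1 / q1) c1 F \<and>
    (AE \<omega> in M. \<forall>\<beta>\<in>B. \<forall>j<p. \<forall>l<p. \<bar>dC [k] \<beta> \<omega> $$ (j, l)\<bar> \<le> F j l \<omega>)" for k
    by (rule dominating_derivative[of "[k]", OF _ q(2) c(2) n1]) auto
  from choice[OF allI[OF this]] obtain F1 where F1': "\<forall>k. mixed_dominated M p (1 / q1) c1 (F1 k) \<and>
    (AE \<omega> in M. \<forall>\<beta>\<in>B. \<forall>j<p. \<forall>l<p. \<bar>dC [k] \<beta> \<omega> $$ (j, l)\<bar> \<le> F1 k j l \<omega>)" ..
  note F1 = F1'[THEN spec, THEN conjunct1] F1'[THEN spec, THEN conjunct2]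
  have "\<exists>F. mixed_dominated M p (1 / q2) c2 F \<and>
    (AE \<omega> in M. \<forall>\<beta>\<in>B. \<forall>j<p. \<forall>l<p. \<bar>dC [k', k] \<beta> \<omega> $$ (j, l)\<bar> \<le> F j l \<omega>)" for k' k
    by (rule dominating_derivative[of "[k', k]", OF _ q(3) c(3) n2]) auto
  from choice[OF allI[OF choice[OF allI[OF this]]]] obtain F2 where F2': "\<forall>k'. \<forall>k. mixed_dominated M p (1 / q2) c2 (F2 k' k) \<and>
    (AE \<omega> in M. \<forall>\<beta>\<in>B. \<forall>j<p. \<forall>l<p. \<bar>dC [k', k] \<beta> \<omega> $$ (j, l)\<bar> \<le> F2 k' k j l \<omega>)" ..
  note F2 = F2'[THEN spec, THEN spec, THEN conjunct1] F2'[THEN spec, THEN spec, THEN conjunct2]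
  define G where "G j l \<omega> = (\<Sum>k\<in>UNIV. F1 k j l \<omega>)" for j l \<omega>
  define H where "H j l \<omega> = (\<Sum>k\<in>UNIV. \<Sum>k'\<in>UNIV. F2 k' k j l \<omega>)" for j l \<omega>
  have "1 / q1 > 0" "1 / q2 > 0" "1 / q0 > 0" using q by auto
  moreover have "3 / q0 = 3 * (1 / q0)" "2 / q1 = 2 * (1 / q1)" "2 / q0 = 2 * (1 / q0)" by simp_all
  ultimately have w: "0 \<le> 1 / q1" "1 / q1 \<le> 1" "0 \<le> 1 / q2" "1 / q2 \<le> 1" using q(4,5) by linarith+
  have "mixed_dominated M p (1 / q1) (\<Sum>k\<in>(UNIV::'k set). c1) G"
    unfolding G_def by (intro mixed_dominated_sum F1 w) auto
  then have domG: "mixed_dominated M p (1 / q1) (real CARD('k) * c1) G" by simp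
  have "mixed_dominated M p (1 / q2) (\<Sum>k\<in>(UNIV::'k set). \<Sum>k'\<in>(UNIV::'k set). c2) H"
    unfolding H_def by (intro mixed_dominated_sum F2 w) auto
  then have domH: "mixed_dominated M p (1 / q2) ((real CARD('k))\<^sup>2 * c2) H"
    by (simp add: power2_eq_square mult.assoc)
  have "AE \<omega> in M. \<forall>k. \<forall>\<beta>\<in>B. \<forall>j<p. \<forall>l<p. \<bar>dC [k] \<beta> \<omega> $$ (j, l)\<bar> \<le> F1 k j l \<omega>"
    by (intro AE_all_countable[THEN iffD2] allI F1(2))
  moreover have "AE \<omega> in M. \<forall>k'. \<forall>k. \<forall>\<beta>\<in>B. \<forall>j<p. \<forall>l<p. \<bar>dC [k', k] \<beta> \<omega> $$ (j, l)\<bar> \<le> F2 k' k j l \<omega>"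
    by (intro AE_all_countable[THEN iffD2] allI F2(2))
  ultimately have "AE \<omega> in M. \<forall>\<beta>\<in>ball \<beta>0 r. \<forall>j<p. \<forall>l<p.
       \<bar>dC [] \<beta> \<omega> $$ (j, l) - dC [] \<beta>0 \<omega> $$ (j, l)\<bar> \<le> norm (\<beta> - \<beta>0) * G j l \<omega> \<and>
       \<bar>dC [] \<beta> \<omega> $$ (j, l) - dC [] \<beta>0 \<omega> $$ (j, l) - (\<Sum>k\<in>UNIV. vec_nth (\<beta> - \<beta>0) k * dC [k] \<beta>0 \<omega> $$ (j, l))\<bar>
         \<le> (norm (\<beta> - \<beta>0))\<^sup>2 * H j l \<omega>"
    using der
  proof eventually_elim
    case (elim \<omega>)
    show ?case
    proof (intro ballI allI impI)
      fix \<beta> j l assume \<beta>: "\<beta> \<in> ball \<beta>0 r" and jl: "j < p" "l < p"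
      have d: "((\<lambda>\<beta>'. dC ks \<beta>' \<omega> $$ (j, l)) has_derivative
             (\<lambda>h. \<Sum>k\<in>UNIV. vec_nth h k * dC (k # ks) y \<omega> $$ (j, l))) (at y within ball \<beta>0 r)"
        if "length ks \<le> 2" "y \<in> ball \<beta>0 r" for ks y
        using elim(3) that jl B(2) by (blast intro: has_derivative_subset)
      have b0: "\<beta>0 \<in> ball \<beta>0 r" using B(3) by simp
      have "\<bar>dC [] \<beta> \<omega> $$ (j, l) - dC [] \<beta>0 \<omega> $$ (j, l)\<bar> \<le> norm (\<beta> - \<beta>0) * G j l \<omega>"
        unfolding G_def
        by (rule gradient_bound[OF convex_ball d _ \<beta> b0]) (use elim(1) jl B(2) in auto)
      moreover have "\<bar>dC [] \<beta> \<omega> $$ (j, l) - dC [] \<beta>0 \<omega> $$ (j, l) - (\<Sum>k\<in>UNIV. vec_nth (\<beta> - \<beta>0) k * dC [k] \<beta>0 \<omega> $$ (j, l))\<bar>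
         \<le> (norm (\<beta> - \<beta>0))\<^sup>2 * H j l \<omega>"
        unfolding H_def
      proof (rule second_order_taylor_bound[where g = "\<lambda>k y. dC [k] y \<omega> $$ (j, l)" and
              h = "\<lambda>k' k y. dC [k', k] y \<omega> $$ (j, l)", OF convex_ball _ _ _ \<beta> b0])
        fix k y assume y: "y \<in> ball \<beta>0 r"
        show "((\<lambda>\<beta>'. dC [] \<beta>' \<omega> $$ (j, l)) has_derivative
             (\<lambda>h. \<Sum>k\<in>UNIV. vec_nth h k * dC [k] y \<omega> $$ (j, l))) (at y within ball \<beta>0 r)"
          using d[of "[]"] y by simp
        show "((\<lambda>\<beta>'. dC [k] \<beta>' \<omega> $$ (j, l)) has_derivative
             (\<lambda>h. \<Sum>k'\<in>UNIV. vec_nth h k' * dC [k', k] y \<omega> $$ (j, l))) (at y within ball \<beta>0 r)"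
          using d[of "[k]"] y by simp
      qed (use elim(2) jl B(2) in auto)
      ultimately show "\<bar>dC [] \<beta> \<omega> $$ (j, l) - dC [] \<beta>0 \<omega> $$ (j, l)\<bar> \<le> norm (\<beta> - \<beta>0) * G j l \<omega> \<and>
       \<bar>dC [] \<beta> \<omega> $$ (j, l) - dC [] \<beta>0 \<omega> $$ (j, l) - (\<Sum>k\<in>UNIV. vec_nth (\<beta> - \<beta>0) k * dC [k] \<beta>0 \<omega> $$ (j, l))\<bar>
         \<le> (norm (\<beta> - \<beta>0))\<^sup>2 * H j l \<omega>" ..
    qed
  qed
  with domG domH that show thesis by blast
qed

lemma square_sum_remainder:
  assumes "mixed_dominated M p (1 / 2) \<kappa> F"
    and "AE \<omega> in M. \<forall>\<beta>\<in>ball \<beta>0 r. \<forall>j<p. \<forall>l<p. \<bar>R \<beta> \<omega> j l\<bar> \<le> (norm (\<beta> - \<beta>0))\<^sup>2 * F j l \<omega>"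
  shows "\<exists>V. integrable M V \<and> (\<forall>\<omega>. 0 \<le> V \<omega>) \<and> integral\<^sup>L M V \<le> 2 * \<kappa>\<^sup>2 * real p \<and>
     (AE \<omega> in M. \<forall>\<beta>\<in>ball \<beta>0 r. (\<Sum>j<p. \<Sum>l<p. (R \<beta> \<omega> j l)\<^sup>2) \<le> norm (\<beta> - \<beta>0) ^ 4 * V \<omega>)"
proof -
  obtain V where V: "integrable M V" "\<And>\<omega>. 0 \<le> V \<omega>" "integral\<^sup>L M V \<le> 2 * \<kappa>\<^sup>2 * real p"
    "AE \<omega> in M. (\<Sum>j<p. \<Sum>l<p. (F j l \<omega>)\<^sup>2) \<le> V \<omega>"
    using mixed_dominated_square_sum[OF assms(1)] by auto
  have "AE \<omega> in M. \<forall>\<beta>\<in>ball \<beta>0 r. (\<Sum>j<p. \<Sum>l<p. (R \<beta> \<omega> j l)\<^sup>2) \<le> norm (\<beta> - \<beta>0) ^ 4 * V \<omega>"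
    using assms(2) V(4)
  proof eventually_elim
    case (elim \<omega>)
    show ?case
    proof
      fix \<beta> assume \<beta>: "\<beta> \<in> ball \<beta>0 r"
      have "(\<Sum>j<p. \<Sum>l<p. (R \<beta> \<omega> j l)\<^sup>2) \<le> (\<Sum>j<p. \<Sum>l<p. norm (\<beta> - \<beta>0) ^ 4 * (F j l \<omega>)\<^sup>2)"
      proof (intro sum_mono)
        fix j l assume jl: "j \<in> {..<p}" "l \<in> {..<p}"
        have "(R \<beta> \<omega> j l)\<^sup>2 = \<bar>R \<beta> \<omega> j l\<bar>\<^sup>2" by simp
        also have "\<dots> \<le> ((norm (\<beta> - \<beta>0))\<^sup>2 * F j l \<omega>)\<^sup>2"
          using elim(1) \<beta> jl by (intro power_mono) auto
        also have "\<dots> = norm (\<beta> - \<beta>0) ^ 4 * (F j l \<omega>)\<^sup>2"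
          by (simp add: power_mult_distrib)
        finally show "(R \<beta> \<omega> j l)\<^sup>2 \<le> norm (\<beta> - \<beta>0) ^ 4 * (F j l \<omega>)\<^sup>2" .
      qed
      also have "\<dots> = norm (\<beta> - \<beta>0) ^ 4 * (\<Sum>j<p. \<Sum>l<p. (F j l \<omega>)\<^sup>2)"
        by (simp add: sum_distrib_left)
      also have "\<dots> \<le> norm (\<beta> - \<beta>0) ^ 4 * V \<omega>" using elim(2) by (intro mult_left_mono) auto
      finally show "(\<Sum>j<p. \<Sum>l<p. (R \<beta> \<omega> j l)\<^sup>2) \<le> norm (\<beta> - \<beta>0) ^ 4 * V \<omega>" .
    qed
  qed
  with V show ?thesis by blast
qed

lemma matrix_remainder:
  "\<exists>V. integrable M V \<and> (\<forall>\<omega>. 0 \<le> V \<omega>) \<and> integral\<^sup>L M V \<le> 2 * ((real CARD('k))\<^sup>2 * c2)\<^sup>2 * real p \<and>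
     (AE \<omega> in M. \<forall>\<beta>\<in>ball \<beta>0 r. (\<Sum>j<p. \<Sum>l<p. (dC [] \<beta> \<omega> $$ (j, l) - dC [] \<beta>0 \<omega> $$ (j, l)
        - (\<Sum>k\<in>UNIV. vec_nth (\<beta> - \<beta>0) k * dC [k] \<beta>0 \<omega> $$ (j, l)))\<^sup>2) \<le> norm (\<beta> - \<beta>0) ^ 4 * V \<omega>)"
proof -
  obtain G H where GH: "mixed_dominated M p (1 / q1) (real CARD('k) * c1) G"
    "mixed_dominated M p (1 / q2) ((real CARD('k))\<^sup>2 * c2) H"
    "AE \<omega> in M. \<forall>\<beta>\<in>ball \<beta>0 r. \<forall>j<p. \<forall>l<p.
       \<bar>dC [] \<beta> \<omega> $$ (j, l) - dC [] \<beta>0 \<omega> $$ (j, l)\<bar> \<le> norm (\<beta> - \<beta>0) * G j l \<omega> \<and>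
       \<bar>dC [] \<beta> \<omega> $$ (j, l) - dC [] \<beta>0 \<omega> $$ (j, l) - (\<Sum>k\<in>UNIV. vec_nth (\<beta> - \<beta>0) k * dC [k] \<beta>0 \<omega> $$ (j, l))\<bar>
         \<le> (norm (\<beta> - \<beta>0))\<^sup>2 * H j l \<omega>"
    by (rule increment_bounds)
  have "0 < 2 / q0" using q by simp
  then have "1 / q2 \<le> 1 / 2" using q(5) by linarith
  with GH(2) have "mixed_dominated M p (1 / 2) ((real CARD('k))\<^sup>2 * c2) H"
    by (rule mixed_dominated_weaken) simp
  then show ?thesis
    by (rule square_sum_remainder) (use GH(3) in eventually_elim, blast)
qed

lemma inverse_remainder:
  "\<exists>V. integrable M V \<and> (\<forall>\<omega>. 0 \<le> V \<omega>) \<and> integral\<^sup>L M V \<le>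
       2 * (c0 * (real CARD('k) * c1 * (c0 * (real CARD('k) * c1 * c0))) + c0 * ((real CARD('k))\<^sup>2 * c2 * c0))\<^sup>2 * real p \<and>
     (AE \<omega> in M. \<forall>\<beta>\<in>ball \<beta>0 r. (\<Sum>j<p. \<Sum>l<p. (inv_mat (dC [] \<beta> \<omega>) $$ (j, l) - inv_mat (dC [] \<beta>0 \<omega>) $$ (j, l)
        - (\<Sum>k\<in>UNIV. vec_nth (\<beta> - \<beta>0) k *
             - (inv_mat (dC [] \<beta>0 \<omega>) * (dC [k] \<beta>0 \<omega> * inv_mat (dC [] \<beta>0 \<omega>))) $$ (j, l)))\<^sup>2) \<le> norm (\<beta> - \<beta>0) ^ 4 * V \<omega>)"
proof -
  obtain G H where GH: "mixed_dominated M p (1 / q1) (real CARD('k) * c1) G"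
    "mixed_dominated M p (1 / q2) ((real CARD('k))\<^sup>2 * c2) H"
    "AE \<omega> in M. \<forall>\<beta>\<in>ball \<beta>0 r. \<forall>j<p. \<forall>l<p.
       \<bar>dC [] \<beta> \<omega> $$ (j, l) - dC [] \<beta>0 \<omega> $$ (j, l)\<bar> \<le> norm (\<beta> - \<beta>0) * G j l \<omega> \<and>
       \<bar>dC [] \<beta> \<omega> $$ (j, l) - dC [] \<beta>0 \<omega> $$ (j, l) - (\<Sum>k\<in>UNIV. vec_nth (\<beta> - \<beta>0) k * dC [k] \<beta>0 \<omega> $$ (j, l))\<bar>
         \<le> (norm (\<beta> - \<beta>0))\<^sup>2 * H j l \<omega>"
    by (rule increment_bounds)
  obtain F where F: "mixed_dominated M p (1 / q0) c0 F"
    "AE \<omega> in M. \<forall>\<beta>\<in>B. \<forall>j<p. \<forall>l<p. \<bar>inv_mat (dC [] \<beta> \<omega>) $$ (j, l)\<bar> \<le> F j l \<omega>"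
    by (rule dominating_inverse)
  define w0 w1 w2 where "w0 = 1 / q0" and "w1 = 1 / q1" and "w2 = 1 / q2"
  have w: "0 < w0" "0 < w1" "0 < w2" "3 * w0 + 2 * w1 \<le> 1 / 2" "2 * w0 + w2 \<le> 1 / 2"
    using q by (auto simp: w0_def w1_def w2_def)
  define d1 d2 where "d1 = real CARD('k) * c1" and "d2 = (real CARD('k))\<^sup>2 * c2"
  have d: "0 \<le> d1" "0 \<le> d2" using c by (auto simp: d1_def d2_def)
  define f where "f \<omega> = (\<lambda>j l. F j l \<omega>)" for \<omega>
  define g where "g \<omega> = (\<lambda>j l. G j l \<omega>)" for \<omega>
  define h where "h \<omega> = (\<lambda>j l. H j l \<omega>)" for \<omega>
  define E where "E j l \<omega> = kernel_prod p (f \<omega>) (kernel_prod p (g \<omega>) (kernel_prod p (f \<omega>) (kernel_prod p (g \<omega>) (f \<omega>)))) j l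
      + kernel_prod p (f \<omega>) (kernel_prod p (h \<omega>) (f \<omega>)) j l" for j l \<omega>
  have doms: "mixed_dominated M p w0 c0 (\<lambda>j l \<omega>. f \<omega> j l)" "mixed_dominated M p w1 d1 (\<lambda>j l \<omega>. g \<omega> j l)"
    "mixed_dominated M p w2 d2 (\<lambda>j l \<omega>. h \<omega> j l)"
    using F(1) GH(1,2) by (simp_all add: f_def g_def h_def w0_def w1_def w2_def d1_def d2_def)
  note kp = mixed_dominated_kernel_prod[where F = "\<lambda>j l \<omega>. K \<omega> j l" and G = "\<lambda>j l \<omega>. L \<omega> j l" for K L, simplified]
  \<comment> \<open>The two error terms are products with total exponents \<open>3/q0 + 2/q1\<close> and \<open>2/q0 + 1/q2\<close>, both at
    most \<open>1/2\<close>.\<close>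
  have "mixed_dominated M p (w0 + (w1 + (w0 + (w1 + w0)))) (c0 * (d1 * (c0 * (d1 * c0))))
     (\<lambda>j l \<omega>. kernel_prod p (f \<omega>) (kernel_prod p (g \<omega>) (kernel_prod p (f \<omega>) (kernel_prod p (g \<omega>) (f \<omega>)))) j l)"
    using w d c by (intro kp doms) auto
  then have E1: "mixed_dominated M p (1 / 2) (c0 * (d1 * (c0 * (d1 * c0))))
     (\<lambda>j l \<omega>. kernel_prod p (f \<omega>) (kernel_prod p (g \<omega>) (kernel_prod p (f \<omega>) (kernel_prod p (g \<omega>) (f \<omega>)))) j l)"
    by (rule mixed_dominated_weaken) (use w in auto)
  have "mixed_dominated M p (w0 + (w2 + w0)) (c0 * (d2 * c0))
     (\<lambda>j l \<omega>. kernel_prod p (f \<omega>) (kernel_prod p (h \<omega>) (f \<omega>)) j l)"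
    using w d c by (intro kp doms) auto
  then have E2: "mixed_dominated M p (1 / 2) (c0 * (d2 * c0))
     (\<lambda>j l \<omega>. kernel_prod p (f \<omega>) (kernel_prod p (h \<omega>) (f \<omega>)) j l)"
    by (rule mixed_dominated_weaken) (use w in auto)
  have E: "mixed_dominated M p (1 / 2) (c0 * (d1 * (c0 * (d1 * c0))) + c0 * (d2 * c0)) E"
    unfolding E_def by (intro mixed_dominated_add E1 E2) auto
  have "AE \<omega> in M. \<forall>\<beta>\<in>ball \<beta>0 r. \<forall>j<p. \<forall>l<p.
     \<bar>inv_mat (dC [] \<beta> \<omega>) $$ (j, l) - inv_mat (dC [] \<beta>0 \<omega>) $$ (j, l)
        - (\<Sum>k\<in>UNIV. vec_nth (\<beta> - \<beta>0) k *
             - (inv_mat (dC [] \<beta>0 \<omega>) * (dC [k] \<beta>0 \<omega> * inv_mat (dC [] \<beta>0 \<omega>))) $$ (j, l))\<bar>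
     \<le> (norm (\<beta> - \<beta>0))\<^sup>2 * E j l \<omega>"
    using GH(3) F(2) AE_space
  proof eventually_elim
    case (elim \<omega>)
    show ?case
    proof (intro ballI allI impI)
      fix \<beta> j l assume \<beta>: "\<beta> \<in> ball \<beta>0 r" and jl: "j < p" "l < p"
      have \<beta>B: "\<beta> \<in> B" using \<beta> B(2) by auto
      define C0 C1 A0 where "C0 = dC [] \<beta>0 \<omega>" and "C1 = dC [] \<beta> \<omega>" and "A0 = inv_mat C0"
      define P where "P k = dC [k] \<beta>0 \<omega>" for k
      define L where "L = mat p p (\<lambda>(j, l). \<Sum>k\<in>UNIV. vec_nth (\<beta> - \<beta>0) k * P k $$ (j, l))"
      have car: "C0 \<in> carrier_mat p p" "C1 \<in> carrier_mat p p" "L \<in> carrier_mat p p" "A0 \<in> carrier_mat p p"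
        "P k \<in> carrier_mat p p" "inv_mat C1 \<in> carrier_mat p p" for k
        using carrier[OF base_in elim(3)] carrier[OF \<beta>B elim(3)]
        by (auto simp: C0_def C1_def L_def A0_def P_def intro!: inv_mat_carrier)
      have det: "det C0 \<noteq> 0" "det C1 \<noteq> 0"
        using pos_def_det_nonzero[OF pd[OF base_in elim(3)]] pos_def_det_nonzero[OF pd[OF \<beta>B elim(3)]]
        by (auto simp: C0_def C1_def)
      have bd: "\<bar>(inv_mat C1 - inv_mat C0 + inv_mat C0 * (L * inv_mat C0)) $$ (j, l)\<bar>
         \<le> (norm (\<beta> - \<beta>0))\<^sup>2 * (kernel_prod p (f \<omega>) (kernel_prod p (g \<omega>) (kernel_prod p (f \<omega>) (kernel_prod p (g \<omega>) (f \<omega>)))) j l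
            + kernel_prod p (f \<omega>) (kernel_prod p (h \<omega>) (f \<omega>)) j l)"
      proof (rule inv_mat_remainder_bound[OF car(1-3) det _ _ _ _ jl])
        show "entries_le p (inv_mat C0) (f \<omega>)" "entries_le p (inv_mat C1) (f \<omega>)"
          using elim(2) base_in \<beta>B car(4,6) unfolding entries_le_def f_def A0_def C0_def C1_def by auto
        show "entries_le p (C1 - C0) (\<lambda>j l. norm (\<beta> - \<beta>0) * g \<omega> j l)"
          using elim(1) \<beta> car(1,2) unfolding entries_le_def g_def C0_def C1_def by auto
        show "entries_le p (C1 - C0 - L) (\<lambda>j l. (norm (\<beta> - \<beta>0))\<^sup>2 * h \<omega> j l)"
          using elim(1) \<beta> car(1,2,3) unfolding entries_le_def h_def C0_def C1_def
          by (auto simp: L_def P_def minus_carrier_mat)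
      qed
      have "(A0 * (L * A0)) $$ (j, l) = (\<Sum>m<p. A0 $$ (j, m) * (\<Sum>m'<p. L $$ (m, m') * A0 $$ (m', l)))"
        using car jl by (simp add: mat_mult_entry[of _ p] mult_carrier_mat[of _ p p _ p] del: index_mult_mat(1))
      also have "\<dots> = (\<Sum>m<p. \<Sum>m'<p. \<Sum>k\<in>UNIV. vec_nth (\<beta> - \<beta>0) k * (A0 $$ (j, m) * (P k $$ (m, m') * A0 $$ (m', l))))"
        unfolding L_def by (intro sum.cong refl) (simp add: sum_distrib_left sum_distrib_right mult_ac)
      also have "\<dots> = (\<Sum>k\<in>UNIV. \<Sum>m<p. \<Sum>m'<p. vec_nth (\<beta> - \<beta>0) k * (A0 $$ (j, m) * (P k $$ (m, m') * A0 $$ (m', l))))"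
        by (simp only: sum.swap[of _ "UNIV::'k set"])
      also have "\<dots> = (\<Sum>k\<in>UNIV. vec_nth (\<beta> - \<beta>0) k * (\<Sum>m<p. A0 $$ (j, m) * (\<Sum>m'<p. P k $$ (m, m') * A0 $$ (m', l))))"
        by (simp add: sum_distrib_left)
      also have "\<dots> = (\<Sum>k\<in>UNIV. vec_nth (\<beta> - \<beta>0) k * (A0 * (P k * A0)) $$ (j, l))"
        using car jl by (simp add: mat_mult_entry[of _ p] mult_carrier_mat[of _ p p _ p] del: index_mult_mat(1))
      finally have lin: "(A0 * (L * A0)) $$ (j, l) = (\<Sum>k\<in>UNIV. vec_nth (\<beta> - \<beta>0) k * (A0 * (P k * A0)) $$ (j, l))" .
      have "(inv_mat C1 - A0 + A0 * (L * A0)) $$ (j, l) = inv_mat C1 $$ (j, l) - A0 $$ (j, l) + (A0 * (L * A0)) $$ (j, l)"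
        using car jl mult_carrier_mat[OF car(4) mult_carrier_mat[OF car(3,4)]] by (simp del: index_mult_mat(1))
      then have "inv_mat C1 $$ (j, l) - A0 $$ (j, l) - (\<Sum>k\<in>UNIV. vec_nth (\<beta> - \<beta>0) k * - (A0 * (P k * A0)) $$ (j, l))
          = (inv_mat C1 - A0 + A0 * (L * A0)) $$ (j, l)"
        unfolding lin by (simp add: sum_negf)
      with bd show "\<bar>inv_mat (dC [] \<beta> \<omega>) $$ (j, l) - inv_mat (dC [] \<beta>0 \<omega>) $$ (j, l)
        - (\<Sum>k\<in>UNIV. vec_nth (\<beta> - \<beta>0) k *
             - (inv_mat (dC [] \<beta>0 \<omega>) * (dC [k] \<beta>0 \<omega> * inv_mat (dC [] \<beta>0 \<omega>))) $$ (j, l))\<bar>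
         \<le> (norm (\<beta> - \<beta>0))\<^sup>2 * E j l \<omega>"
        unfolding E_def A0_def C0_def C1_def P_def by simp
    qed
  qed
  from square_sum_remainder[OF E this] show ?thesis unfolding d1_def d2_def .
qed

lemma symmetric_base: "\<beta> \<in> B \<Longrightarrow> \<omega> \<in> space M \<Longrightarrow> transpose_mat (dC [] \<beta> \<omega>) = dC [] \<beta> \<omega>"
  using pd unfolding pos_def_def by blast

text \<open>The entries \<open>(j, l)\<close> and \<open>(l, j)\<close> coincide as functions on \<open>B\<close>, and at the interior point
  \<open>\<beta>0\<close> the derivative within \<open>B\<close> is unique.\<close>

lemma AE_symmetric_derivative:
  "AE \<omega> in M. \<forall>k. transpose_mat (dC [k] \<beta>0 \<omega>) = dC [k] \<beta>0 \<omega>"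
  using der AE_space
proof eventually_elim
  case (elim \<omega>)
  show ?case
  proof (intro allI eq_matI)
    fix k j l assume "j < dim_row (dC [k] \<beta>0 \<omega>)" "l < dim_col (dC [k] \<beta>0 \<omega>)"
    then have jl: "j < p" "l < p" using carrier[OF base_in elim(2), of "[k]"] by auto
    have int: "\<beta>0 \<in> interior B" using B(2,3) by (meson centre_in_ball interior_maximal open_ball subset_iff)
    have d: "((\<lambda>\<beta>'. dC [] \<beta>' \<omega> $$ (j, l)) has_derivative
             (\<lambda>h. \<Sum>k\<in>UNIV. vec_nth h k * dC [k] \<beta>0 \<omega> $$ (j, l))) (at \<beta>0 within B)"
      if "j < p" "l < p" for j l
      using elim(1) base_in that by auto
    have eq: "dC [] \<beta> \<omega> $$ (l, j) = dC [] \<beta> \<omega> $$ (j, l)" if "\<beta> \<in> B" for \<beta>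
    proof -
      have "transpose_mat (dC [] \<beta> \<omega>) $$ (j, l) = dC [] \<beta> \<omega> $$ (j, l)"
        using symmetric_base[OF that elim(2)] by simp
      then show ?thesis using carrier[OF that elim(2), of "[]"] jl by simp
    qed
    have "((\<lambda>\<beta>'. dC [] \<beta>' \<omega> $$ (j, l)) has_derivative
             (\<lambda>h. \<Sum>k\<in>UNIV. vec_nth h k * dC [k] \<beta>0 \<omega> $$ (l, j))) (at \<beta>0 within B)"
      using base_in eq d[OF jl(2,1)] by (intro has_derivative_transform[OF base_in _ d[OF jl(2,1)]]) auto
    with d[OF jl] have "(\<lambda>h. \<Sum>k\<in>UNIV. vec_nth h k * dC [k] \<beta>0 \<omega> $$ (j, l)) =
        (\<lambda>h. \<Sum>k\<in>UNIV. vec_nth h k * dC [k] \<beta>0 \<omega> $$ (l, j))"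
      unfolding at_within_interior[OF int] by (rule has_derivative_unique)
    from fun_cong[OF this, of "axis k 1"] have "dC [k] \<beta>0 \<omega> $$ (j, l) = dC [k] \<beta>0 \<omega> $$ (l, j)"
      by (simp add: axis_def if_distrib[of "\<lambda>x. x * _"] cong: if_cong)
    then show "transpose_mat (dC [k] \<beta>0 \<omega>) $$ (j, l) = dC [k] \<beta>0 \<omega> $$ (j, l)"
      using carrier[OF base_in elim(2), of "[k]"] jl by simp
  qed (use carrier_matD[OF carrier[OF base_in elim(2), of "[_]"]] in auto)
qed

lemma AE_trace_0:
  "AE \<omega> in M. \<forall>k1 k2. trace_mat (mat_powi (dC [] \<beta>0 \<omega>) 0 * dC [k1] \<beta>0 \<omega> * mat_powi (dC [] \<beta>0 \<omega>) 0 * dC [k2] \<beta>0 \<omega>)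
     = (\<Sum>j<p. \<Sum>l<p. dC [k1] \<beta>0 \<omega> $$ (j, l) * dC [k2] \<beta>0 \<omega> $$ (j, l))"
  using AE_symmetric_derivative AE_space
  by eventually_elim (auto intro!: trace_mat_powi_0 carrier base_in)

lemma AE_trace_minus_2:
  "AE \<omega> in M. \<forall>k1 k2. trace_mat (mat_powi (dC [] \<beta>0 \<omega>) (-2) * dC [k1] \<beta>0 \<omega> * mat_powi (dC [] \<beta>0 \<omega>) (-2) * dC [k2] \<beta>0 \<omega>)
     = (\<Sum>j<p. \<Sum>l<p. (inv_mat (dC [] \<beta>0 \<omega>) * (dC [k1] \<beta>0 \<omega> * inv_mat (dC [] \<beta>0 \<omega>))) $$ (j, l)
         * (inv_mat (dC [] \<beta>0 \<omega>) * (dC [k2] \<beta>0 \<omega> * inv_mat (dC [] \<beta>0 \<omega>))) $$ (j, l))"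
  using AE_symmetric_derivative AE_space
  by eventually_elim (auto intro!: trace_mat_powi_minus_2 carrier base_in symmetric_base)

lemma borel_measurable_trace:
  assumes "l = 0 \<or> l = -2"
  shows "(\<lambda>\<omega>. trace_mat (mat_powi (dC [] \<beta>0 \<omega>) l * dC [k1] \<beta>0 \<omega> * mat_powi (dC [] \<beta>0 \<omega>) l * dC [k2] \<beta>0 \<omega>))
    \<in> borel_measurable M"
  by (intro borel_measurable_trace_mat[where p = p] measurable_mat_mult measurable_mat_powi meas base_in assms) auto

lemma measurable_sandwich:
  "measurable_mat M p (\<lambda>\<omega>. inv_mat (dC [] \<beta>0 \<omega>) * (dC [k] \<beta>0 \<omega> * inv_mat (dC [] \<beta>0 \<omega>)))"
  by (intro measurable_mat_mult measurable_mat_inv_mat meas base_in) auto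

end

section \<open>Squared Frobenius errors of plug-in covariance estimators\<close>

theorem theorem3:
  fixes M :: "'a measure" and S :: "nat \<Rightarrow> 'x measure"
    and n p :: "nat \<Rightarrow> nat"
    and Y :: "nat \<Rightarrow> nat \<Rightarrow> 'a \<Rightarrow> real vec"
    and X :: "nat \<Rightarrow> nat \<Rightarrow> 'a \<Rightarrow> 'x"
    and C :: "nat \<Rightarrow> real ^ 'k \<Rightarrow> 'x \<Rightarrow> real mat"
    and dC :: "nat \<Rightarrow> 'k list \<Rightarrow> real ^ 'k \<Rightarrow> 'x \<Rightarrow> real mat"
    and B :: "(real ^ 'k) set" and \<beta>0 :: "real ^ 'k"
    and \<epsilon> :: "nat \<Rightarrow> nat \<Rightarrow> nat \<Rightarrow> 'a \<Rightarrow> real" and \<eta>1 :: real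
    and Q :: "int \<Rightarrow> nat \<Rightarrow> real ^ 'k ^ 'k"
    and \<beta>hat :: "nat \<Rightarrow> 'a \<Rightarrow> real ^ 'k"
    and N :: "'c measure" and Z :: "'c \<Rightarrow> real ^ 'k"
    and i :: nat
  assumes model: "cov_reg_model M S n p Y X C \<beta>0"
    and p_lim: "filterlim p at_top sequentially"
    and n_regime: "(\<exists>n0. \<forall>t. n t = n0) \<or> filterlim n at_top sequentially"
    and A1: "A1 M S n p Y X C \<beta>0 \<epsilon> \<eta>1"
    and A2: "A2 M S n p X C dC B \<beta>0"
    and A3: "A3 M n p X C dC B \<beta>0 \<eta>1"
    and A5: "A5 M n p X C dC \<beta>0 Q"
    and Z_normal: "prob_space N" "multivariate_normal N Z"
    and estimator: "\<And>t. \<beta>hat t \<in> borel_measurable M"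
    and estimator_lim:
      "conv_in_dist M (\<lambda>t \<omega>. sqrt (real (n t) * real (p t)) *\<^sub>R (\<beta>hat t \<omega> - \<beta>0)) N Z"
    and i_obs: "\<forall>\<^sub>F t in sequentially. i \<in> {1..n t}"
    and plug_in_measurable:
      "\<And>t. i \<in> {1..n t} \<Longrightarrow> measurable_mat M (p t) (\<lambda>\<omega>. C t (\<beta>hat t \<omega>) (X t i \<omega>))"
  shows "weak_conv_m
           (\<lambda>t. distr M borel (\<lambda>\<omega>. real (n t) *
              (frobenius_norm (C t (\<beta>hat t \<omega>) (X t i \<omega>) - C t \<beta>0 (X t i \<omega>)))\<^sup>2))
           (distr N borel (\<lambda>\<omega>. Z \<omega> \<bullet> (Q 0 i *v Z \<omega>))) \<and>
         ((\<forall>t. i \<in> {1..n t} \<longrightarrow>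
             (AE \<omega> in M. invertible_mat (C t (\<beta>hat t \<omega>) (X t i \<omega>)))) \<longrightarrow>
          weak_conv_m
           (\<lambda>t. distr M borel (\<lambda>\<omega>. real (n t) *
              (frobenius_norm (inv_mat (C t (\<beta>hat t \<omega>) (X t i \<omega>)) - inv_mat (C t \<beta>0 (X t i \<omega>))))\<^sup>2))
           (distr N borel (\<lambda>\<omega>. Z \<omega> \<bullet> (Q (-2) i *v Z \<omega>))))"
proof -
  have M: "prob_space M" and np: "\<And>t. 1 \<le> n t" "\<And>t. 1 \<le> p t"
    and Cm: "\<And>t \<beta>. measurable_mat (S t) (p t) (C t \<beta>)"
    and X: "\<And>t. i \<in> {1..n t} \<Longrightarrow> X t i \<in> measurable M (S t)"
    using model unfolding cov_reg_model_def by auto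
  have Z: "Z \<in> borel_measurable N" using Z_normal(2) unfolding multivariate_normal_def by blast
  have B: "compact B" "\<beta>0 \<in> interior B" and dC0: "\<And>t. dC t [] = C t"
    using A2 unfolding A2_def by auto
  obtain r where r: "0 < r" "ball \<beta>0 r \<subseteq> B" using B(2) by (auto simp: mem_interior)
  obtain q0 q1 q2 c0 c1 c2 where
    q: "0 < q0" "0 < q1" "0 < q2" "3 / q0 + 2 / q1 \<le> 1 / 2" "2 / q0 + 1 / q2 \<le> 1 / 2"
    and c: "0 \<le> c0" "0 \<le> c1" "0 \<le> c2"
    and n0: "\<And>t. i \<in> {1..n t} \<Longrightarrow> mixed_norm M (p t) q0 1 (sup_abs_entry B (\<lambda>\<beta> \<omega>. inv_mat (C t \<beta> (X t i \<omega>)))) \<le> ennreal c0"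
    and n1: "\<And>t k. i \<in> {1..n t} \<Longrightarrow> mixed_norm M (p t) q1 1 (sup_abs_entry B (\<lambda>\<beta> \<omega>. dC t [k] \<beta> (X t i \<omega>))) \<le> ennreal c1"
    and n2: "\<And>t k k'. i \<in> {1..n t} \<Longrightarrow> mixed_norm M (p t) q2 1 (sup_abs_entry B (\<lambda>\<beta> \<omega>. dC t [k, k'] \<beta> (X t i \<omega>))) \<le> ennreal c2"
  proof -
    from A3 obtain \<eta>2 \<delta>c \<delta>0 \<delta>1 \<delta>2 \<delta>3 where \<eta>2: "\<eta>2 > 8 / \<eta>1"
      and \<delta>: "\<delta>c > 0" "\<delta>0 > 0" "\<delta>1 > 0" "\<delta>2 > 0" "\<delta>3 > 0"
      and mx: "Max {2 / \<delta>c + 4 / \<delta>0 + 3 / \<delta>1, 2 / \<delta>c + 3 / \<delta>0 + 1 / \<delta>1 + 1 / \<delta>2, 2 / \<delta>c + 2 / \<delta>0 + 1 / \<delta>3} \<le> 1"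
      and f0: "(SUP t. SUP i\<in>{1..n t}. mixed_norm M (p t) (\<delta>0 * (2 + \<eta>2)) 1
           (sup_abs_entry B (\<lambda>\<beta> \<omega>. inv_mat (C t \<beta> (X t i \<omega>))))) < \<infinity>"
      and f1: "\<forall>k. (SUP t. SUP i\<in>{1..n t}. mixed_norm M (p t) (\<delta>1 * (2 + \<eta>2)) 1
           (sup_abs_entry B (\<lambda>\<beta> \<omega>. dC t [k] \<beta> (X t i \<omega>)))) < \<infinity>"
      and f2: "\<forall>k1 k2. (SUP t. SUP i\<in>{1..n t}. mixed_norm M (p t) (\<delta>2 * (2 + \<eta>2)) 1
           (sup_abs_entry B (\<lambda>\<beta> \<omega>. dC t [k1, k2] \<beta> (X t i \<omega>)))) < \<infinity>"
      unfolding A3_def by blast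
    have "\<eta>1 > 0" using A1 unfolding A1_def by blast
    then have a: "2 + \<eta>2 > 2" using \<eta>2 by (meson divide_pos_pos less_add_same_cancel1 less_trans zero_less_numeral)
    have bnd: "F t i \<le> ennreal (enn2real (SUP t. SUP i\<in>{1..n t}. F t i))"
      if "(SUP t. SUP i\<in>{1..n t}. F t i) < \<infinity>" "i \<in> {1..n t}" for F :: "nat \<Rightarrow> nat \<Rightarrow> ennreal" and t i
    proof -
      have "F t i \<le> (SUP i\<in>{1..n t}. F t i)" using that(2) by (rule SUP_upper)
      also have "\<dots> \<le> (SUP t. SUP i\<in>{1..n t}. F t i)" by (rule SUP_upper) simp
      finally show ?thesis using that(1) by simp
    qed
    \<comment> \<open>The suprema over all stages and observations are finite, which yields constants that do
      not depend on the stage; for the derivatives the constants are summed over the finitely many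
      directions.\<close>
    define e0 where "e0 = enn2real (SUP t. SUP i\<in>{1..n t}. mixed_norm M (p t) (\<delta>0 * (2 + \<eta>2)) 1
           (sup_abs_entry B (\<lambda>\<beta> \<omega>. inv_mat (C t \<beta> (X t i \<omega>)))))"
    define e1 where "e1 k = enn2real (SUP t. SUP i\<in>{1..n t}. mixed_norm M (p t) (\<delta>1 * (2 + \<eta>2)) 1
           (sup_abs_entry B (\<lambda>\<beta> \<omega>. dC t [k] \<beta> (X t i \<omega>))))" for k
    define e2 where "e2 k k' = enn2real (SUP t. SUP i\<in>{1..n t}. mixed_norm M (p t) (\<delta>2 * (2 + \<eta>2)) 1
           (sup_abs_entry B (\<lambda>\<beta> \<omega>. dC t [k, k'] \<beta> (X t i \<omega>))))" for k k'
    have le: "e1 k \<le> (\<Sum>k\<in>UNIV. e1 k)" "e2 k k' \<le> (\<Sum>k\<in>UNIV. \<Sum>k'\<in>UNIV. e2 k k')" for k k'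
    proof -
      show "e1 k \<le> (\<Sum>k\<in>UNIV. e1 k)" by (rule member_le_sum) (auto simp: e1_def)
      have "e2 k k' \<le> (\<Sum>k'\<in>UNIV. e2 k k')" by (rule member_le_sum) (auto simp: e2_def)
      also have "\<dots> \<le> (\<Sum>k\<in>UNIV. \<Sum>k'\<in>UNIV. e2 k k')"
        by (rule member_le_sum) (auto simp: e2_def intro!: sum_nonneg)
      finally show "e2 k k' \<le> (\<Sum>k\<in>UNIV. \<Sum>k'\<in>UNIV. e2 k k')" .
    qed
    have ex: "3 / \<delta>0 + 2 / \<delta>1 \<le> 1" "2 / \<delta>0 + 1 / \<delta>2 \<le> 1"
    proof -
      have "0 < 2 / \<delta>c" "0 < 1 / \<delta>0" "0 < 1 / \<delta>1" "0 < 1 / \<delta>2" using \<delta> by auto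
      moreover have "2 / \<delta>c + 4 / \<delta>0 + 3 / \<delta>1 \<le> 1" "2 / \<delta>c + 3 / \<delta>0 + 1 / \<delta>1 + 1 / \<delta>2 \<le> 1" using mx by auto
      moreover have "4 / \<delta>0 = 3 / \<delta>0 + 1 / \<delta>0" "3 / \<delta>0 = 2 / \<delta>0 + 1 / \<delta>0" "3 / \<delta>1 = 2 / \<delta>1 + 1 / \<delta>1"
        by (simp_all flip: add_divide_distrib)
      ultimately show "3 / \<delta>0 + 2 / \<delta>1 \<le> 1" "2 / \<delta>0 + 1 / \<delta>2 \<le> 1" by linarith+
    qed
    \<comment> \<open>The factor \<open>2 + \<eta>2 > 2\<close> in the exponents leaves room for square integrability.\<close>
    have half: "u / (2 + \<eta>2) \<le> 1 / 2" if "u \<le> 1" for u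
    proof -
      have "u / (2 + \<eta>2) \<le> 1 / (2 + \<eta>2)" using that a by (intro divide_right_mono) auto
      also have "\<dots> \<le> 1 / 2" using a by (intro divide_left_mono) auto
      finally show ?thesis .
    qed
    show thesis
    proof (rule that[of "\<delta>0 * (2 + \<eta>2)" "\<delta>1 * (2 + \<eta>2)" "\<delta>2 * (2 + \<eta>2)" e0 "\<Sum>k\<in>UNIV. e1 k" "\<Sum>k\<in>UNIV. \<Sum>k'\<in>UNIV. e2 k k'"])
      show "3 / (\<delta>0 * (2 + \<eta>2)) + 2 / (\<delta>1 * (2 + \<eta>2)) \<le> 1 / 2"
        using half[OF ex(1)] by (simp add: add_divide_distrib)
      show "2 / (\<delta>0 * (2 + \<eta>2)) + 1 / (\<delta>2 * (2 + \<eta>2)) \<le> 1 / 2"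
        using half[OF ex(2)] by (simp add: add_divide_distrib)
      fix t k k' assume i: "i \<in> {1..n t}"
      show "mixed_norm M (p t) (\<delta>0 * (2 + \<eta>2)) 1 (sup_abs_entry B (\<lambda>\<beta> \<omega>. inv_mat (C t \<beta> (X t i \<omega>)))) \<le> ennreal e0"
        unfolding e0_def by (rule bnd[OF f0 i])
      show "mixed_norm M (p t) (\<delta>1 * (2 + \<eta>2)) 1 (sup_abs_entry B (\<lambda>\<beta> \<omega>. dC t [k] \<beta> (X t i \<omega>))) \<le> ennreal (\<Sum>k\<in>UNIV. e1 k)"
        by (rule order_trans[OF bnd[OF f1[rule_format, of k] i, folded e1_def] ennreal_leI[OF le(1)]])
      show "mixed_norm M (p t) (\<delta>2 * (2 + \<eta>2)) 1 (sup_abs_entry B (\<lambda>\<beta> \<omega>. dC t [k, k'] \<beta> (X t i \<omega>))) \<le> ennreal (\<Sum>k\<in>UNIV. \<Sum>k'\<in>UNIV. e2 k k')"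
        by (rule order_trans[OF bnd[OF f2[rule_format, of k k'] i, folded e2_def] ennreal_leI[OF le(2)]])
    qed (use \<delta> a in \<open>auto simp: e0_def e1_def e2_def intro!: sum_nonneg\<close>)
  qed
  have stage: "smooth_random_matrix M (p t) (\<lambda>ks \<beta> \<omega>. dC t ks \<beta> (X t i \<omega>)) B \<beta>0 r q0 q1 q2 c0 c1 c2"
    if i: "i \<in> {1..n t}" for t
  proof (intro smooth_random_matrix.intro smooth_random_matrix_axioms.intro)
    have Xs: "X t i \<omega> \<in> space (S t)" if "\<omega> \<in> space M" for \<omega>
      using X[OF i] that by (rule measurable_space)
    show "closed B" using B(1) by (rule compact_imp_closed)
    show "pos_def (p t) (dC t [] \<beta> (X t i \<omega>))" if "\<beta> \<in> B" "\<omega> \<in> space M" for \<beta> \<omega>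
      using A2 that Xs unfolding A2_def dC0 by blast
    have "AE x in distr M (S t) (X t i).
        \<forall>ks. length ks \<le> 2 \<longrightarrow> (\<forall>\<beta>\<in>B. \<forall>j<p t. \<forall>l<p t.
          ((\<lambda>\<beta>'. dC t ks \<beta>' x $$ (j, l)) has_derivative
             (\<lambda>h. \<Sum>k\<in>UNIV. vec_nth h k * dC t (k # ks) \<beta> x $$ (j, l))) (at \<beta> within B))"
      using A2 i unfolding A2_def by blast
    then show "AE \<omega> in M.
        \<forall>ks. length ks \<le> 2 \<longrightarrow> (\<forall>\<beta>\<in>B. \<forall>j<p t. \<forall>l<p t.
          ((\<lambda>\<beta>'. dC t ks \<beta>' (X t i \<omega>) $$ (j, l)) has_derivative
             (\<lambda>h. \<Sum>k\<in>UNIV. vec_nth h k * dC t (k # ks) \<beta> (X t i \<omega>) $$ (j, l))) (at \<beta> within B))"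
      by (rule AE_distrD[OF X[OF i]])
    show "measurable_mat M (p t) (\<lambda>\<omega>. dC t ks \<beta> (X t i \<omega>))" if "length ks \<le> 2" "\<beta> \<in> B" for ks \<beta>
    proof -
      have "measurable_mat (S t) (p t) (dC t ks \<beta>)" using A2 that unfolding A2_def by auto
      then show ?thesis by (rule measurable_mat_compose[OF X[OF i]])
    qed
  qed (use M r q c n0[OF i] n1[OF i] n2[OF i] in \<open>simp_all add: dC0\<close>)
  have C_carrier: "C t \<beta> (X t i \<omega>) \<in> carrier_mat (p t) (p t)" if "i \<in> {1..n t}" "\<omega> \<in> space M" for t \<beta> \<omega>
    using Cm measurable_space[OF X[OF that(1)] that(2)] unfolding measurable_mat_def by blast
  have C0m: "measurable_mat M (p t) (\<lambda>\<omega>. C t \<beta>0 (X t i \<omega>))" if "i \<in> {1..n t}" for t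
    using smooth_random_matrix.meas[OF stage[OF that], of "[]" \<beta>0]
      smooth_random_matrix.base_in[OF stage[OF that]] by (simp add: dC0)
  \<comment> \<open>The traces are inner products only almost surely, because the derivatives of \<open>C\<close> are
    symmetric only almost surely.\<close>
  have Qlim: "conv_in_prob M (\<lambda>t \<omega>. \<chi> k1 k2. 1 / real (p t) *
       (\<Sum>j<p t. \<Sum>l<p t. G t \<omega> k1 j l * G t \<omega> k2 j l)) (Q m i)"
    if m: "m = 0 \<or> m = -2"
      and G: "\<And>t k j l. i \<in> {1..n t} \<Longrightarrow> j < p t \<Longrightarrow> l < p t \<Longrightarrow> (\<lambda>\<omega>. G t \<omega> k j l) \<in> borel_measurable M"
      and tr: "\<And>t. i \<in> {1..n t} \<Longrightarrow> AE \<omega> in M. \<forall>k1 k2.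
         trace_mat (mat_powi (C t \<beta>0 (X t i \<omega>)) m * dC t [k1] \<beta>0 (X t i \<omega>) *
                    mat_powi (C t \<beta>0 (X t i \<omega>)) m * dC t [k2] \<beta>0 (X t i \<omega>))
         = (\<Sum>j<p t. \<Sum>l<p t. G t \<omega> k1 j l * G t \<omega> k2 j l)"
    for m and G :: "nat \<Rightarrow> 'a \<Rightarrow> 'k \<Rightarrow> nat \<Rightarrow> nat \<Rightarrow> real"
  proof (rule conv_in_prob_cong_AE)
    show "conv_in_prob M
          (\<lambda>t \<omega>. \<chi> k1 k2. 1 / real (p t) *
             trace_mat (mat_powi (C t \<beta>0 (X t i \<omega>)) m * dC t [k1] \<beta>0 (X t i \<omega>) *
                        mat_powi (C t \<beta>0 (X t i \<omega>)) m * dC t [k2] \<beta>0 (X t i \<omega>)))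
          (Q m i)"
      using A5 i_obs m unfolding A5_def by blast
    show "\<forall>\<^sub>F t in sequentially. (\<lambda>\<omega>. (\<chi> k1 k2. 1 / real (p t) *
             trace_mat (mat_powi (C t \<beta>0 (X t i \<omega>)) m * dC t [k1] \<beta>0 (X t i \<omega>) *
                        mat_powi (C t \<beta>0 (X t i \<omega>)) m * dC t [k2] \<beta>0 (X t i \<omega>))) :: real^'k^'k) \<in> borel_measurable M"
      using i_obs
    proof eventually_elim
      case (elim t)
      show ?case
        using smooth_random_matrix.borel_measurable_trace[OF stage[OF elim] m]
        by (intro borel_measurable_matrix_lambda borel_measurable_times) (simp_all add: dC0)
    qed
    show "\<forall>\<^sub>F t in sequentially. (\<lambda>\<omega>. (\<chi> k1 k2. 1 / real (p t) *
       (\<Sum>j<p t. \<Sum>l<p t. G t \<omega> k1 j l * G t \<omega> k2 j l)) :: real^'k^'k) \<in> borel_measurable M"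
      using i_obs
    proof eventually_elim
      case (elim t)
      show ?case
        using G[OF elim]
        by (intro borel_measurable_matrix_lambda borel_measurable_times borel_measurable_sum) simp_all
    qed
    show "\<forall>\<^sub>F t in sequentially. AE \<omega> in M. (\<chi> k1 k2. 1 / real (p t) *
             trace_mat (mat_powi (C t \<beta>0 (X t i \<omega>)) m * dC t [k1] \<beta>0 (X t i \<omega>) *
                        mat_powi (C t \<beta>0 (X t i \<omega>)) m * dC t [k2] \<beta>0 (X t i \<omega>))) =
       ((\<chi> k1 k2. 1 / real (p t) * (\<Sum>j<p t. \<Sum>l<p t. G t \<omega> k1 j l * G t \<omega> k2 j l)) :: real^'k^'k)"
      using i_obs
    proof eventually_elim
      case (elim t)
      show ?case using tr[OF elim] by eventually_elim simp
    qed
  qed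
  \<comment> \<open>Both claims are instances of one statement about an error matrix \<open>A - A0\<close> whose linear part has
    the coefficients \<open>G\<close>; only the exponent \<open>m\<close> in the limit matrix differs.\<close>
  have transfer: "weak_conv_m (\<lambda>t. distr M borel (\<lambda>\<omega>. real (n t) * (frobenius_norm (A t \<omega> - A0 t \<omega>))\<^sup>2))
         (distr N borel (\<lambda>\<omega>. Z \<omega> \<bullet> (Q m i *v Z \<omega>)))"
    if m: "m = 0 \<or> m = -2"
      and A: "\<And>t. i \<in> {1..n t} \<Longrightarrow> measurable_mat M (p t) (A t)"
      and A0: "\<And>t. i \<in> {1..n t} \<Longrightarrow> measurable_mat M (p t) (A0 t)"
      and G: "\<And>t k j l. i \<in> {1..n t} \<Longrightarrow> j < p t \<Longrightarrow> l < p t \<Longrightarrow> (\<lambda>\<omega>. G t \<omega> k j l) \<in> borel_measurable M"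
      and tr: "\<And>t. i \<in> {1..n t} \<Longrightarrow> AE \<omega> in M. \<forall>k1 k2.
         trace_mat (mat_powi (C t \<beta>0 (X t i \<omega>)) m * dC t [k1] \<beta>0 (X t i \<omega>) *
                    mat_powi (C t \<beta>0 (X t i \<omega>)) m * dC t [k2] \<beta>0 (X t i \<omega>))
         = (\<Sum>j<p t. \<Sum>l<p t. G t \<omega> k1 j l * G t \<omega> k2 j l)"
      and rem: "\<And>t. i \<in> {1..n t} \<Longrightarrow> \<exists>V. integrable M V \<and> (\<forall>\<omega>. 0 \<le> V \<omega>) \<and> integral\<^sup>L M V \<le> \<kappa> * real (p t) \<and>
         (AE \<omega> in M. norm (\<beta>hat t \<omega> - \<beta>0) < r \<longrightarrow>
            (\<Sum>j<p t. \<Sum>l<p t. (A t \<omega> $$ (j, l) - A0 t \<omega> $$ (j, l)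
               - (\<Sum>k\<in>UNIV. vec_nth (\<beta>hat t \<omega> - \<beta>0) k * G t \<omega> k j l))\<^sup>2)
            \<le> norm (\<beta>hat t \<omega> - \<beta>0) ^ 4 * V \<omega>)"
    for m \<kappa> and A A0 :: "nat \<Rightarrow> 'a \<Rightarrow> real mat" and G :: "nat \<Rightarrow> 'a \<Rightarrow> 'k \<Rightarrow> nat \<Rightarrow> nat \<Rightarrow> real"
  proof (rule weak_conv_m_cong)
    show "weak_conv_m (\<lambda>t. distr M borel (\<lambda>\<omega>. real (n t) * (\<Sum>j<p t. \<Sum>l<p t. (A t \<omega> $$ (j, l) - A0 t \<omega> $$ (j, l))\<^sup>2)))
           (distr N borel (\<lambda>\<omega>. Z \<omega> \<bullet> (Q m i *v Z \<omega>)))"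
    proof (rule frobenius_delta_method[OF M Z_normal(1) Z np p_lim estimator estimator_lim _ _ Qlim[OF m G tr] r(1)])
      show "\<forall>\<^sub>F t in sequentially. \<forall>j<p t. \<forall>l<p t. (\<lambda>\<omega>. A t \<omega> $$ (j, l) - A0 t \<omega> $$ (j, l)) \<in> borel_measurable M"
        using i_obs
      proof eventually_elim
        case (elim t)
        show ?case
          using A[OF elim] A0[OF elim] unfolding measurable_mat_def
          by (intro allI impI borel_measurable_diff) auto
      qed
      show "\<forall>\<^sub>F t in sequentially. \<forall>k. \<forall>j<p t. \<forall>l<p t. (\<lambda>\<omega>. G t \<omega> k j l) \<in> borel_measurable M"
        using i_obs by eventually_elim (use G in auto)
      show "\<forall>\<^sub>F t in sequentially. \<exists>V. integrable M V \<and> (\<forall>\<omega>. 0 \<le> V \<omega>) \<and> integral\<^sup>L M V \<le> \<kappa> * real (p t) \<and>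
         (AE \<omega> in M. norm (\<beta>hat t \<omega> - \<beta>0) < r \<longrightarrow>
            (\<Sum>j<p t. \<Sum>l<p t. (A t \<omega> $$ (j, l) - A0 t \<omega> $$ (j, l)
               - (\<Sum>k\<in>UNIV. vec_nth (\<beta>hat t \<omega> - \<beta>0) k * G t \<omega> k j l))\<^sup>2)
            \<le> norm (\<beta>hat t \<omega> - \<beta>0) ^ 4 * V \<omega>)"
        using i_obs by eventually_elim (rule rem)
    qed
    show "\<forall>\<^sub>F t in sequentially.
        distr M borel (\<lambda>\<omega>. real (n t) * (\<Sum>j<p t. \<Sum>l<p t. (A t \<omega> $$ (j, l) - A0 t \<omega> $$ (j, l))\<^sup>2)) =
        distr M borel (\<lambda>\<omega>. real (n t) * (frobenius_norm (A t \<omega> - A0 t \<omega>))\<^sup>2)"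
      using i_obs
    proof eventually_elim
      case (elim t)
      show ?case
      proof (rule distr_cong)
        fix \<omega> assume "\<omega> \<in> space M"
        then have "A t \<omega> \<in> carrier_mat (p t) (p t)" "A0 t \<omega> \<in> carrier_mat (p t) (p t)"
          using A[OF elim] A0[OF elim] unfolding measurable_mat_def by auto
        then show "real (n t) * (\<Sum>j<p t. \<Sum>l<p t. (A t \<omega> $$ (j, l) - A0 t \<omega> $$ (j, l))\<^sup>2) =
            real (n t) * (frobenius_norm (A t \<omega> - A0 t \<omega>))\<^sup>2"
          by (simp add: frobenius_norm_diff_squared)
      qed auto
    qed
  qed
  have ball: "\<beta> \<in> ball \<beta>0 r" if "norm (\<beta> - \<beta>0) < r" for \<beta>
    using that by (simp add: dist_norm norm_minus_commute)
  have "weak_conv_m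
           (\<lambda>t. distr M borel (\<lambda>\<omega>. real (n t) *
              (frobenius_norm (C t (\<beta>hat t \<omega>) (X t i \<omega>) - C t \<beta>0 (X t i \<omega>)))\<^sup>2))
           (distr N borel (\<lambda>\<omega>. Z \<omega> \<bullet> (Q 0 i *v Z \<omega>)))"
  proof (rule transfer[where G = "\<lambda>t \<omega> k j l. dC t [k] \<beta>0 (X t i \<omega>) $$ (j, l)"])
    fix t assume i: "i \<in> {1..n t}"
    interpret st: smooth_random_matrix M "p t" "\<lambda>ks \<beta> \<omega>. dC t ks \<beta> (X t i \<omega>)" B \<beta>0 r q0 q1 q2 c0 c1 c2
      by (rule stage[OF i])
    show "(\<lambda>\<omega>. dC t [k] \<beta>0 (X t i \<omega>) $$ (j, l)) \<in> borel_measurable M" if "j < p t" "l < p t" for k j l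
      using st.meas[of "[k]" \<beta>0] st.base_in that unfolding measurable_mat_def by simp
    show "AE \<omega> in M. \<forall>k1 k2.
         trace_mat (mat_powi (C t \<beta>0 (X t i \<omega>)) 0 * dC t [k1] \<beta>0 (X t i \<omega>) *
                    mat_powi (C t \<beta>0 (X t i \<omega>)) 0 * dC t [k2] \<beta>0 (X t i \<omega>))
         = (\<Sum>j<p t. \<Sum>l<p t. dC t [k1] \<beta>0 (X t i \<omega>) $$ (j, l) * dC t [k2] \<beta>0 (X t i \<omega>) $$ (j, l))"
      using st.AE_trace_0 by (simp add: dC0)
    obtain V where V: "integrable M V" "\<forall>\<omega>. 0 \<le> V \<omega>" "integral\<^sup>L M V \<le> 2 * ((real CARD('k))\<^sup>2 * c2)\<^sup>2 * real (p t)"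
      "AE \<omega> in M. \<forall>\<beta>\<in>ball \<beta>0 r. (\<Sum>j<p t. \<Sum>l<p t. (C t \<beta> (X t i \<omega>) $$ (j, l) - C t \<beta>0 (X t i \<omega>) $$ (j, l)
        - (\<Sum>k\<in>UNIV. vec_nth (\<beta> - \<beta>0) k * dC t [k] \<beta>0 (X t i \<omega>) $$ (j, l)))\<^sup>2) \<le> norm (\<beta> - \<beta>0) ^ 4 * V \<omega>"
      using st.matrix_remainder unfolding dC0 by blast
    show "\<exists>V. integrable M V \<and> (\<forall>\<omega>. 0 \<le> V \<omega>) \<and> integral\<^sup>L M V \<le> (2 * ((real CARD('k))\<^sup>2 * c2)\<^sup>2) * real (p t) \<and>
         (AE \<omega> in M. norm (\<beta>hat t \<omega> - \<beta>0) < r \<longrightarrow>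
            (\<Sum>j<p t. \<Sum>l<p t. (C t (\<beta>hat t \<omega>) (X t i \<omega>) $$ (j, l) - C t \<beta>0 (X t i \<omega>) $$ (j, l)
               - (\<Sum>k\<in>UNIV. vec_nth (\<beta>hat t \<omega> - \<beta>0) k * dC t [k] \<beta>0 (X t i \<omega>) $$ (j, l)))\<^sup>2)
            \<le> norm (\<beta>hat t \<omega> - \<beta>0) ^ 4 * V \<omega>)"
    proof (intro exI[of _ V] conjI V(1-3))
      show "AE \<omega> in M. norm (\<beta>hat t \<omega> - \<beta>0) < r \<longrightarrow>
            (\<Sum>j<p t. \<Sum>l<p t. (C t (\<beta>hat t \<omega>) (X t i \<omega>) $$ (j, l) - C t \<beta>0 (X t i \<omega>) $$ (j, l)
               - (\<Sum>k\<in>UNIV. vec_nth (\<beta>hat t \<omega> - \<beta>0) k * dC t [k] \<beta>0 (X t i \<omega>) $$ (j, l)))\<^sup>2)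
            \<le> norm (\<beta>hat t \<omega> - \<beta>0) ^ 4 * V \<omega>"
        using V(4) by eventually_elim (use ball in blast)
    qed
  qed (simp_all add: plug_in_measurable C0m)
  moreover have "weak_conv_m
           (\<lambda>t. distr M borel (\<lambda>\<omega>. real (n t) *
              (frobenius_norm (inv_mat (C t (\<beta>hat t \<omega>) (X t i \<omega>)) - inv_mat (C t \<beta>0 (X t i \<omega>))))\<^sup>2))
           (distr N borel (\<lambda>\<omega>. Z \<omega> \<bullet> (Q (-2) i *v Z \<omega>)))"
  proof (rule transfer[where G = "\<lambda>t \<omega> k j l. - (inv_mat (C t \<beta>0 (X t i \<omega>)) *
        (dC t [k] \<beta>0 (X t i \<omega>) * inv_mat (C t \<beta>0 (X t i \<omega>)))) $$ (j, l)"])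
    fix t assume i: "i \<in> {1..n t}"
    interpret st: smooth_random_matrix M "p t" "\<lambda>ks \<beta> \<omega>. dC t ks \<beta> (X t i \<omega>)" B \<beta>0 r q0 q1 q2 c0 c1 c2
      by (rule stage[OF i])
    show "(\<lambda>\<omega>. - (inv_mat (C t \<beta>0 (X t i \<omega>)) *
        (dC t [k] \<beta>0 (X t i \<omega>) * inv_mat (C t \<beta>0 (X t i \<omega>)))) $$ (j, l)) \<in> borel_measurable M" if "j < p t" "l < p t" for k j l
      using st.measurable_sandwich[of k] that unfolding measurable_mat_def dC0 by (intro borel_measurable_uminus) auto
    show "AE \<omega> in M. \<forall>k1 k2.
         trace_mat (mat_powi (C t \<beta>0 (X t i \<omega>)) (-2) * dC t [k1] \<beta>0 (X t i \<omega>) *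
                    mat_powi (C t \<beta>0 (X t i \<omega>)) (-2) * dC t [k2] \<beta>0 (X t i \<omega>))
         = (\<Sum>j<p t. \<Sum>l<p t. - (inv_mat (C t \<beta>0 (X t i \<omega>)) *
              (dC t [k1] \<beta>0 (X t i \<omega>) * inv_mat (C t \<beta>0 (X t i \<omega>)))) $$ (j, l) *
            - (inv_mat (C t \<beta>0 (X t i \<omega>)) *
              (dC t [k2] \<beta>0 (X t i \<omega>) * inv_mat (C t \<beta>0 (X t i \<omega>)))) $$ (j, l))"
      using st.AE_trace_minus_2 unfolding dC0 by (simp only: minus_mult_minus)
    show "measurable_mat M (p t) (\<lambda>\<omega>. inv_mat (C t (\<beta>hat t \<omega>) (X t i \<omega>)))"
      "measurable_mat M (p t) (\<lambda>\<omega>. inv_mat (C t \<beta>0 (X t i \<omega>)))"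
      by (intro measurable_mat_inv_mat plug_in_measurable C0m i)+
    let ?\<kappa> = "2 * (c0 * (real CARD('k) * c1 * (c0 * (real CARD('k) * c1 * c0))) + c0 * ((real CARD('k))\<^sup>2 * c2 * c0))\<^sup>2"
    obtain V where V: "integrable M V" "\<forall>\<omega>. 0 \<le> V \<omega>" "integral\<^sup>L M V \<le> ?\<kappa> * real (p t)"
      "AE \<omega> in M. \<forall>\<beta>\<in>ball \<beta>0 r. (\<Sum>j<p t. \<Sum>l<p t. (inv_mat (C t \<beta> (X t i \<omega>)) $$ (j, l) - inv_mat (C t \<beta>0 (X t i \<omega>)) $$ (j, l)
        - (\<Sum>k\<in>UNIV. vec_nth (\<beta> - \<beta>0) k * - (inv_mat (C t \<beta>0 (X t i \<omega>)) *
        (dC t [k] \<beta>0 (X t i \<omega>) * inv_mat (C t \<beta>0 (X t i \<omega>)))) $$ (j, l)))\<^sup>2) \<le> norm (\<beta> - \<beta>0) ^ 4 * V \<omega>"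
      using st.inverse_remainder unfolding dC0 by blast
    show "\<exists>V. integrable M V \<and> (\<forall>\<omega>. 0 \<le> V \<omega>) \<and> integral\<^sup>L M V \<le> ?\<kappa> * real (p t) \<and>
         (AE \<omega> in M. norm (\<beta>hat t \<omega> - \<beta>0) < r \<longrightarrow>
            (\<Sum>j<p t. \<Sum>l<p t. (inv_mat (C t (\<beta>hat t \<omega>) (X t i \<omega>)) $$ (j, l) - inv_mat (C t \<beta>0 (X t i \<omega>)) $$ (j, l)
               - (\<Sum>k\<in>UNIV. vec_nth (\<beta>hat t \<omega> - \<beta>0) k * - (inv_mat (C t \<beta>0 (X t i \<omega>)) *
        (dC t [k] \<beta>0 (X t i \<omega>) * inv_mat (C t \<beta>0 (X t i \<omega>)))) $$ (j, l)))\<^sup>2)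
            \<le> norm (\<beta>hat t \<omega> - \<beta>0) ^ 4 * V \<omega>)"
    proof (intro exI[of _ V] conjI V(1-3))
      show "AE \<omega> in M. norm (\<beta>hat t \<omega> - \<beta>0) < r \<longrightarrow>
            (\<Sum>j<p t. \<Sum>l<p t. (inv_mat (C t (\<beta>hat t \<omega>) (X t i \<omega>)) $$ (j, l) - inv_mat (C t \<beta>0 (X t i \<omega>)) $$ (j, l)
               - (\<Sum>k\<in>UNIV. vec_nth (\<beta>hat t \<omega> - \<beta>0) k * - (inv_mat (C t \<beta>0 (X t i \<omega>)) *
        (dC t [k] \<beta>0 (X t i \<omega>) * inv_mat (C t \<beta>0 (X t i \<omega>)))) $$ (j, l)))\<^sup>2)
            \<le> norm (\<beta>hat t \<omega> - \<beta>0) ^ 4 * V \<omega>"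
        using V(4) by eventually_elim (use ball in blast)
    qed
  qed simp
  ultimately show ?thesis by blast
qed

end
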